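(* Let $\mathcal F\in\{A\mathrm J,B\mathrm J,A\mathrm M,B\mathrm M\}$ be any of the four families of interpolation polynomials, let $\lambda,\mu\in\mathcal P_n$ and put $k=|\lambda|-|\mu|$. Then $$\binom\lambda\mu=\sum_{\zeta\in\mathfrak C_{\lambda\mu}}\mathrm{wt}(\zeta)\prod_{i=0}^{k-1}\binom{\zeta_i}{\zeta_{i+1}},\qquad \mathrm{wt}(\zeta)=\prod_{i=0}^{k-1}\frac{\|\overline{\zeta_i}\|-\|\overline{\zeta_{i+1}}\|}{\|\overline{\zeta_0}\|-\|\overline{\zeta_{i+1}}\|},$$ where $\mathfrak C_{\lambda\mu}$ is the set of saturated chains $\zeta=(\zeta_0,\dots,\zeta_k)$ from $\lambda$ to $\mu$ (an empty sum being $0$ and an empty product $1$).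
   Context: Fix $n\geqslant1$. $\mathcal P_n=\{\lambda\in\mathbb Z^n:\lambda_1\geqslant\cdots\geqslant\lambda_n\geqslant0\}$, $|\lambda|=\lambda_1+\dots+\lambda_n$; $\lambda\supseteq\mu$ means $\lambda_i\geqslant\mu_i$ for all $i$; $\lambda\gtrdot\mu$ means $\lambda\supseteq\mu$ and $|\lambda|=|\mu|+1$. A saturated chain from $\lambda$ to $\mu$ is a sequence in $\mathcal P_n$ with $\lambda=\zeta_0\gtrdot\zeta_1\gtrdot\cdots\gtrdot\zeta_k=\mu$. The four families $\mathcal F$ have the following data (base field $\mathbb F$, ring $\Lambda$, shifting map $\mathcal P_n\to\mathbb F^n$, $\lambda\mapsto\overline\lambda$, and "norm" $\|x\|$), with indeterminate parameters: - $A\mathrm J$: $\mathbb F=\mathbb Q(\tau)$; $\Lambda=\mathbb F[x_1,\dots,x_n]^{S_n}$; $\overline\lambda_i=\lambda_i+(n-i)\tau$; $\|x\|=\sum_i x_i$. - $B\mathrm J$: $\mathbb F=\mathbb Q(\tau,\alpha)$; $\Lambda=\mathbb F[x_1^2,\dots,x_n^2]^{S_n}$; $\overline\lambda_i=\lambda_i+(n-i)\tau+\alpha$; $\|x\|=\sum_i x_i^2$. - $A\mathrm M$: $\mathbb F=\mathbb Q(q,t)$; $\Lambda=\mathbb F[x_1,\dots,x_n]^{S_n}$; $\overline\lambda_i=q^{\lambda_i}t^{n-i}$; $\|x\|=\sum_i x_i$. - $B\mathrm M$: $\mathbb F=\mathbb Q(q,t,a)$; $\Lambda=\mathbb F[x_1+x_1^{-1},\dots,x_n+x_n^{-1}]^{S_n}$;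 $\overline\lambda_i=aq^{\lambda_i}t^{n-i}$; $\|x\|=\sum_i(x_i+x_i^{-1})$. The degree of a Laurent polynomial is the maximum of $|\alpha_1|+\dots+|\alpha_n|$ over monomials $x^\alpha$ occurring in it. For $\mu\in\mathcal P_n$, the (unital) interpolation polynomial $h_\mu$ is the unique element of $\Lambda$ of degree at most $|\mu|$ (at most $2|\mu|$ when $\mathcal F=B\mathrm J$) with $h_\mu(\overline\lambda)=\delta_{\lambda\mu}$ for all $\lambda\in\mathcal P_n$ with $|\lambda|\leqslant|\mu|$ (existence and uniqueness are known). The binomial coefficients are $\binom{\lambda}{\mu}=h_\mu(\overline\lambda)\in\mathbb F$. *)

theory Defs
  imports
    Complex_Main
    "HOL-Library.Poly_Mapping"
    "HOL-Combinatorics.Permutations"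
    "HOL-Computational_Algebra.Polynomial"
    "HOL-Computational_Algebra.Fraction_Field"
begin

section \<open>Partitions and saturated chains\<close>

text \<open>Elements of \<open>\<int>\<^sup>n\<close> with nonnegative entries are functions on \<open>{1..n}\<close>, extended by
  \<open>0\<close> to all of \<open>nat\<close> so that equality of functions is equality of tuples.\<close>

definition partitions :: "nat \<Rightarrow> (nat \<Rightarrow> nat) set" where
  "partitions n = {l. (\<forall>i\<in>{1..n}. \<forall>j\<in>{1..n}. i \<le> j \<longrightarrow> l j \<le> l i) \<and> (\<forall>i. i \<notin> {1..n} \<longrightarrow> l i = 0)}"

definition psize :: "nat \<Rightarrow> (nat \<Rightarrow> nat) \<Rightarrow> nat" where
  "psize n l = (\<Sum>i=1..n. l i)"

definition contains :: "nat \<Rightarrow> (nat \<Rightarrow> nat) \<Rightarrow> (nat \<Rightarrow> nat) \<Rightarrow> bool" where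
  "contains n l m \<longleftrightarrow> (\<forall>i\<in>{1..n}. m i \<le> l i)"

definition covers :: "nat \<Rightarrow> (nat \<Rightarrow> nat) \<Rightarrow> (nat \<Rightarrow> nat) \<Rightarrow> bool" where
  "covers n l m \<longleftrightarrow> contains n l m \<and> psize n l = psize n m + 1"

definition saturated_chains :: "nat \<Rightarrow> (nat \<Rightarrow> nat) \<Rightarrow> (nat \<Rightarrow> nat) \<Rightarrow> (nat \<Rightarrow> nat) list set" where
  "saturated_chains n l m =
     {z. z \<noteq> [] \<and> set z \<subseteq> partitions n \<and> hd z = l \<and> last z = m \<and> successively (covers n) z}"

text \<open>The length of a saturated chain is determined by its end points, and the set of such
  chains is finite, so a sum over it is an honest finite sum.\<close>

lemma saturated_chain_length:
  assumes "z \<in> saturated_chains n l m"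
  shows "psize n l = psize n m + (length z - 1)" and "length z = psize n l - psize n m + 1"
proof -
  have aux: "z \<noteq> [] \<Longrightarrow> successively (covers n) z \<Longrightarrow>
      psize n (hd z) = psize n (last z) + (length z - 1)" for z
    by (induction z rule: induct_list012) (auto simp: covers_def)
  show 1: "psize n l = psize n m + (length z - 1)"
    using assms aux[of z] by (auto simp: saturated_chains_def)
  show "length z = psize n l - psize n m + 1"
    using 1 assms by (cases z) (auto simp: saturated_chains_def)
qed

lemma finite_partitions_psize_le: "finite {l \<in> partitions n. psize n l \<le> d}"
proof (rule finite_subset)
  show "{l \<in> partitions n. psize n l \<le> d} \<subseteq>
      {l. \<forall>i. (i \<in> {1..n} \<longrightarrow> l i \<in> {..d}) \<and> (i \<notin> {1..n} \<longrightarrow> l i = 0)}"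
  proof (intro subsetI CollectI allI conjI impI)
    fix l i assume l: "l \<in> {l \<in> partitions n. psize n l \<le> d}"
    show "l i \<in> {..d}" if "i \<in> {1..n}"
      using l that member_le_sum[of i "{1..n}" l] by (auto simp: psize_def)
    show "l i = 0" if "i \<notin> {1..n}"
      using l that by (auto simp: partitions_def)
  qed
  show "finite {l. \<forall>i. (i \<in> {1..n} \<longrightarrow> l i \<in> {..d}) \<and> (i \<notin> {1..n} \<longrightarrow> l i = (0::nat))}"
    by (rule finite_set_of_finite_funs) auto
qed

lemma finite_saturated_chains: "finite (saturated_chains n l m)"
proof (rule finite_subset)
  have aux: "x \<in> set z \<Longrightarrow> successively (covers n) z \<Longrightarrow> psize n x \<le> psize n (hd z)" for x z
    by (induction z rule: induct_list012) (auto simp: covers_def)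
  show "saturated_chains n l m \<subseteq> {z. set z \<subseteq> {x \<in> partitions n. psize n x \<le> psize n l} \<and>
      length z = psize n l - psize n m + 1}"
    using aux saturated_chain_length(2) by (fastforce simp: saturated_chains_def)
  show "finite {z. set z \<subseteq> {x \<in> partitions n. psize n x \<le> psize n l} \<and>
      length z = psize n l - psize n m + 1}"
    by (intro finite_lists_length_eq finite_partitions_psize_le)
qed


section \<open>Laurent polynomials\<close>

text \<open>A Laurent polynomial is the finitely supported function sending an exponent vector to its
  coefficient; multiplication is convolution, from \<open>HOL-Library.Poly_Mapping\<close>. The type has
  variables \<open>x\<^sub>i\<close> for all \<open>i :: nat\<close>; the rings below only involve \<open>x\<^sub>1, \<dots>, x\<^sub>n\<close>.\<close>

type_synonym 'a laurent = "(nat \<Rightarrow>\<^sub>0 int) \<Rightarrow>\<^sub>0 'a"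

definition lconst :: "'a::field \<Rightarrow> 'a laurent" where
  "lconst c = Poly_Mapping.single 0 c"

text \<open>\<open>lvar i k\<close> is \<open>x\<^sub>i\<close> to the power \<open>k\<close>.\<close>

definition lvar :: "nat \<Rightarrow> int \<Rightarrow> 'a::field laurent" where
  "lvar i k = Poly_Mapping.single (Poly_Mapping.single i k) 1"

definition leval :: "'a::field laurent \<Rightarrow> (nat \<Rightarrow> 'a) \<Rightarrow> 'a" where
  "leval f x = (\<Sum>m\<in>Poly_Mapping.keys f. Poly_Mapping.lookup f m *
      (\<Prod>i\<in>Poly_Mapping.keys m. x i powi Poly_Mapping.lookup m i))"

text \<open>The zero polynomial gets degree \<open>0\<close>; this is harmless, as only upper bounds are imposed.\<close>

definition ldegree :: "'a::field laurent \<Rightarrow> nat" where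
  "ldegree f = Max (insert 0
     ((\<lambda>m. \<Sum>i\<in>Poly_Mapping.keys m. nat \<bar>Poly_Mapping.lookup m i\<bar>) ` Poly_Mapping.keys f))"

definition lsymmetric :: "nat \<Rightarrow> 'a::field laurent \<Rightarrow> bool" where
  "lsymmetric n f \<longleftrightarrow> (\<forall>s m. s permutes {1..n} \<longrightarrow>
     Poly_Mapping.lookup f (Poly_Mapping.map_key s m) = Poly_Mapping.lookup f m)"

text \<open>The subalgebra generated by a set of Laurent polynomials.\<close>

inductive_set adjoin :: "'a::field laurent set \<Rightarrow> 'a laurent set" for G where
  adjoin_const: "lconst c \<in> adjoin G"
| adjoin_gen: "g \<in> G \<Longrightarrow> g \<in> adjoin G"
| adjoin_add: "f \<in> adjoin G \<Longrightarrow> g \<in> adjoin G \<Longrightarrow> f + g \<in> adjoin G"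
| adjoin_mult: "f \<in> adjoin G \<Longrightarrow> g \<in> adjoin G \<Longrightarrow> f * g \<in> adjoin G"


section \<open>Interpolation polynomials and binomial coefficients\<close>

text \<open>In a family, \<open>gen i\<close> is the \<open>i\<close>-th generator, so that \<open>\<Lambda>\<close> is the ring of symmetric
  elements of the algebra generated by \<open>gen 1, \<dots>, gen n\<close>; \<open>h\<^sub>\<mu>\<close> has degree at most
  \<open>deg_factor * \<bar>\<mu>\<bar>\<close>.\<close>

record (overloaded) ('a :: field) family =
  nvars :: nat
  gen :: "nat \<Rightarrow> 'a laurent"
  shifted :: "(nat \<Rightarrow> nat) \<Rightarrow> nat \<Rightarrow> 'a"
  pnorm :: "(nat \<Rightarrow> 'a) \<Rightarrow> 'a"
  deg_factor :: nat

definition Lambda :: "'a::field family \<Rightarrow> 'a laurent set" where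
  "Lambda F = {f \<in> adjoin (gen F ` {1..nvars F}). lsymmetric (nvars F) f}"

definition is_interp_poly :: "'a::field family \<Rightarrow> (nat \<Rightarrow> nat) \<Rightarrow> 'a laurent \<Rightarrow> bool" where
  "is_interp_poly F m h \<longleftrightarrow>
     h \<in> Lambda F \<and> ldegree h \<le> deg_factor F * psize (nvars F) m \<and>
     (\<forall>l\<in>partitions (nvars F). psize (nvars F) l \<le> psize (nvars F) m \<longrightarrow>
        leval h (shifted F l) = (if l = m then 1 else 0))"

definition interp_poly :: "'a::field family \<Rightarrow> (nat \<Rightarrow> nat) \<Rightarrow> 'a laurent" where
  "interp_poly F m = (THE h. is_interp_poly F m h)"

definition binom :: "'a::field family \<Rightarrow> (nat \<Rightarrow> nat) \<Rightarrow> (nat \<Rightarrow> nat) \<Rightarrow> 'a" where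
  "binom F l m = leval (interp_poly F m) (shifted F l)"

definition chain_wt :: "'a::field family \<Rightarrow> (nat \<Rightarrow> nat) list \<Rightarrow> 'a" where
  "chain_wt F z = (\<Prod>i<length z - 1.
     (pnorm F (shifted F (z ! i)) - pnorm F (shifted F (z ! Suc i))) /
     (pnorm F (shifted F (z ! 0)) - pnorm F (shifted F (z ! Suc i))))"


section \<open>The four families\<close>

text \<open>The field of rational functions over \<open>\<rat>\<close> in one, two or three indeterminates is the fraction
  field of the iterated polynomial ring; e.g. \<open>\<rat>(q,t,a)\<close> is \<open>Frac (\<rat>[q][t][a])\<close>.\<close>

definition AJ :: "nat \<Rightarrow> rat poly fract family" where
  "AJ n = (let \<tau> = Fraction_Field.Fract [:0, 1:] 1 in
     \<lparr> nvars = n,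
       gen = (\<lambda>i. lvar i 1),
       shifted = (\<lambda>l i. of_nat (l i) + of_nat (n - i) * \<tau>),
       pnorm = (\<lambda>x. \<Sum>i=1..n. x i),
       deg_factor = 1 \<rparr>)"

definition BJ :: "nat \<Rightarrow> rat poly poly fract family" where
  "BJ n = (let \<tau> = Fraction_Field.Fract [:[:0, 1:]:] 1; \<alpha> = Fraction_Field.Fract [:0, 1:] 1 in
     \<lparr> nvars = n,
       gen = (\<lambda>i. lvar i 2),
       shifted = (\<lambda>l i. of_nat (l i) + of_nat (n - i) * \<tau> + \<alpha>),
       pnorm = (\<lambda>x. \<Sum>i=1..n. (x i)\<^sup>2),
       deg_factor = 2 \<rparr>)"

definition AM :: "nat \<Rightarrow> rat poly poly fract family" where
  "AM n = (let q = Fraction_Field.Fract [:[:0, 1:]:] 1; t = Fraction_Field.Fract [:0, 1:] 1 in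
     \<lparr> nvars = n,
       gen = (\<lambda>i. lvar i 1),
       shifted = (\<lambda>l i. q ^ l i * t ^ (n - i)),
       pnorm = (\<lambda>x. \<Sum>i=1..n. x i),
       deg_factor = 1 \<rparr>)"

definition BM :: "nat \<Rightarrow> rat poly poly poly fract family" where
  "BM n = (let q = Fraction_Field.Fract [:[:[:0, 1:]:]:] 1;
               t = Fraction_Field.Fract [:[:0, 1:]:] 1;
               a = Fraction_Field.Fract [:0, 1:] 1 in
     \<lparr> nvars = n,
       gen = (\<lambda>i. lvar i 1 + lvar i (- 1)),
       shifted = (\<lambda>l i. a * q ^ l i * t ^ (n - i)),
       pnorm = (\<lambda>x. \<Sum>i=1..n. (x i + inverse (x i))),
       deg_factor = 1 \<rparr>)"

end

theory Submission
  imports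
    Defs
    "HOL-Computational_Algebra.Formal_Power_Series"
    "HOL-Computational_Algebra.Polynomial_Factorial"
    "Jordan_Normal_Form.Determinant"
begin

text \<open>
  In suitable variables \<open>y\<^sub>i\<close> (\<open>x\<^sub>i\<close>, \<open>x\<^sub>i\<^sup>2\<close> or \<open>x\<^sub>i + x\<^sub>i\<^sup>-\<^sup>1\<close>) every family evaluates symmetric polynomials of
  degree at most \<open>d\<close> at points \<open>y\<^sub>i = \<phi>(\<lambda>\<^sub>i, n - i)\<close> of a grid \<open>\<phi>\<close>, and the norm is \<open>\<Sum>y\<^sub>i\<close>. Subtracting its
  value at \<open>\<mu>\<close> and multiplying by \<open>h\<^sub>\<mu>\<close> gives a polynomial of degree \<open>\<bar>\<mu>\<bar> + 1\<close> vanishing at all nodes of size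
  at most \<open>\<bar>\<mu>\<bar>\<close>, hence a combination of the \<open>h\<^sub>\<nu>\<close> with \<open>\<bar>\<nu>\<bar> = \<bar>\<mu>\<bar> + 1\<close>; iterating this Pieri rule yields the
  sum over chains, provided that \<open>h\<^sub>\<mu>\<close> vanishes at every such \<open>\<nu>\<close> not containing \<open>\<mu>\<close>. This extra vanishing is
  proved with difference operators that lower the degree: on all four grids, \<open>\<phi>(a \<plusminus> 1, b)\<close> and \<open>\<phi>(a, b \<plusminus> 1)\<close>
  have the form \<open>A(\<phi>) \<mp> c \<delta>\<close> with \<open>A\<close> linear and \<open>\<delta>\<^sup>2\<close> a quadratic polynomial in \<open>\<phi>\<close>, and this alone makes the operators
  preserve polynomiality. Existence and uniqueness of \<open>h\<^sub>\<mu>\<close> come from interpolation by induction on \<open>n\<close> and a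
  dimension count.
\<close>

section \<open>Symmetric polynomial functions\<close>

no_notation vec_index (infixl \<open>$\<close> 100)
unbundle fps_syntax
unbundle no m_inv_syntax

text \<open>A difference operator moves a node by one step in every coordinate, and most of the
  moved points are not partitions. The products over \<open>j\<close> remove these: the factor with
  \<open>b - 1\<close> is zero when row \<open>i\<close> cannot lose a box because the next row is
  equally long, the factor with \<open>b + 1\<close> when row \<open>i\<close> cannot gain one. The
  only boundary left is an empty bottom row, whence \<open>gm 0 0 = 0\<close>; the freedom that
  remains in the coefficients places the zero of \<open>gp\<close>.

  Polynomiality holds because down- and up-terms are conjugate under \<delta> -> -\<delta>, so their
  difference divided by \<delta> is a polynomial in \<phi>. The poles at \<open>y i = y j\<close>
  disappear as in divided differences, which lower the degree by the n - 1 that the products had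
  added.

  The binomials are defined by a description inside a Laurent ring, where the degree counts absolute
  exponents and is only subadditive. Uniqueness therefore also requires that every element of
  \<open>Lambda F\<close> of bounded degree is a combination of equally bounded symmetrised
  monomials in the variables \<open>gen F i\<close>; an argument with leading monomials excludes
  cancellation at the top.\<close>

text \<open>Filtered by degree; power sums generate because the characteristic is \<open>0\<close>.\<close>

inductive symf :: "nat \<Rightarrow> nat \<Rightarrow> ((nat \<Rightarrow> 'a::field_char_0) \<Rightarrow> 'a) \<Rightarrow> bool" for n where
  symf_const: "symf n d (\<lambda>_. c)"
| symf_psum: "r \<le> d \<Longrightarrow> symf n d (\<lambda>y. \<Sum>i=1..n. y i ^ r)"
| symf_add: "symf n d f \<Longrightarrow> symf n d g \<Longrightarrow> symf n d (\<lambda>y. f y + g y)"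
| symf_mult: "symf n d f \<Longrightarrow> symf n e g \<Longrightarrow> d + e \<le> k \<Longrightarrow> symf n k (\<lambda>y. f y * g y)"

lemma symf_mono: "symf n d f \<Longrightarrow> d \<le> k \<Longrightarrow> symf n k f"
  using symf_mult[OF symf_const[of n 0 1], of d f k] by simp

lemma symf_cmult: "symf n d f \<Longrightarrow> symf n d (\<lambda>y. c * f y)"
  using symf_mult[OF symf_const[of n 0 c], of d f d] by simp

lemma symf_diff: "symf n d f \<Longrightarrow> symf n d g \<Longrightarrow> symf n d (\<lambda>y. f y - g y)"
  using symf_add[of n d f "\<lambda>y. - 1 * g y"] symf_cmult[of n d g "- 1"] by simp

lemma symf_sum: "(\<And>a. a \<in> A \<Longrightarrow> symf n d (f a)) \<Longrightarrow> symf n d (\<lambda>y. \<Sum>a\<in>A. f a y)"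
  by (induction A rule: infinite_finite_induct) (auto intro: symf_const symf_add)

lemma symf_cong: "symf n d f \<Longrightarrow> (\<And>i. i \<in> {1..n} \<Longrightarrow> y i = y' i) \<Longrightarrow> f y = f y'"
  by (induction rule: symf.induct) auto

section \<open>Generating series of elementary, complete and power sums\<close>

definition elem_fps :: "nat set \<Rightarrow> (nat \<Rightarrow> 'a::field_char_0) \<Rightarrow> 'a fps" where
  "elem_fps A y = (\<Prod>j\<in>A. 1 - fps_const (y j) * fps_X)"

text \<open>Coefficient k is the power sum of exponent k + 1, the indexing that makes this the
  negative logarithmic derivative of \<open>elem_fps\<close>. The coefficients of
  \<open>elem_fps\<close> are the elementary symmetric polynomials with alternating signs.\<close>

definition psum_fps :: "nat set \<Rightarrow> (nat \<Rightarrow> 'a::field_char_0) \<Rightarrow> 'a fps" where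
  "psum_fps A y = (\<Sum>j\<in>A. fps_const (y j) * Abs_fps (\<lambda>k. y j ^ k))"

lemma geometric_fps: "(1 - fps_const c * fps_X) * Abs_fps (\<lambda>k. c ^ k) = (1 :: 'a::field_char_0 fps)"
proof (rule fps_ext)
  fix k
  show "((1 - fps_const c * fps_X) * Abs_fps (\<lambda>k. c ^ k)) $ k = 1 $ k"
    by (cases k) (auto simp: left_diff_distrib mult.assoc)
qed

lemma elem_fps_nth_0: "finite A \<Longrightarrow> elem_fps A y $ 0 = 1"
  by (induction A rule: finite_induct) (auto simp: elem_fps_def)

lemma elem_fps_insert:
  "finite A \<Longrightarrow> x \<notin> A \<Longrightarrow> elem_fps (insert x A) y = (1 - fps_const (y x) * fps_X) * elem_fps A y"
  by (simp add: elem_fps_def)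

lemma psum_fps_nth: "finite A \<Longrightarrow> psum_fps A y $ k = (\<Sum>j\<in>A. y j ^ Suc k)"
  by (simp add: psum_fps_def fps_sum_nth)

lemma elem_fps_deriv: "finite A \<Longrightarrow> fps_deriv (elem_fps A y) = - elem_fps A y * psum_fps A y"
proof (induction A rule: finite_induct)
  case empty
  then show ?case by (simp add: elem_fps_def psum_fps_def)
next
  case (insert x A)
  have 1: "elem_fps (insert x A) y = (1 - fps_const (y x) * fps_X) * elem_fps A y"
    and 2: "psum_fps (insert x A) y = fps_const (y x) * Abs_fps (\<lambda>k. y x ^ k) + psum_fps A y"
    using insert by (auto simp: elem_fps_def psum_fps_def)
  have ring: "u * (- E * P) + (- a) * E = - (u * E) * (a * G + P)" if "u * G = 1" for u G a E P :: "'a fps"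
  proof -
    have "- (u * E) * (a * G + P) = - (u * G) * (a * E) + u * (- E * P)" by (simp add: algebra_simps)
    then show ?thesis using that by simp
  qed
  have "fps_deriv (1 - fps_const (y x) * fps_X) = - fps_const (y x)"
    by (simp only: fps_deriv_sub fps_deriv_mult fps_deriv_fps_X fps_deriv_const fps_deriv_1 mult_1_right
        mult_zero_left add_0_right diff_0)
  then show ?case
    unfolding 1 2 fps_deriv_mult insert.IH using ring[OF geometric_fps] by (simp only:)
qed

definition comp_fps :: "nat set \<Rightarrow> (nat \<Rightarrow> 'a::field_char_0) \<Rightarrow> 'a fps" where
  "comp_fps A y = inverse (elem_fps A y)"

lemma elem_comp_fps: "finite A \<Longrightarrow> elem_fps A y * comp_fps A y = 1"
  unfolding comp_fps_def by (metis elem_fps_nth_0 inverse_mult_eq_1' zero_neq_one)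

lemma comp_fps_deriv: "finite A \<Longrightarrow> fps_deriv (comp_fps A y) = comp_fps A y * psum_fps A y"
proof -
  assume A: "finite A"
  have "0 = fps_deriv (elem_fps A y * comp_fps A y)"
    by (simp add: elem_comp_fps A)
  also have "\<dots> = elem_fps A y * fps_deriv (comp_fps A y) - (elem_fps A y * comp_fps A y) * psum_fps A y"
    by (simp add: elem_fps_deriv A algebra_simps)
  finally have "elem_fps A y * fps_deriv (comp_fps A y) = psum_fps A y"
    by (simp add: elem_comp_fps A)
  then have "(elem_fps A y * comp_fps A y) * fps_deriv (comp_fps A y) = comp_fps A y * psum_fps A y"
    by (metis mult.assoc mult.commute)
  then show ?thesis by (simp add: elem_comp_fps A)
qed

text \<open>Newton's identities in the form of the logarithmic derivative.\<close>

lemma symf_fps_log_deriv: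
  assumes d: "\<And>y. fps_deriv (F y) = fps_const c * F y * psum_fps {1..n} y"
    and z: "\<And>y. F y $ 0 = (1 :: 'a::field_char_0)"
  shows "symf n k (\<lambda>y. F y $ k)"
proof (induction k rule: less_induct)
  case (less k)
  show ?case
  proof (cases k)
    case 0
    then show ?thesis by (simp add: z symf_const)
  next
    case (Suc m)
    have "F y $ Suc m = c / of_nat (Suc m) * (\<Sum>i=0..m. F y $ i * (\<Sum>j=1..n. y j ^ Suc (m - i)))" for y
    proof -
      have "of_nat (Suc m) * F y $ Suc m = fps_deriv (F y) $ m" by simp
      also have "\<dots> = c * (\<Sum>i=0..m. F y $ i * (\<Sum>j=1..n. y j ^ Suc (m - i)))"
        unfolding d mult.assoc fps_mult_left_const_nth by (simp add: fps_mult_nth psum_fps_nth)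
      finally show ?thesis by (simp add: field_simps del: of_nat_Suc)
    qed
    moreover have "symf n k (\<lambda>y. c / of_nat (Suc m) * (\<Sum>i=0..m. F y $ i * (\<Sum>j=1..n. y j ^ Suc (m - i))))"
      using Suc by (intro symf_cmult symf_sum symf_mult[OF less.IH symf_psum[OF order_refl]]) auto
    ultimately show ?thesis by (simp only: Suc)
  qed
qed

lemma fps_const_neg_1: "fps_const (- 1) = (- 1 :: 'a::ring_1 fps)"
  by (metis fps_const_1_eq_1 fps_const_neg)

lemma symf_elem: "symf n k (\<lambda>y. elem_fps {1..n} y $ k)"
proof (rule symf_fps_log_deriv)
  show "fps_deriv (elem_fps {1..n} y) = fps_const (- 1) * elem_fps {1..n} y * psum_fps {1..n} y" for y :: "nat \<Rightarrow> 'a"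
    using elem_fps_deriv[of "{1..n}" y] by (simp only: fps_const_neg_1 finite_atLeastAtMost mult_minus_left mult_1)
qed (simp add: elem_fps_nth_0)

lemma symf_comp: "symf n k (\<lambda>y. comp_fps {1..n} y $ k)"
proof (rule symf_fps_log_deriv)
  show "fps_deriv (comp_fps {1..n} y) = fps_const 1 * comp_fps {1..n} y * psum_fps {1..n} y" for y :: "nat \<Rightarrow> 'a"
    using comp_fps_deriv[of "{1..n}" y] by simp
qed (simp add: comp_fps_def elem_fps_nth_0)

lemma prod_diff_eq_elem:
  "finite A \<Longrightarrow> (\<Prod>j\<in>A. z - y j) = (\<Sum>k\<le>card A. elem_fps A y $ k * z ^ (card A - k))"
proof (induction A rule: finite_induct)
  case empty
  then show ?case by (simp add: elem_fps_def)
next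
  case (insert x A)
  let ?N = "card A"
  have E: "elem_fps (insert x A) y = elem_fps A y - fps_const (y x) * (fps_X * elem_fps A y)"
    unfolding elem_fps_insert[OF insert.hyps] by (simp only: left_diff_distrib mult_1 mult.assoc)
  \<comment> \<open>The series is a polynomial of degree at most \<open>card A\<close>, so the sum
    may be lengthened by one term to match the index range of \<open>insert x A\<close>.\<close>
  have top: "elem_fps A y $ Suc ?N = 0"
  proof -
    have "finite B \<Longrightarrow> card B < k \<Longrightarrow> elem_fps B y $ k = 0" for B k
    proof (induction B arbitrary: k rule: finite_induct)
      case empty
      then show ?case by (simp add: elem_fps_def)
    next
      case (insert b B)
      then have "elem_fps (insert b B) y = elem_fps B y - fps_const (y b) * (fps_X * elem_fps B y)"
        unfolding elem_fps_insert[OF insert.hyps] by (simp only: left_diff_distrib mult_1 mult.assoc)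
      then show ?case using insert by (cases k) auto
    qed
    then show ?thesis using insert by simp
  qed
  have "(\<Sum>k\<le>Suc ?N. elem_fps (insert x A) y $ k * z ^ (Suc ?N - k)) =
     (\<Sum>k\<le>Suc ?N. elem_fps A y $ k * z ^ (Suc ?N - k)) -
     (\<Sum>k\<le>Suc ?N. (fps_const (y x) * (fps_X * elem_fps A y)) $ k * z ^ (Suc ?N - k))"
    unfolding E by (simp add: sum_subtractf left_diff_distrib)
  also have "(\<Sum>k\<le>Suc ?N. elem_fps A y $ k * z ^ (Suc ?N - k)) = z * (\<Sum>k\<le>?N. elem_fps A y $ k * z ^ (?N - k))"
    by (simp add: top sum_distrib_left) (intro sum.cong, auto simp: Suc_diff_le)
  also have "(\<Sum>k\<le>Suc ?N. (fps_const (y x) * (fps_X * elem_fps A y)) $ k * z ^ (Suc ?N - k)) =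
      y x * (\<Sum>k\<le>?N. elem_fps A y $ k * z ^ (?N - k))"
    unfolding sum.atMost_Suc_shift by (simp add: sum_distrib_left mult_ac)
  finally show ?case using insert by (simp add: algebra_simps)
qed

lemma symf_prod_diff: "symf n n (\<lambda>y. \<Prod>i=1..n. y i - c)"
proof -
  have "(\<Prod>i=1..n. y i - c) = (- 1) ^ n * (\<Sum>k\<le>n. c ^ (n - k) * elem_fps {1..n} y $ k)" for y :: "nat \<Rightarrow> 'a"
  proof -
    have "(\<Prod>i=1..n. y i - c) = (\<Prod>i=1..n. (- 1) * (c - y i))" by simp
    also have "\<dots> = (- 1) ^ n * (\<Prod>i=1..n. c - y i)" by (subst prod.distrib) simp
    finally show ?thesis by (simp add: prod_diff_eq_elem mult.commute)
  qed
  then show ?thesis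
    using symf_cmult[OF symf_sum[of "{..n}" n n, OF symf_cmult[OF symf_mono[OF symf_elem]]]] by auto
qed

text \<open>Both sides satisfy the recursion of divided differences.\<close>

lemma sum_power_over_prod_diff:
  fixes y :: "nat \<Rightarrow> 'a::field_char_0"
  assumes "finite A" "A \<noteq> {}" "inj_on y A"
  shows "(\<Sum>i\<in>A. y i ^ m / (\<Prod>j\<in>A - {i}. y i - y j)) = (fps_X ^ card A * comp_fps A y) $ Suc m"
  using assms
proof (induction "card A" arbitrary: A rule: less_induct)
  case less
  show ?case
  proof (cases "\<exists>p. A = {p}")
    case True
    then obtain p where A: "A = {p}" by blast
    have "comp_fps {p} y = Abs_fps (\<lambda>k. y p ^ k)"
    proof -
      have uniq: "c = g" if "e * c = 1" "e * g = 1" for e c g :: "'a fps"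
        using that by (metis mult.commute mult.left_commute mult_1_right)
      show ?thesis
        by (rule uniq[OF elem_comp_fps]) (simp_all only: elem_fps_def geometric_fps finite.intros prod.insert
            prod.empty mult_1_right finite.emptyI empty_iff not_False_eq_True)
    qed
    then show ?thesis using A by simp
  next
    case False
    then obtain p q where pq: "p \<in> A" "q \<in> A" "p \<noteq> q" using less(3) by blast
    have ne: "y p - y q \<noteq> 0" using pq less(4) by (auto simp: inj_on_def)
    define S where "S B = (\<Sum>i\<in>B. y i ^ m / (\<Prod>j\<in>B - {i}. y i - y j))" for B
    have IH: "S B = (fps_X ^ card B * comp_fps B y) $ Suc m" if "B = A - {p} \<or> B = A - {q}" for B
      unfolding S_def
    proof (rule less.hyps)
      show "card B < card A" using that pq less(2) by (auto intro: card_Diff1_less)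
      show "inj_on y B" using that less(4) by (auto intro: inj_on_subset)
    qed (use that pq less(2) in auto)
    have rem: "(y i - y r) / (\<Prod>j\<in>A - {i}. y i - y j) = 1 / (\<Prod>j\<in>A - {r} - {i}. y i - y j)"
      if "i \<in> A" "r \<in> A" "i \<noteq> r" for i r
    proof -
      have "A - {i} = insert r (A - {r} - {i})" using that by auto
      then have "(\<Prod>j\<in>A - {i}. y i - y j) = (y i - y r) * (\<Prod>j\<in>A - {r} - {i}. y i - y j)"
        using less(2) by simp
      moreover have "y i - y r \<noteq> 0" using that less(4) by (auto simp: inj_on_def)
      ultimately show ?thesis by simp
    qed
    have drop: "(\<Sum>i\<in>A. y i ^ m * (y i - y r) / (\<Prod>j\<in>A - {i}. y i - y j)) = S (A - {r})" if "r \<in> A" for r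
    proof -
      have "(\<Sum>i\<in>A. y i ^ m * (y i - y r) / (\<Prod>j\<in>A - {i}. y i - y j)) =
          (\<Sum>i\<in>A - {r}. y i ^ m * ((y i - y r) / (\<Prod>j\<in>A - {i}. y i - y j)))"
        using less(2) that by (subst sum.remove[of _ r]) auto
      also have "\<dots> = S (A - {r})"
        unfolding S_def using that by (intro sum.cong refl) (simp add: rem)
      finally show ?thesis .
    qed
    have comb: "(u - v) * (a / b) = a * (x - v) / b - a * (x - u) / b" for a b u v x :: 'a
      unfolding diff_divide_distrib[symmetric] by (simp add: algebra_simps)
    \<comment> \<open>For every i, \<open>y p - y q = (y i - y q) - (y i - y p)\<close>; each of the
      two differences kills one summand and cancels one factor in the denominators of the
      others.\<close>
    have "(y p - y q) * S A = S (A - {q}) - S (A - {p})"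
      unfolding drop[OF pq(1), symmetric] drop[OF pq(2), symmetric] sum_subtractf[symmetric]
      unfolding S_def sum_distrib_left
      by (intro sum.cong refl comb)
    also have "\<dots> = (y p - y q) * (fps_X ^ card A * comp_fps A y) $ Suc m"
    proof -
      have cd: "card A = Suc (card (A - {r}))" if "r \<in> A" for r
        using that less(2) by (metis card_Suc_Diff1)
      have cancel: "c' = u * c" if "e = u * e'" "e * c = 1" "e' * c' = 1" for e c u e' c' :: "'a fps"
      proof -
        have "u * c = u * c * (e' * c')" using that by simp
        also have "\<dots> = (u * e') * c * c'" by (simp only: mult_ac)
        also have "(u * e') * c = 1" using that by metis
        finally show ?thesis by simp
      qed
      have cmp: "comp_fps (A - {r}) y = (1 - fps_const (y r) * fps_X) * comp_fps A y" if "r \<in> A" for r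
      proof -
        have "elem_fps A y = (1 - fps_const (y r) * fps_X) * elem_fps (A - {r}) y"
          using elem_fps_insert[of "A - {r}" r y] that less(2) by (simp only: finite_Diff insert_Diff Diff_iff insert_iff simp_thms)
        then show ?thesis
          by (rule cancel[OF _ elem_comp_fps[OF less(2)] elem_comp_fps]) (use less(2) in simp)
      qed
      obtain c where c: "card A = Suc c" using cd[OF pq(1)] by blast
      then have c': "card (A - {p}) = c" "card (A - {q}) = c" using cd[OF pq(1)] cd[OF pq(2)] by simp_all
      have ring: "(1 - v * X) * C - (1 - u * X) * C = (u - v) * (X * C)" for u v X C :: "'a fps"
        by (simp add: algebra_simps)
      have ring2: "X ^ c * (k * (X * C)) = k * (X ^ Suc c * C)" for k X C :: "'a fps"
        by (simp add: mult_ac)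
      have "S (A - {q}) - S (A - {p}) = (fps_X ^ c * (comp_fps (A - {q}) y - comp_fps (A - {p}) y)) $ Suc m"
        unfolding IH[OF disjI1[OF refl]] IH[OF disjI2[OF refl]] c' right_diff_distrib fps_sub_nth by (rule refl)
      also have "comp_fps (A - {q}) y - comp_fps (A - {p}) y = fps_const (y p - y q) * (fps_X * comp_fps A y)"
        unfolding cmp[OF pq(1)] cmp[OF pq(2)] fps_const_sub[symmetric] by (rule ring)
      also have "fps_X ^ c * (fps_const (y p - y q) * (fps_X * comp_fps A y)) = fps_const (y p - y q) * (fps_X ^ card A * comp_fps A y)"
        unfolding c by (rule ring2)
      finally show ?thesis by (simp only: fps_mult_left_const_nth)
    qed
    finally show ?thesis using ne by (simp only: S_def mult_cancel_left simp_thms)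
  qed
qed


section \<open>Degree-lowering difference operators\<close>

text \<open>Sums of terms \<open>c(y) u\<^sup>s v\<^sup>t\<close> of total degree strictly below \<open>d\<close>; they describe \<open>f\<close> with one
  coordinate \<open>v\<close> replaced by \<open>u\<close>, divided by \<open>u - v\<close>.\<close>

inductive bisymf :: "nat \<Rightarrow> nat \<Rightarrow> ((nat \<Rightarrow> 'a::field_char_0) \<Rightarrow> 'a \<Rightarrow> 'a \<Rightarrow> 'a) \<Rightarrow> bool" for n d where
  bisymf_zero: "bisymf n d (\<lambda>y u v. 0)"
| bisymf_step: "bisymf n d g \<Longrightarrow> symf n e c \<Longrightarrow> e + s + t < d \<Longrightarrow>
    bisymf n d (\<lambda>y u v. g y u v + c y * u ^ s * v ^ t)"

lemma bisymf_term: "symf n e c \<Longrightarrow> e + s + t < d \<Longrightarrow> bisymf n d (\<lambda>y u v. c y * u ^ s * v ^ t)"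
  using bisymf_step[OF bisymf_zero, of n e c s t d] by simp

lemma bisymf_add: "bisymf n d g \<Longrightarrow> bisymf n d f \<Longrightarrow> bisymf n d (\<lambda>y u v. f y u v + g y u v)"
  by (induction rule: bisymf.induct) (auto intro: bisymf_step simp flip: add.assoc)

lemma bisymf_mult_term:
  assumes "bisymf n d g" "symf n e c" "e + s + t + d \<le> k"
  shows "bisymf n k (\<lambda>y u v. c y * u ^ s * v ^ t * g y u v)"
  using assms(1)
proof (induction rule: bisymf.induct)
  case bisymf_zero
  then show ?case by (simp add: bisymf.bisymf_zero)
next
  case (bisymf_step g e' c' s' t')
  have "bisymf n k (\<lambda>y u v. (c y * c' y) * u ^ (s + s') * v ^ (t + t'))"
    by (rule bisymf_term[OF symf_mult[OF assms(2) bisymf_step(2) order_refl]])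
       (use bisymf_step(3) assms(3) in simp)
  from bisymf_add[OF this bisymf_step(4)] show ?case
    by (simp add: power_add algebra_simps)
qed

lemma bisymf_sum: "(\<And>a. a \<in> A \<Longrightarrow> bisymf n d (f a)) \<Longrightarrow> bisymf n d (\<lambda>y u v. \<Sum>a\<in>A. f a y u v)"
proof (induction A rule: infinite_finite_induct)
  case (insert x A)
  then show ?case using bisymf_add[of n d "\<lambda>y u v. \<Sum>a\<in>A. f a y u v" "f x"] by simp
qed (auto intro: bisymf_zero)

text \<open>Both factors have degree strictly below their bounds, which leaves room for the
  additional factor \<open>u - v\<close>. This is the cross term of the Leibniz rule for
  differences.\<close>

lemma bisymf_mult:
  assumes "bisymf n d f" "bisymf n e g" "d + e \<le> k"
  shows "bisymf n k (\<lambda>y u v. (u - v) * f y u v * g y u v)"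
  using assms(1)
proof (induction rule: bisymf.induct)
  case bisymf_zero
  then show ?case by (simp add: bisymf.bisymf_zero)
next
  case (bisymf_step f' e' c s t)
  have 1: "bisymf n k (\<lambda>y u v. c y * u ^ Suc s * v ^ t * g y u v)"
    by (rule bisymf_mult_term[OF assms(2) bisymf_step(2)]) (use bisymf_step(3) assms(3) in simp)
  have 2: "bisymf n k (\<lambda>y u v. (- 1 * c y) * u ^ s * v ^ Suc t * g y u v)"
    by (rule bisymf_mult_term[OF assms(2) symf_cmult[OF bisymf_step(2)]])
       (use bisymf_step(3) assms(3) in simp)
  from bisymf_add[OF 1 bisymf_add[OF 2 bisymf_step(4)]] show ?case
    by (simp add: algebra_simps)
qed

text \<open>For a power sum the quotient is the geometric sum of \<open>u ^ r - v ^ r\<close> over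
  \<open>u - v\<close>; products follow from the Leibniz rule. One \<open>g\<close> serves all i,
  since its coefficients are symmetric in the whole of y, the replaced coordinate included.\<close>

lemma symf_update:
  "symf n d f \<Longrightarrow> \<exists>g. bisymf n d g \<and>
     (\<forall>y u. \<forall>i\<in>{1..n}. f (y(i := u)) - f y = (u - y i) * g y u (y i))"
proof (induction rule: symf.induct)
  case (symf_const d c)
  show ?case by (rule exI[of _ "\<lambda>y u v. 0"]) (simp add: bisymf_zero)
next
  case (symf_psum r d)
  show ?case
  proof (intro exI conjI allI ballI)
    show "bisymf n d (\<lambda>y u v. \<Sum>s<r. 1 * u ^ s * v ^ (r - Suc s))"
      by (intro bisymf_sum bisymf_term[OF symf_const[of n 0]]) (use symf_psum in auto)
    fix y :: "nat \<Rightarrow> 'a" and u i assume i: "i \<in> {1..n}"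
    have "(\<Sum>j=1..n. (y(i := u)) j ^ r) - (\<Sum>j=1..n. y j ^ r) =
      (\<Sum>j=1..n. if j = i then u ^ r - y i ^ r else 0)"
      unfolding sum_subtractf[symmetric] by (intro sum.cong) auto
    also have "\<dots> = u ^ r - y i ^ r" using i by simp
    also have "\<dots> = (u - y i) * (\<Sum>s<r. 1 * u ^ s * y i ^ (r - Suc s))"
      by (simp add: power_diff_sumr2 mult.commute)
    finally show "(\<Sum>j=1..n. (y(i := u)) j ^ r) - (\<Sum>j=1..n. y j ^ r) =
      (u - y i) * (\<Sum>s<r. 1 * u ^ s * y i ^ (r - Suc s))" .
  qed
next
  case (symf_add d f g)
  then obtain f' g' where *: "bisymf n d f'" "bisymf n d g'"
    and f': "\<And>y u i. i \<in> {1..n} \<Longrightarrow> f (y(i := u)) - f y = (u - y i) * f' y u (y i)"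
    and g': "\<And>y u i. i \<in> {1..n} \<Longrightarrow> g (y(i := u)) - g y = (u - y i) * g' y u (y i)"
    by blast
  have eq: "f (y(i := u)) + g (y(i := u)) - (f y + g y) = (u - y i) * (g' y u (y i) + f' y u (y i))"
    if "i \<in> {1..n}" for y u i
  proof -
    have "f (y(i := u)) + g (y(i := u)) - (f y + g y) = (f (y(i := u)) - f y) + (g (y(i := u)) - g y)"
      by simp
    then show ?thesis unfolding f'[OF that] g'[OF that] by (simp add: algebra_simps)
  qed
  show ?case
    by (intro exI[of _ "\<lambda>y u v. g' y u v + f' y u v"] conjI bisymf_add * allI ballI eq)
next
  case (symf_mult d f e g k)
  then obtain f' g' where *: "bisymf n d f'" "bisymf n e g'"
    and f': "\<And>y u i. i \<in> {1..n} \<Longrightarrow> f (y(i := u)) - f y = (u - y i) * f' y u (y i)"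
    and g': "\<And>y u i. i \<in> {1..n} \<Longrightarrow> g (y(i := u)) - g y = (u - y i) * g' y u (y i)"
    by blast
  show ?case
  proof (intro exI conjI allI ballI)
    show "bisymf n k (\<lambda>y u v. ((u - v) * f' y u v * g' y u v + f y * u ^ 0 * v ^ 0 * g' y u v)
        + g y * u ^ 0 * v ^ 0 * f' y u v)"
      using symf_mult by (intro bisymf_add bisymf_mult[OF *] bisymf_mult_term[OF *(1)] bisymf_mult_term[OF *(2)]) auto
    fix y :: "nat \<Rightarrow> 'a" and u i assume i: "i \<in> {1..n}"
    have "f (y(i := u)) = f y + (u - y i) * f' y u (y i)" "g (y(i := u)) = g y + (u - y i) * g' y u (y i)"
      using f'[OF i, of y u] g'[OF i, of y u] by (simp_all add: algebra_simps)
    then show "f (y(i := u)) * g (y(i := u)) - f y * g y = (u - y i) *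
       (((u - y i) * f' y u (y i) * g' y u (y i) + f y * u ^ 0 * y i ^ 0 * g' y u (y i))
        + g y * u ^ 0 * y i ^ 0 * f' y u (y i))"
      by (simp only:) (simp add: algebra_simps)
  qed
qed

text \<open>Dividing \<open>elem_fps {1..n} y\<close> by the factor of index i expresses the product
  over the other indices through \<open>z\<close>, \<open>y i\<close> and coefficients symmetric in
  all variables. Every term has total degree n - 1.\<close>

lemma prod_diff_remove:
  fixes y :: "nat \<Rightarrow> 'a::field_char_0"
  assumes "i \<in> {1..n}"
  shows "(\<Prod>j\<in>{1..n} - {i}. z - y j) = (\<Sum>k<n. \<Sum>l\<le>k. elem_fps {1..n} y $ l * y i ^ (k - l) * z ^ (n - 1 - k))"
proof -
  let ?A = "{1..n} - {i}"
  have fin: "finite ?A" and card: "card ?A = n - 1" using assms by auto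
  have "elem_fps {1..n} y = (1 - fps_const (y i) * fps_X) * elem_fps ?A y"
    using elem_fps_insert[of ?A i y] assms by (simp only: finite_Diff insert_Diff Diff_iff insert_iff simp_thms finite_atLeastAtMost)
  then have "elem_fps {1..n} y * Abs_fps (\<lambda>k. y i ^ k) = elem_fps ?A y * ((1 - fps_const (y i) * fps_X) * Abs_fps (\<lambda>k. y i ^ k))"
    by (simp only: mult_ac)
  then have E: "elem_fps ?A y = elem_fps {1..n} y * Abs_fps (\<lambda>k. y i ^ k)"
    by (simp only: geometric_fps mult_1_right)
  have "{..n - 1} = {..<n}" using assms by auto
  then show ?thesis
    unfolding prod_diff_eq_elem[OF fin] card E
    by (simp add: fps_mult_nth sum_distrib_right atLeast0AtMost)
qed

text \<open>Each monomial of Q contributes a complete homogeneous polynomial. The vanishing for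
  \<open>D + 1 < n\<close> is recorded separately because the truncated subtraction in the degree
  bound would lose it.\<close>

lemma sum_poly_over_prod_diff:
  assumes "n \<ge> 1" "degree Q \<le> D"
  shows "\<exists>G :: (nat \<Rightarrow> 'a::field_char_0) \<Rightarrow> 'a. symf n (D + 1 - n) G \<and> (D + 1 < n \<longrightarrow> G = (\<lambda>_. 0)) \<and>
     (\<forall>y. inj_on y {1..n} \<longrightarrow> (\<Sum>i=1..n. poly Q (y i) / (\<Prod>j\<in>{1..n} - {i}. y i - y j)) = G y)"
proof (intro exI conjI allI impI)
  let ?G = "\<lambda>y. \<Sum>r\<le>degree Q. coeff Q r * (fps_X ^ n * comp_fps {1..n} y) $ Suc r"
  have nth: "(fps_X ^ n * comp_fps {1..n} y) $ Suc r = (if Suc r < n then 0 else comp_fps {1..n} y $ (Suc r - n))" for y :: "nat \<Rightarrow> 'a" and r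
    by (simp add: fps_X_power_mult_nth)
  show "symf n (D + 1 - n) ?G"
  proof (intro symf_sum symf_cmult)
    fix r assume "r \<in> {..degree Q}"
    then have "Suc r - n \<le> D + 1 - n" using assms by auto
    then show "symf n (D + 1 - n) (\<lambda>y :: nat \<Rightarrow> 'a. (fps_X ^ n * comp_fps {1..n} y) $ Suc r)"
      unfolding nth using symf_mono[OF symf_comp[of n "Suc r - n"]] by (cases "Suc r < n") (auto intro: symf_const)
  qed
  show "?G = (\<lambda>_. 0)" if "D + 1 < n"
  proof (intro ext sum.neutral ballI)
    fix y :: "nat \<Rightarrow> 'a" and r assume "r \<in> {..degree Q}"
    then have "Suc r < n" using that assms(2) by simp
    then show "coeff Q r * (fps_X ^ n * comp_fps {1..n} y) $ Suc r = 0"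
      by (simp only: nth if_True mult_zero_right)
  qed
  fix y :: "nat \<Rightarrow> 'a" assume inj: "inj_on y {1..n}"
  have "(\<Sum>i=1..n. poly Q (y i) / (\<Prod>j\<in>{1..n} - {i}. y i - y j)) =
      (\<Sum>i=1..n. \<Sum>r\<le>degree Q. coeff Q r * (y i ^ r / (\<Prod>j\<in>{1..n} - {i}. y i - y j)))"
    by (simp add: poly_altdef sum_divide_distrib)
  also have "\<dots> = (\<Sum>r\<le>degree Q. coeff Q r * (\<Sum>i=1..n. y i ^ r / (\<Prod>j\<in>{1..n} - {i}. y i - y j)))"
    by (subst sum.swap) (simp add: sum_distrib_left)
  also have "\<dots> = ?G y"
    using sum_power_over_prod_diff[OF _ _ inj] assms(1) by simp
  finally show "(\<Sum>i=1..n. poly Q (y i) / (\<Prod>j\<in>{1..n} - {i}. y i - y j)) = ?G y" .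
qed

lemma sum_swap_divide:
  fixes Z :: "nat \<Rightarrow> nat \<Rightarrow> 'b \<Rightarrow> 'a::field"
  shows "(\<Sum>i\<in>I. (\<Sum>k<n. \<Sum>l\<le>k. X k l * Z k l i) / P i) = (\<Sum>k<n. \<Sum>l\<le>k. X k l * (\<Sum>i\<in>I. Z k l i / P i))"
proof -
  have "(\<Sum>i\<in>I. (\<Sum>k<n. \<Sum>l\<le>k. X k l * Z k l i) / P i) = (\<Sum>i\<in>I. \<Sum>k<n. \<Sum>l\<le>k. X k l * (Z k l i / P i))"
    by (simp only: sum_divide_distrib times_divide_eq_right)
  also have "\<dots> = (\<Sum>k<n. \<Sum>i\<in>I. \<Sum>l\<le>k. X k l * (Z k l i / P i))"
    by (rule sum.swap)
  also have "\<dots> = (\<Sum>k<n. \<Sum>l\<le>k. \<Sum>i\<in>I. X k l * (Z k l i / P i))"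
    by (intro sum.cong refl sum.swap)
  finally show ?thesis by (simp only: sum_distrib_left)
qed

text \<open>\<open>gm\<close> and \<open>gp\<close> are the coefficients of the down-shift and the up-shift of one coordinate in a difference
  operator; each may have poles, which cancel in the combinations below.\<close>

definition admissible :: "(int \<Rightarrow> int \<Rightarrow> 'a::field_char_0) \<Rightarrow> (int \<Rightarrow> int \<Rightarrow> 'a) \<Rightarrow> (int \<Rightarrow> int \<Rightarrow> 'a) \<Rightarrow> bool" where
  "admissible \<phi> gm gp \<longleftrightarrow> (\<forall>i j. \<exists>R. degree R \<le> i + j \<and>
     (\<forall>a b. gm a b * \<phi> (a - 1) b ^ i * \<phi> a (b - 1) ^ j + gp a b * \<phi> (a + 1) b ^ i * \<phi> a (b + 1) ^ j = poly R (\<phi> a b)))"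

text \<open>The expression is linear in g, so one term \<open>c y * u ^ s * v ^ t\<close> suffices.
  After expanding the products over \<open>j\<close>, admissibility turns each pair of down- and
  up-terms into a polynomial in \<open>y i\<close>, and the remaining sum over i is a divided
  difference.\<close>

lemma admissible_sum:
  assumes adm: "admissible \<phi> gm gp" and g: "bisymf n d g"
  shows "\<exists>G. symf n (d - 1) G \<and> (\<forall>A B y. y = (\<lambda>i. \<phi> (A i) (B i)) \<longrightarrow> inj_on y {1..n} \<longrightarrow>
    (\<Sum>i=1..n. (gm (A i) (B i) * (\<Prod>j\<in>{1..n} - {i}. \<phi> (A i) (B i - 1) - y j) * g y (\<phi> (A i - 1) (B i)) (y i)
            + gp (A i) (B i) * (\<Prod>j\<in>{1..n} - {i}. \<phi> (A i) (B i + 1) - y j) * g y (\<phi> (A i + 1) (B i)) (y i))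
       / (\<Prod>j\<in>{1..n} - {i}. y i - y j)) = G y)"
  using g
proof (induction rule: bisymf.induct)
  case bisymf_zero
  show ?case by (rule exI[of _ "\<lambda>_. 0"]) (simp add: symf_const)
next
  case (bisymf_step g e c s t)
  then obtain G where G: "symf n (d - 1) G" and Gy: "\<And>A B y. y = (\<lambda>i. \<phi> (A i) (B i)) \<Longrightarrow> inj_on y {1..n} \<Longrightarrow>
    (\<Sum>i=1..n. (gm (A i) (B i) * (\<Prod>j\<in>{1..n} - {i}. \<phi> (A i) (B i - 1) - y j) * g y (\<phi> (A i - 1) (B i)) (y i)
            + gp (A i) (B i) * (\<Prod>j\<in>{1..n} - {i}. \<phi> (A i) (B i + 1) - y j) * g y (\<phi> (A i + 1) (B i)) (y i))
       / (\<Prod>j\<in>{1..n} - {i}. y i - y j)) = G y" by blast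
  show ?case
  proof (cases "n = 0")
    case True
    then show ?thesis by (intro exI[of _ "\<lambda>_. 0"]) (simp add: symf_const)
  next
    case False
    let ?adm = "\<lambda>i j R. degree R \<le> i + j \<and> (\<forall>a b. gm a b * \<phi> (a - 1) b ^ i * \<phi> a (b - 1) ^ j +
      gp a b * \<phi> (a + 1) b ^ i * \<phi> a (b + 1) ^ j = poly R (\<phi> a b))"
    define R where "R i j = (SOME R. ?adm i j R)" for i j
    have adm_R: "?adm i j (R i j)" for i j
      unfolding R_def by (rule someI_ex) (use adm in \<open>simp only: admissible_def\<close>)
    then have degR: "degree (R i j) \<le> i + j" for i j by blast
    have R: "gm a b * \<phi> (a - 1) b ^ i * \<phi> a (b - 1) ^ j + gp a b * \<phi> (a + 1) b ^ i * \<phi> a (b + 1) ^ j = poly (R i j) (\<phi> a b)"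
      for i j a b using adm_R by blast
    \<comment> \<open>The powers of \<open>y i\<close> come from the expanded product and from
      \<open>v ^ t\<close>, the factor \<open>R\<close> from the admissible pair. The degree is at
      most \<open>s + t + n - 1 - l\<close>; the divided difference takes away n - 1, and the
      coefficient \<open>elem_fps {1..n} y $ l\<close> restores l.\<close>
    define Q where "Q k l = monom 1 (k - l + t) * R s (n - 1 - k)" for k l
    let ?PH = "\<lambda>k l H. symf n (s + t + n - 1 - l + 1 - n) H \<and> (s + t + n - 1 - l + 1 < n \<longrightarrow> H = (\<lambda>_. 0)) \<and>
     (\<forall>y. inj_on y {1..n} \<longrightarrow> (\<Sum>i=1..n. poly (Q k l) (y i) / (\<Prod>j\<in>{1..n} - {i}. y i - y j)) = H y)"
    define H where "H k l = (SOME H. ?PH k l H)" for k l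
    have PH: "?PH k l (H k l)" if "k < n" "l \<le> k" for k l
      unfolding H_def
    proof (rule someI_ex[of "?PH k l"], rule sum_poly_over_prod_diff)
      have "degree (Q k l) \<le> (k - l + t) + (s + (n - 1 - k))"
        unfolding Q_def using degR[of s "n - 1 - k"]
        by (intro order.trans[OF degree_mult_le] add_mono order.trans[OF degree_monom_le]) auto
      then show "degree (Q k l) \<le> s + t + n - 1 - l" using that by simp
    qed (use False in simp)
    then have H: "symf n (s + t + n - 1 - l + 1 - n) (H k l)"
      and H0: "s + t + n - 1 - l + 1 < n \<Longrightarrow> H k l = (\<lambda>_. 0)"
      and HQ: "inj_on y {1..n} \<Longrightarrow>
         (\<Sum>i=1..n. poly (Q k l) (y i) / (\<Prod>j\<in>{1..n} - {i}. y i - y j)) = H k l y"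
      if "k < n" "l \<le> k" for k l y
      using that by blast+
    let ?G = "\<lambda>y. G y + c y * (\<Sum>k<n. \<Sum>l\<le>k. elem_fps {1..n} y $ l * H k l y)"
    have "symf n (s + t) (\<lambda>y. elem_fps {1..n} y $ l * H k l y)" if "k < n" "l \<le> k" for k l
    \<comment> \<open>This is the case \<open>l > s + t\<close>, in which the coefficient of index l
      alone would exceed the degree bound; there \<open>H k l\<close> is zero.\<close>
    proof (cases "s + t + n - 1 - l + 1 < n")
      case True
      then show ?thesis using H0[OF that] by (simp add: symf_const)
    next
      case F: False
      show ?thesis
        by (rule symf_mult[OF symf_elem H[OF that]]) (use F that False in simp)
    qed
    then have "symf n (d - 1) ?G"
      using bisymf_step(2,3) by (intro symf_add G symf_mult[OF bisymf_step(2)] symf_sum) auto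
    moreover have "(\<Sum>i=1..n. (gm (A i) (B i) * (\<Prod>j\<in>{1..n} - {i}. \<phi> (A i) (B i - 1) - y j) *
               (g y (\<phi> (A i - 1) (B i)) (y i) + c y * \<phi> (A i - 1) (B i) ^ s * y i ^ t)
            + gp (A i) (B i) * (\<Prod>j\<in>{1..n} - {i}. \<phi> (A i) (B i + 1) - y j) *
               (g y (\<phi> (A i + 1) (B i)) (y i) + c y * \<phi> (A i + 1) (B i) ^ s * y i ^ t))
       / (\<Prod>j\<in>{1..n} - {i}. y i - y j)) = ?G y" if y: "y = (\<lambda>i. \<phi> (A i) (B i))" and inj: "inj_on y {1..n}" for A B y
    proof -
      let ?P = "\<lambda>i. \<Prod>j\<in>{1..n} - {i}. y i - y j"
      let ?M = "\<lambda>i. \<Prod>j\<in>{1..n} - {i}. \<phi> (A i) (B i - 1) - y j"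
      let ?N = "\<lambda>i. \<Prod>j\<in>{1..n} - {i}. \<phi> (A i) (B i + 1) - y j"
      have comb: "(a * (g1 + e * p * q) + b * (g2 + e * r * q)) / P = (a * g1 + b * g2) / P + e * ((a * p * q + b * r * q) / P)"
        for a b e p q r P g1 g2 :: 'a
        unfolding times_divide_eq_right add_divide_distrib[symmetric] by (simp add: algebra_simps)
      have inner: "gm (A i) (B i) * ?M i * \<phi> (A i - 1) (B i) ^ s * y i ^ t + gp (A i) (B i) * ?N i * \<phi> (A i + 1) (B i) ^ s * y i ^ t
          = (\<Sum>k<n. \<Sum>l\<le>k. elem_fps {1..n} y $ l * poly (Q k l) (y i))" if i: "i \<in> {1..n}" for i
      proof -
        have "gm (A i) (B i) * ?M i * \<phi> (A i - 1) (B i) ^ s * y i ^ t + gp (A i) (B i) * ?N i * \<phi> (A i + 1) (B i) ^ s * y i ^ t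
          = (\<Sum>k<n. \<Sum>l\<le>k. elem_fps {1..n} y $ l * (y i ^ (k - l + t) *
             (gm (A i) (B i) * \<phi> (A i - 1) (B i) ^ s * \<phi> (A i) (B i - 1) ^ (n - 1 - k) +
              gp (A i) (B i) * \<phi> (A i + 1) (B i) ^ s * \<phi> (A i) (B i + 1) ^ (n - 1 - k))))"
          unfolding prod_diff_remove[OF i] sum_distrib_left sum_distrib_right sum.distrib[symmetric]
          by (intro sum.cong refl) (simp only: power_add ring_distribs mult_ac)
        then show ?thesis unfolding R Q_def by (simp only: poly_monom poly_mult y mult_1)
      qed
      have "(\<Sum>i=1..n. (gm (A i) (B i) * ?M i *
               (g y (\<phi> (A i - 1) (B i)) (y i) + c y * \<phi> (A i - 1) (B i) ^ s * y i ^ t)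
            + gp (A i) (B i) * ?N i * (g y (\<phi> (A i + 1) (B i)) (y i) + c y * \<phi> (A i + 1) (B i) ^ s * y i ^ t)) / ?P i) =
        (\<Sum>i=1..n. (gm (A i) (B i) * ?M i * g y (\<phi> (A i - 1) (B i)) (y i) + gp (A i) (B i) * ?N i * g y (\<phi> (A i + 1) (B i)) (y i)) / ?P i
          + c y * ((gm (A i) (B i) * ?M i * \<phi> (A i - 1) (B i) ^ s * y i ^ t + gp (A i) (B i) * ?N i * \<phi> (A i + 1) (B i) ^ s * y i ^ t) / ?P i))"
        by (intro sum.cong refl comb)
      also have "\<dots> = G y + c y * (\<Sum>i=1..n. (\<Sum>k<n. \<Sum>l\<le>k. elem_fps {1..n} y $ l * poly (Q k l) (y i)) / ?P i)"
        unfolding sum.distrib Gy[OF y inj] sum_distrib_left[symmetric] by (simp only: inner cong: sum.cong)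
      also have "(\<Sum>i=1..n. (\<Sum>k<n. \<Sum>l\<le>k. elem_fps {1..n} y $ l * poly (Q k l) (y i)) / ?P i) =
        (\<Sum>k<n. \<Sum>l\<le>k. elem_fps {1..n} y $ l * (\<Sum>i=1..n. poly (Q k l) (y i) / ?P i))"
        by (rule sum_swap_divide)
      also have "\<dots> = (\<Sum>k<n. \<Sum>l\<le>k. elem_fps {1..n} y $ l * H k l y)"
        by (intro sum.cong refl arg_cong2[where f = times] HQ inj) auto
      finally show ?thesis .
    qed
    ultimately show ?thesis by (intro exI[of _ ?G]) auto
  qed
qed

text \<open>Rewrites the sum of \<open>admissible_sum\<close> with differences of f in place of the
  quotient g. The degree drops by one because g has degree below d and the rest of the operator
  preserves degree.\<close>

lemma lowering_operator:
  assumes inj: "\<And>a b a' b'. \<phi> a b = \<phi> a' b' \<Longrightarrow> a = a' \<and> b = b'"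
    and adm: "admissible \<phi> gm gp" and f: "symf n d f"
  shows "\<exists>G. symf n (d - 1) G \<and> (\<forall>A B y. y = (\<lambda>i. \<phi> (A i) (B i)) \<longrightarrow> inj_on y {1..n} \<longrightarrow>
    G y = (\<Sum>i=1..n.
      gm (A i) (B i) / (\<phi> (A i - 1) (B i) - y i) * (\<Prod>j\<in>{1..n} - {i}. (\<phi> (A i) (B i - 1) - y j) / (y i - y j)) *
        (f (y(i := \<phi> (A i - 1) (B i))) - f y) +
      gp (A i) (B i) / (\<phi> (A i + 1) (B i) - y i) * (\<Prod>j\<in>{1..n} - {i}. (\<phi> (A i) (B i + 1) - y j) / (y i - y j)) *
        (f (y(i := \<phi> (A i + 1) (B i))) - f y)))"
proof -
  obtain g where g: "bisymf n d g"
    and fg: "\<And>y u i. i \<in> {1..n} \<Longrightarrow> f (y(i := u)) - f y = (u - y i) * g y u (y i)"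
    using symf_update[OF f] by blast
  obtain G where "symf n (d - 1) G" and Gy: "\<And>A B y. y = (\<lambda>i. \<phi> (A i) (B i)) \<Longrightarrow> inj_on y {1..n} \<Longrightarrow>
    (\<Sum>i=1..n. (gm (A i) (B i) * (\<Prod>j\<in>{1..n} - {i}. \<phi> (A i) (B i - 1) - y j) * g y (\<phi> (A i - 1) (B i)) (y i)
            + gp (A i) (B i) * (\<Prod>j\<in>{1..n} - {i}. \<phi> (A i) (B i + 1) - y j) * g y (\<phi> (A i + 1) (B i)) (y i))
       / (\<Prod>j\<in>{1..n} - {i}. y i - y j)) = G y"
    using admissible_sum[OF adm g] by blast
  show ?thesis
  proof (intro exI[of _ G] conjI allI impI)
    fix A B y assume y: "y = (\<lambda>i. \<phi> (A i) (B i))" and injy: "inj_on y {1..n}"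
    have ne: "\<phi> (A i - 1) (B i) - y i \<noteq> 0" "\<phi> (A i + 1) (B i) - y i \<noteq> 0" for i
      using inj[of "A i - 1" "B i" "A i" "B i"] inj[of "A i + 1" "B i" "A i" "B i"] by (auto simp: y)
    have cancel: "g1 / w * (p / q) * (w * x) = g1 * p * x / q" if "w \<noteq> 0" for g1 w p q x :: 'a
      using that by simp
    show "G y = (\<Sum>i=1..n.
      gm (A i) (B i) / (\<phi> (A i - 1) (B i) - y i) * (\<Prod>j\<in>{1..n} - {i}. (\<phi> (A i) (B i - 1) - y j) / (y i - y j)) *
        (f (y(i := \<phi> (A i - 1) (B i))) - f y) +
      gp (A i) (B i) / (\<phi> (A i + 1) (B i) - y i) * (\<Prod>j\<in>{1..n} - {i}. (\<phi> (A i) (B i + 1) - y j) / (y i - y j)) *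
        (f (y(i := \<phi> (A i + 1) (B i))) - f y))"
      unfolding Gy[OF y injy, symmetric] prod_dividef
      by (intro sum.cong refl) (simp only: fg cancel[OF ne(1)] cancel[OF ne(2)] add_divide_distrib)
  qed fact
qed


section \<open>Perfect grids and interpolation\<close>

text \<open>In the four families \<open>\<delta>\<close> is \<open>1\<close>, \<open>x\<close>, \<open>x\<close> and \<open>x - x\<^sup>-\<^sup>1\<close>, where \<open>x\<close> is the shifted coordinate. The last
  condition lets the up-coefficient of a lowering operator vanish at exactly one prescribed point.\<close>

definition perfect_grid :: "(int \<Rightarrow> int \<Rightarrow> 'a::field_char_0) \<Rightarrow> (int \<Rightarrow> int \<Rightarrow> 'a) \<Rightarrow> bool" where
  "perfect_grid \<phi> \<delta> \<longleftrightarrow>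
     (\<forall>a b a' b'. \<phi> a b = \<phi> a' b' \<longrightarrow> a = a' \<and> b = b') \<and>
     (\<forall>a b. \<delta> a b \<noteq> 0) \<and>
     (\<exists>Q. degree Q \<le> 2 \<and> (\<forall>a b. (\<delta> a b)\<^sup>2 = poly Q (\<phi> a b))) \<and>
     (\<exists>U u. degree U \<le> 1 \<and> (\<forall>a b. \<phi> (a - 1) b = poly U (\<phi> a b) + u * \<delta> a b \<and> \<phi> (a + 1) b = poly U (\<phi> a b) - u * \<delta> a b)) \<and>
     (\<exists>W w. degree W \<le> 1 \<and> (\<forall>a b. \<phi> a (b - 1) = poly W (\<phi> a b) + w * \<delta> a b \<and> \<phi> a (b + 1) = poly W (\<phi> a b) - w * \<delta> a b)) \<and>
     (\<forall>a b a' b' a0 b0. (\<phi> a b - \<phi> a0 b0) * (\<delta> a' b' + \<delta> a0 b0) = (\<phi> a' b' - \<phi> a0 b0) * (\<delta> a b + \<delta> a0 b0) \<longrightarrow>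
        a = a' \<and> b = b')"

lemma perfect_grid_inj: "perfect_grid \<phi> \<delta> \<Longrightarrow> \<phi> a b = \<phi> a' b' \<Longrightarrow> a = a' \<and> b = b'"
  unfolding perfect_grid_def by (elim conjE) blast

text \<open>Setting the last part to zero and dropping its variable moves the origin of the grid by
  one in the second coordinate. The separation condition survives because it is required at every
  base point \<open>a0\<close>, \<open>b0\<close>.\<close>

lemma perfect_grid_shift:
  assumes "perfect_grid \<phi> \<delta>"
  shows "perfect_grid (\<lambda>a b. \<phi> a (b + 1)) (\<lambda>a b. \<delta> a (b + 1))"
proof -
  have e: "b - 1 + 1 = b + 1 - 1" for b :: int by simp
  have i: "b + 1 = b' + 1 \<longleftrightarrow> b = b'" for b b' :: int by simp
  show ?thesis
    using assms unfolding perfect_grid_def e by (elim conjE) (intro conjI; meson i)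
qed

text \<open>\<open>p = A(\<phi>) + B(\<phi>) \<delta>\<close> together with its conjugate \<open>q = A(\<phi>) - B(\<phi>) \<delta>\<close>: then \<open>(p - q) / \<delta> = 2 B(\<phi>)\<close> is a
  polynomial in \<open>\<phi>\<close> of degree less than \<open>e\<close>.\<close>

definition conj_pair :: "(int \<Rightarrow> int \<Rightarrow> 'a::field_char_0) \<Rightarrow> (int \<Rightarrow> int \<Rightarrow> 'a) \<Rightarrow> nat \<Rightarrow>
    (int \<Rightarrow> int \<Rightarrow> 'a) \<Rightarrow> (int \<Rightarrow> int \<Rightarrow> 'a) \<Rightarrow> bool" where
  "conj_pair \<phi> \<delta> e p q \<longleftrightarrow> (\<exists>A B. degree A \<le> e \<and> (B = 0 \<or> degree B < e) \<and>
     (\<forall>a b. p a b = poly A (\<phi> a b) + poly B (\<phi> a b) * \<delta> a b \<and>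
            q a b = poly A (\<phi> a b) - poly B (\<phi> a b) * \<delta> a b))"

lemma conj_pair_one: "conj_pair \<phi> \<delta> 0 (\<lambda>_ _. 1) (\<lambda>_ _. 1)"
  unfolding conj_pair_def by (rule exI[of _ 1], rule exI[of _ 0]) simp

text \<open>Multiplication as in a quadratic extension: \<delta> squared is replaced by
  \<open>Q\<close>, whose degree 2 is paid for by the two strict bounds on \<open>B\<close> and
  \<open>B'\<close>.\<close>

lemma conj_pair_mult:
  assumes Q: "degree Q \<le> 2" "\<And>a b. (\<delta> a b)\<^sup>2 = poly Q (\<phi> a b)"
    and "conj_pair \<phi> \<delta> e p q" "conj_pair \<phi> \<delta> e' p' q'"
  shows "conj_pair \<phi> \<delta> (e + e') (\<lambda>a b. p a b * p' a b) (\<lambda>a b. q a b * q' a b)"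
proof -
  obtain A B where AB: "degree A \<le> e" "B = 0 \<or> degree B < e"
    and pq: "\<And>a b. p a b = poly A (\<phi> a b) + poly B (\<phi> a b) * \<delta> a b"
       "\<And>a b. q a b = poly A (\<phi> a b) - poly B (\<phi> a b) * \<delta> a b"
    using assms(3) unfolding conj_pair_def by blast
  obtain A' B' where AB': "degree A' \<le> e'" "B' = 0 \<or> degree B' < e'"
    and pq': "\<And>a b. p' a b = poly A' (\<phi> a b) + poly B' (\<phi> a b) * \<delta> a b"
       "\<And>a b. q' a b = poly A' (\<phi> a b) - poly B' (\<phi> a b) * \<delta> a b"
    using assms(4) unfolding conj_pair_def by blast
  have d1: "degree (A * A' + B * B' * Q) \<le> e + e'"
  proof (rule degree_add_le)
    show "degree (A * A') \<le> e + e'"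
      using degree_mult_le[of A A'] AB AB' by linarith
    show "degree (B * B' * Q) \<le> e + e'"
      using degree_mult_le[of "B * B'" Q] degree_mult_le[of B B'] AB AB' Q(1) by (cases "B = 0"; cases "B' = 0") auto
  qed
  have d2: "A * B' + A' * B = 0 \<or> degree (A * B' + A' * B) < e + e'"
  proof -
    have "degree (A * B') < e + e'" if "B' \<noteq> 0"
      using degree_mult_le[of A B'] AB AB' that by linarith
    moreover have "degree (A' * B) < e + e'" if "B \<noteq> 0"
      using degree_mult_le[of A' B] AB AB' that by linarith
    ultimately show ?thesis
      by (cases "B = 0"; cases "B' = 0") (auto intro: degree_add_less)
  qed
  have "x * x = poly Q (\<phi> a b)" if "x = \<delta> a b" for x a b
    using Q(2)[of a b] that by (simp add: power2_eq_square)
  then have sq: "\<delta> a b * (\<delta> a b * c) = poly Q (\<phi> a b) * c" for a b c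
    by (simp flip: mult.assoc)
  show ?thesis
    unfolding conj_pair_def
    by (rule exI[of _ "A * A' + B * B' * Q"], rule exI[of _ "A * B' + A' * B"])
       (use d1 d2 in \<open>simp add: pq pq' algebra_simps sq Q(2) flip: power2_eq_square\<close>)
qed

lemma conj_pair_power:
  assumes "degree Q \<le> 2" "\<And>a b. (\<delta> a b)\<^sup>2 = poly Q (\<phi> a b)" "conj_pair \<phi> \<delta> 1 p q"
  shows "conj_pair \<phi> \<delta> i (\<lambda>a b. p a b ^ i) (\<lambda>a b. q a b ^ i)"
proof (induction i)
  case 0
  show ?case using conj_pair_one[of \<phi> \<delta>] by simp
next
  case (Suc i)
  show ?case using conj_pair_mult[OF assms(1,2,3) Suc] by simp
qed

text \<open>\<open>N\<close> and \<open>N'\<close> are conjugate, so multiplying them by powers of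
  the conjugate neighbours gives again a conjugate pair; the difference of its members over \<delta>
  is \<open>2 * B\<close>, and the strict bound on the degree of \<open>B\<close> is the required
  one.\<close>

lemma perfect_grid_admissible:
  assumes "perfect_grid \<phi> \<delta>"
  shows "\<exists>gm gp. admissible \<phi> gm gp \<and> gm 0 0 = 0 \<and> (\<forall>a b. gp a b = 0 \<longleftrightarrow> a = a1 \<and> b = b1)"
proof -
  \<comment> \<open>\<open>N\<close> is a combination of \<phi> and \<delta> that vanishes at the
    origin for any \<open>c1\<close>, \<open>c2\<close>. The ratio chosen here is the one for which
    the conjugate \<open>N'\<close> vanishes at \<open>(a1, b1)\<close>; by the separation condition
    it vanishes nowhere else.\<close>
  define c1 where "c1 = \<delta> a1 b1 + \<delta> 0 0"
  define c2 where "c2 = \<phi> a1 b1 - \<phi> 0 0"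
  define N where "N a b = c1 * (\<phi> a b - \<phi> 0 0) + c2 * (\<delta> a b - \<delta> 0 0)" for a b
  define N' where "N' a b = c1 * (\<phi> a b - \<phi> 0 0) - c2 * (\<delta> a b + \<delta> 0 0)" for a b
  define gm where "gm a b = N a b / \<delta> a b" for a b
  define gp where "gp a b = - N' a b / \<delta> a b" for a b
  have nz: "\<delta> a b \<noteq> 0" for a b using assms unfolding perfect_grid_def by (elim conjE) blast
  have sep: "(\<phi> a b - \<phi> a0 b0) * (\<delta> a' b' + \<delta> a0 b0) = (\<phi> a' b' - \<phi> a0 b0) * (\<delta> a b + \<delta> a0 b0) \<Longrightarrow> a = a' \<and> b = b'" for a b a' b' a0 b0
    using assms unfolding perfect_grid_def by (elim conjE) blast
  obtain Q where Q: "degree Q \<le> 2" "\<And>a b. (\<delta> a b)\<^sup>2 = poly Q (\<phi> a b)"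
    using assms unfolding perfect_grid_def by (elim conjE) blast
  have step: "conj_pair \<phi> \<delta> 1 p q" if "\<exists>U u. degree U \<le> 1 \<and> (\<forall>a b. p a b = poly U (\<phi> a b) + u * \<delta> a b \<and> q a b = poly U (\<phi> a b) - u * \<delta> a b)" for p q
  proof -
    obtain U u where "degree U \<le> 1" "\<forall>a b. p a b = poly U (\<phi> a b) + u * \<delta> a b \<and> q a b = poly U (\<phi> a b) - u * \<delta> a b"
      using \<open>\<exists>U u. _ U u\<close> by blast
    then show ?thesis unfolding conj_pair_def by (intro exI[of _ U] exI[of _ "[:u:]"]) simp
  qed
  have Y: "conj_pair \<phi> \<delta> 1 (\<lambda>a b. \<phi> (a - 1) b) (\<lambda>a b. \<phi> (a + 1) b)"
    using assms unfolding perfect_grid_def by (elim conjE, intro step)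
  have Z: "conj_pair \<phi> \<delta> 1 (\<lambda>a b. \<phi> a (b - 1)) (\<lambda>a b. \<phi> a (b + 1))"
    using assms unfolding perfect_grid_def by (elim conjE, intro step)
  have NN: "conj_pair \<phi> \<delta> 1 N N'"
    unfolding conj_pair_def
    by (rule exI[of _ "[:- c1 * \<phi> 0 0 - c2 * \<delta> 0 0, c1:]"], rule exI[of _ "[:c2:]"])
       (simp add: N_def N'_def algebra_simps)
  have "\<exists>R. degree R \<le> i + j \<and> (\<forall>a b. gm a b * \<phi> (a - 1) b ^ i * \<phi> a (b - 1) ^ j + gp a b * \<phi> (a + 1) b ^ i * \<phi> a (b + 1) ^ j = poly R (\<phi> a b))" for i j
  proof -
    have "conj_pair \<phi> \<delta> (1 + i + j) (\<lambda>a b. N a b * \<phi> (a - 1) b ^ i * \<phi> a (b - 1) ^ j) (\<lambda>a b. N' a b * \<phi> (a + 1) b ^ i * \<phi> a (b + 1) ^ j)"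
      by (intro conj_pair_mult[OF Q] NN conj_pair_power[OF Q] Y Z)
    then obtain A B where B: "B = 0 \<or> degree B < 1 + i + j"
      and AB: "\<And>a b. N a b * \<phi> (a - 1) b ^ i * \<phi> a (b - 1) ^ j = poly A (\<phi> a b) + poly B (\<phi> a b) * \<delta> a b"
        "\<And>a b. N' a b * \<phi> (a + 1) b ^ i * \<phi> a (b + 1) ^ j = poly A (\<phi> a b) - poly B (\<phi> a b) * \<delta> a b"
      unfolding conj_pair_def by blast
    show ?thesis
    proof (intro exI[of _ "Polynomial.smult 2 B"] conjI allI)
      show "degree (Polynomial.smult 2 B) \<le> i + j" using B by auto
      fix a b
      have "gm a b * \<phi> (a - 1) b ^ i * \<phi> a (b - 1) ^ j + gp a b * \<phi> (a + 1) b ^ i * \<phi> a (b + 1) ^ j =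
        (N a b * \<phi> (a - 1) b ^ i * \<phi> a (b - 1) ^ j - N' a b * \<phi> (a + 1) b ^ i * \<phi> a (b + 1) ^ j) / \<delta> a b"
        by (simp add: gm_def gp_def diff_divide_distrib)
      also have "\<dots> = poly (Polynomial.smult 2 B) (\<phi> a b)" unfolding AB using nz[of a b] by simp
      finally show "gm a b * \<phi> (a - 1) b ^ i * \<phi> a (b - 1) ^ j + gp a b * \<phi> (a + 1) b ^ i * \<phi> a (b + 1) ^ j = poly (Polynomial.smult 2 B) (\<phi> a b)" .
    qed
  qed
  then have "admissible \<phi> gm gp" unfolding admissible_def by blast
  moreover have "gm 0 0 = 0" by (simp add: gm_def N_def)
  moreover have "gp a b = 0 \<longleftrightarrow> a = a1 \<and> b = b1" for a b
  proof -
    have "gp a b = 0 \<longleftrightarrow> (\<phi> a b - \<phi> 0 0) * (\<delta> a1 b1 + \<delta> 0 0) = (\<phi> a1 b1 - \<phi> 0 0) * (\<delta> a b + \<delta> 0 0)"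
      using nz[of a b] by (auto simp: gp_def N'_def c1_def c2_def mult.commute)
    also have "\<dots> \<longleftrightarrow> a = a1 \<and> b = b1" using sep[of a b 0 0 a1 b1] by auto
    finally show ?thesis .
  qed
  ultimately show ?thesis by blast
qed

text \<open>The second coordinate is an integer difference, not a truncated one, so a node is
  injective on all indices.\<close>

definition node :: "(int \<Rightarrow> int \<Rightarrow> 'a) \<Rightarrow> nat \<Rightarrow> (nat \<Rightarrow> nat) \<Rightarrow> nat \<Rightarrow> 'a" where
  "node \<phi> n l i = \<phi> (int (l i)) (int n - int i)"

text \<open>On the hyperplane where the new variable equals c, a power sum in one more variable
  exceeds the old one by the constant \<open>c ^ r\<close>, which may be subtracted without raising
  the degree.\<close>

lemma symf_extend: "symf n d f \<Longrightarrow> \<exists>g. symf (Suc n) d g \<and> (\<forall>y. y (Suc n) = c \<longrightarrow> g y = f y)"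
proof (induction rule: symf.induct)
  case (symf_const d a)
  show ?case by (intro exI[of _ "\<lambda>_. a"]) (simp add: symf.symf_const)
next
  case (symf_psum r d)
  show ?case
    by (intro exI[of _ "\<lambda>y. (\<Sum>i=1..Suc n. y i ^ r) - c ^ r"] conjI symf_diff symf.symf_psum symf_psum symf_const) simp
next
  case (symf_add d f g)
  then obtain f' g' where "symf (Suc n) d f'" "symf (Suc n) d g'"
     "\<forall>y. y (Suc n) = c \<longrightarrow> f' y = f y" "\<forall>y. y (Suc n) = c \<longrightarrow> g' y = g y" by blast
  then show ?case by (intro exI[of _ "\<lambda>y. f' y + g' y"] conjI symf.symf_add) auto
next
  case (symf_mult d f e g k)
  then obtain f' g' where "symf (Suc n) d f'" "symf (Suc n) e g'"
     "\<forall>y. y (Suc n) = c \<longrightarrow> f' y = f y" "\<forall>y. y (Suc n) = c \<longrightarrow> g' y = g y" by blast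
  then show ?case using symf_mult.hyps(3)
    by (intro exI[of _ "\<lambda>y. f' y * g' y"] conjI symf.symf_mult[of _ d _ e]) auto
qed

lemma symf_restrict: "symf (Suc n) d f \<Longrightarrow> symf n d (\<lambda>y. f (y(Suc n := c)))"
proof (induction rule: symf.induct)
  case (symf_psum r d)
  have "(\<Sum>i=1..Suc n. (y(Suc n := c)) i ^ r) = (\<Sum>i=1..n. y i ^ r) + c ^ r" for y
  proof -
    have "(\<Sum>i=1..n. (y(Suc n := c)) i ^ r) = (\<Sum>i=1..n. y i ^ r)" by (intro sum.cong) auto
    then show ?thesis by simp
  qed
  then show ?case by (simp only:) (intro symf_add symf.symf_psum symf_psum symf_const)
qed (auto intro: symf.intros)

section \<open>Existence of interpolating symmetric polynomials\<close>

lemma partitions_Suc_iff: "l (Suc n) = 0 \<Longrightarrow> l \<in> partitions (Suc n) \<longleftrightarrow> l \<in> partitions n"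
  by (auto simp: partitions_def le_Suc_eq)

lemma psize_Suc_eq: "l (Suc n) = 0 \<Longrightarrow> psize (Suc n) l = psize n l"
  by (simp add: psize_def)

lemma partitions_mono: "l \<in> partitions n \<Longrightarrow> i \<in> {1..n} \<Longrightarrow> j \<in> {1..n} \<Longrightarrow> i \<le> j \<Longrightarrow> l j \<le> l i"
  by (auto simp: partitions_def)

lemma partitions_outside: "l \<in> partitions n \<Longrightarrow> i \<notin> {1..n} \<Longrightarrow> l i = 0"
  by (auto simp: partitions_def)

text \<open>Partitions with last part 0 are handled by fewer variables on the grid shifted in
  \<open>b\<close>. The others are corrected by a multiple of the product of all
  \<open>y i - \<phi> 0 0\<close>, which vanishes on the first kind and only there; removing the
  first column puts the cofactor on the grid shifted in \<open>a\<close>, with degree smaller by the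
  number of variables.\<close>

theorem interpolation_exists:
  fixes \<phi> :: "int \<Rightarrow> int \<Rightarrow> 'a::field_char_0"
  assumes "\<And>a b a' b'. \<phi> a b = \<phi> a' b' \<Longrightarrow> a = a' \<and> b = b'"
  shows "\<exists>f. symf n d f \<and> (\<forall>l\<in>partitions n. psize n l \<le> d \<longrightarrow> f (node \<phi> n l) = v l)"
  using assms
proof (induction n arbitrary: \<phi> d v)
  case 0
  have "l = (\<lambda>_. 0)" if "l \<in> partitions 0" for l using that by (auto simp: partitions_def)
  then show ?case by (intro exI[of _ "\<lambda>_. v (\<lambda>_. 0)"]) (auto intro: symf_const)
next
  case (Suc n)
  note IHn = Suc.IH
  show ?case
    using Suc.prems
  proof (induction d arbitrary: \<phi> v rule: less_induct)
    case (less d)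
    note inj = less.prems
    have "\<exists>f. symf n d f \<and> (\<forall>l\<in>partitions n. psize n l \<le> d \<longrightarrow> f (node (\<lambda>a b. \<phi> a (b + 1)) n l) = v l)"
      by (rule IHn) (use inj in force)
    then obtain f0 where f0: "symf n d f0" "\<And>l. l \<in> partitions n \<Longrightarrow> psize n l \<le> d \<Longrightarrow> f0 (node (\<lambda>a b. \<phi> a (b + 1)) n l) = v l"
      by blast
    from symf_extend[OF f0(1)] obtain f1 where f1: "symf (Suc n) d f1" "\<And>y. y (Suc n) = \<phi> 0 0 \<Longrightarrow> f1 y = f0 y"
      by blast
    have bot: "f1 (node \<phi> (Suc n) l) = v l" if l: "l \<in> partitions (Suc n)" "psize (Suc n) l \<le> d" "l (Suc n) = 0" for l
    proof -
      have "f1 (node \<phi> (Suc n) l) = f0 (node \<phi> (Suc n) l)" using l by (intro f1) (simp add: node_def)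
      also have "\<dots> = f0 (node (\<lambda>a b. \<phi> a (b + 1)) n l)"
        by (rule symf_cong[OF f0(1)]) (simp add: node_def algebra_simps)
      also have "\<dots> = v l" using l by (intro f0) (simp_all add: partitions_Suc_iff psize_Suc_eq)
      finally show ?thesis .
    qed
    show ?case
    proof (cases "Suc n \<le> d")
      case False
      \<comment> \<open>A nonzero last part forces all \<open>Suc n\<close> parts to be positive,
        hence a size above \<open>d\<close>.\<close>
      have "l (Suc n) = 0" if "l \<in> partitions (Suc n)" "psize (Suc n) l \<le> d" for l
      proof (rule ccontr)
        assume "l (Suc n) \<noteq> 0"
        then have "1 \<le> l i" if "i \<in> {1..Suc n}" for i
          using partitions_mono[OF \<open>l \<in> _\<close> that, of "Suc n"] that by auto
        then have "(\<Sum>i=1..Suc n. 1) \<le> psize (Suc n) l" unfolding psize_def by (intro sum_mono) auto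
        then show False using that False by simp
      qed
      then show ?thesis using f1(1) bot by blast
    next
      case True
      \<comment> \<open>Adds a full first column; the nodes of \<open>up l\<close> are the nodes of
        \<open>l\<close> on the grid shifted in \<open>a\<close>.\<close>
      define up :: "(nat \<Rightarrow> nat) \<Rightarrow> nat \<Rightarrow> nat" where "up k = (\<lambda>i. if i \<in> {1..Suc n} then k i + 1 else 0)" for k
      let ?P = "\<lambda>y. \<Prod>i=1..Suc n. y i - \<phi> 0 0"
      have "\<exists>g. symf (Suc n) (d - Suc n) g \<and> (\<forall>l\<in>partitions (Suc n). psize (Suc n) l \<le> d - Suc n \<longrightarrow>
          g (node (\<lambda>a b. \<phi> (a + 1) b) (Suc n) l) = (v (up l) - f1 (node \<phi> (Suc n) (up l))) / ?P (node \<phi> (Suc n) (up l)))"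
        by (rule less.IH) (use True inj in force)+
      then obtain g where g: "symf (Suc n) (d - Suc n) g"
        and gv: "\<And>l. l \<in> partitions (Suc n) \<Longrightarrow> psize (Suc n) l \<le> d - Suc n \<Longrightarrow>
          g (node (\<lambda>a b. \<phi> (a + 1) b) (Suc n) l) = (v (up l) - f1 (node \<phi> (Suc n) (up l))) / ?P (node \<phi> (Suc n) (up l))"
        by blast
      have "symf (Suc n) d (\<lambda>y. f1 y + ?P y * g y)"
        by (rule symf_add[OF f1(1) symf_mult[OF symf_prod_diff g]]) (use True in simp)
      moreover have "f1 (node \<phi> (Suc n) l) + ?P (node \<phi> (Suc n) l) * g (node \<phi> (Suc n) l) = v l"
        if l: "l \<in> partitions (Suc n)" "psize (Suc n) l \<le> d" for l
      proof (cases "l (Suc n) = 0")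
        case z: True
        have "?P (node \<phi> (Suc n) l) = 0"
          by (rule prod_zero) (use z in \<open>auto simp: node_def intro!: bexI[of _ "Suc n"]\<close>)
        then show ?thesis using bot[OF l z] by simp
      next
        case nz: False
        have pos: "1 \<le> l i" if "i \<in> {1..Suc n}" for i
          using partitions_mono[OF l(1) that, of "Suc n"] that nz by auto
        define k where "k = (\<lambda>i. l i - 1)"
        have upk: "up k = l"
        proof
          show "up k i = l i" for i
            using pos[of i] partitions_outside[OF l(1), of i] by (cases "i \<in> {1..Suc n}") (auto simp: up_def k_def)
        qed
        have "psize (Suc n) l = (\<Sum>i=1..Suc n. k i + 1)"
          unfolding psize_def by (intro sum.cong refl) (use pos in \<open>force simp: k_def\<close>)
        then have sz: "psize (Suc n) l = psize (Suc n) k + Suc n" by (simp only: psize_def sum.distrib) simp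
        have kp: "k \<in> partitions (Suc n)" using l(1) unfolding partitions_def k_def by (auto intro: diff_le_mono)
        have "g (node \<phi> (Suc n) l) = g (node (\<lambda>a b. \<phi> (a + 1) b) (Suc n) k)"
          using pos by (intro symf_cong[OF g]) (simp add: node_def k_def of_nat_diff)
        also have "\<dots> = (v l - f1 (node \<phi> (Suc n) l)) / ?P (node \<phi> (Suc n) l)"
          using gv[OF kp] sz l(2) by (simp only: upk le_diff_conv2 True)
        finally have "g (node \<phi> (Suc n) l) = (v l - f1 (node \<phi> (Suc n) l)) / ?P (node \<phi> (Suc n) l)" .
        moreover have "?P (node \<phi> (Suc n) l) \<noteq> 0"
        proof -
          have "node \<phi> (Suc n) l i - \<phi> 0 0 \<noteq> 0" if "i \<in> {1..Suc n}" for i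
            using pos[OF that] inj[of "int (l i)" "int (Suc n) - int i" 0 0] by (auto simp: node_def)
          then show ?thesis by simp
        qed
        ultimately show ?thesis by simp
      qed
      ultimately show ?thesis by (intro exI[of _ "\<lambda>y. f1 y + ?P y * g y"]) blast
    qed
  qed
qed


section \<open>Uniqueness of interpolation\<close>

text \<open>The symmetrised monomial, a positive multiple of the monomial symmetric polynomial
  because stabilisers are counted. The value type is general so that both field elements and the
  Laurent polynomials \<open>gen F i\<close> can be inserted.\<close>

definition ysum :: "nat \<Rightarrow> (nat \<Rightarrow> nat) \<Rightarrow> (nat \<Rightarrow> 'b::comm_semiring_1) \<Rightarrow> 'b" where
  "ysum n k y = (\<Sum>s | s permutes {1..n}. \<Prod>i=1..n. y (s i) ^ k i)"

lemma ysum_cong: "(\<And>i. i \<in> {1..n} \<Longrightarrow> k i = k' i) \<Longrightarrow> ysum n k y = ysum n k' y"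
  unfolding ysum_def by (intro sum.cong prod.cong refl) simp

lemma prod_permute_power:
  assumes "t permutes {1..n::nat}"
  shows "(\<Prod>i=1..n. y i ^ k (t i)) = (\<Prod>i=1..n. y (inv t i) ^ k i :: 'b::comm_semiring_1)"
proof -
  have "(\<Prod>i=1..n. y (inv t i) ^ k i) = (\<Prod>i=1..n. (\<lambda>i. y (inv t i) ^ k i) (t i))"
    by (subst prod.permute[OF assms]) (simp add: o_def)
  then show ?thesis using permutes_inverses[OF assms] by simp
qed

lemma sum_permutes_compose_left:
  assumes "t permutes {1..n::nat}"
  shows "(\<Sum>s | s permutes {1..n}. f (t \<circ> s)) = (\<Sum>s | s permutes {1..n}. f s)"
  using setum_permutations_compose_left[OF assms, of f] by simp

lemma sum_permutes_compose_right:
  assumes "t permutes {1..n::nat}"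
  shows "(\<Sum>s | s permutes {1..n}. f (s \<circ> t)) = (\<Sum>s | s permutes {1..n}. f s)"
  using sum_permutations_compose_right[OF assms, of f] by simp

lemma ysum_permute:
  assumes t: "t permutes {1..n}"
  shows "ysum n (k \<circ> t) y = ysum n k y"
proof -
  have "ysum n (k \<circ> t) y = (\<Sum>s | s permutes {1..n}. \<Prod>i=1..n. y ((s \<circ> inv t) i) ^ k i)"
    unfolding ysum_def using prod_permute_power[OF t, of "\<lambda>i. y (s i)" k for s] by simp
  also have "\<dots> = ysum n k y"
    unfolding ysum_def by (rule sum_permutes_compose_right[OF permutes_inv[OF t]])
  finally show ?thesis .
qed

lemma exists_sorting_permutation:
  fixes k :: "nat \<Rightarrow> nat"
  shows "\<exists>t. t permutes {1..n} \<and> (\<forall>i\<in>{1..n}. \<forall>j\<in>{1..n}. i \<le> j \<longrightarrow> k (t j) \<le> k (t i))"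
proof (induction n arbitrary: k)
  case 0
  show ?case by (intro exI[of _ id]) auto
next
  case (Suc n)
  obtain m where m: "m \<in> {1..Suc n}" "\<And>i. i \<in> {1..Suc n} \<Longrightarrow> k m \<le> k i"
    using ex_min_if_finite[of "k ` {1..Suc n}"] by (force simp: not_less)
  define r where "r = transpose m (Suc n)"
  have r: "r permutes {1..Suc n}" unfolding r_def using m by (intro permutes_swap_id) auto
  obtain t where t: "t permutes {1..n}" "\<forall>i\<in>{1..n}. \<forall>j\<in>{1..n}. i \<le> j \<longrightarrow> (k \<circ> r) (t j) \<le> (k \<circ> r) (t i)"
    using Suc[of "k \<circ> r"] by blast
  have t': "t permutes {1..Suc n}" using t(1) by (rule permutes_subset) auto
  have tn: "t (Suc n) = Suc n" using t(1) by (intro permutes_not_in) auto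
  show ?case
  proof (intro exI[of _ "r \<circ> t"] conjI ballI impI)
    show "r \<circ> t permutes {1..Suc n}" by (rule permutes_compose[OF t' r])
    fix i j assume ij: "i \<in> {1..Suc n}" "j \<in> {1..Suc n}" "i \<le> j"
    show "k ((r \<circ> t) j) \<le> k ((r \<circ> t) i)"
    proof (cases "j = Suc n")
      case True
      then have "k ((r \<circ> t) j) = k m" by (simp add: tn r_def)
      moreover have "(r \<circ> t) i \<in> {1..Suc n}"
        using permutes_in_image[OF permutes_compose[OF t' r], of i] ij by simp
      ultimately show ?thesis using m(2) by simp
    next
      case False
      then show ?thesis using t(2) ij by (simp add: o_def)
    qed
  qed
qed

lemma psize_permute: "t permutes {1..n} \<Longrightarrow> psize n (k \<circ> t) = psize n k"
  unfolding psize_def by (rule sum.permute[symmetric])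

lemma ysum_eq_partition: "\<exists>l\<in>partitions n. psize n l = psize n k \<and> (\<forall>y::nat \<Rightarrow> 'b::comm_semiring_1. ysum n l y = ysum n k y)"
proof -
  obtain t where t: "t permutes {1..n}" "\<forall>i\<in>{1..n}. \<forall>j\<in>{1..n}. i \<le> j \<longrightarrow> k (t j) \<le> k (t i)"
    using exists_sorting_permutation[of n k] by blast
  let ?l = "\<lambda>i. if i \<in> {1..n} then k (t i) else 0"
  show ?thesis
  proof (intro bexI conjI allI)
    have "?l j \<le> ?l i" if "i \<in> {1..n}" "j \<in> {1..n}" "i \<le> j" for i j
      using t(2)[rule_format, OF that] that(1,2) by (simp only: if_True)
    then show "?l \<in> partitions n" unfolding partitions_def by simp
    have "psize n ?l = psize n (k \<circ> t)" unfolding psize_def by (intro sum.cong) auto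
    then show "psize n ?l = psize n k" by (simp only: psize_permute[OF t(1)])
    fix y :: "nat \<Rightarrow> 'b"
    have "ysum n ?l y = ysum n (k \<circ> t) y" by (rule ysum_cong) auto
    then show "ysum n ?l y = ysum n k y" by (simp only: ysum_permute[OF t(1)])
  qed
qed

text \<open>Writing the second permutation as the first one composed with t lets both monomials be
  read in the same variables, so that their exponents add.\<close>

lemma ysum_mult:
  "ysum n k y * ysum n k' y = (\<Sum>t | t permutes {1..n}. ysum n (\<lambda>i. k i + k' (inv t i)) y)"
proof -
  have "ysum n k y * ysum n k' y = (\<Sum>s | s permutes {1..n}. \<Sum>t | t permutes {1..n}. (\<Prod>i=1..n. y (s i) ^ k i) * (\<Prod>i=1..n. y (t i) ^ k' i))"
    unfolding ysum_def by (simp add: sum_product)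
  also have "\<dots> = (\<Sum>s | s permutes {1..n}. \<Sum>t | t permutes {1..n}. (\<Prod>i=1..n. y (s i) ^ k i) * (\<Prod>i=1..n. y ((s \<circ> t) i) ^ k' i))"
    by (intro sum.cong refl sum_permutes_compose_left[symmetric]) simp
  also have "\<dots> = (\<Sum>s | s permutes {1..n}. \<Sum>t | t permutes {1..n}. \<Prod>i=1..n. y (s i) ^ (k i + k' (inv t i)))"
  proof (intro sum.cong refl)
    fix s t :: "nat \<Rightarrow> nat" assume "t \<in> {t. t permutes {1..n}}"
    then have t: "t permutes {1..n}" by simp
    have "(\<Prod>i=1..n. y ((s \<circ> t) i) ^ k' i) = (\<Prod>i=1..n. y (s i) ^ k' (inv t i))"
      using prod_permute_power[OF permutes_inv[OF t], of "\<lambda>i. y (s i)" k'] permutes_inv_inv[OF t] by simp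
    then show "(\<Prod>i=1..n. y (s i) ^ k i) * (\<Prod>i=1..n. y ((s \<circ> t) i) ^ k' i) = (\<Prod>i=1..n. y (s i) ^ (k i + k' (inv t i)))"
      by (simp add: power_add prod.distrib)
  qed
  also have "\<dots> = (\<Sum>t | t permutes {1..n}. ysum n (\<lambda>i. k i + k' (inv t i)) y)"
    unfolding ysum_def by (rule sum.swap)
  finally show ?thesis .
qed

section \<open>Span of symmetrised monomials of bounded degree\<close>

abbreviation bounded_partitions :: "nat \<Rightarrow> nat \<Rightarrow> (nat \<Rightarrow> nat) set" where
  "bounded_partitions n d \<equiv> {l \<in> partitions n. psize n l \<le> d}"

definition ysum_span :: "nat \<Rightarrow> nat \<Rightarrow> ((nat \<Rightarrow> 'a::field_char_0) \<Rightarrow> 'a) \<Rightarrow> bool" where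
  "ysum_span n d f \<longleftrightarrow> (\<exists>c. \<forall>y. f y = (\<Sum>l\<in>bounded_partitions n d. c l * ysum n l y))"

lemma ysum_span_ysum:
  assumes "psize n k \<le> d"
  shows "ysum_span n d (ysum n k :: (nat \<Rightarrow> 'a::field_char_0) \<Rightarrow> 'a)"
proof -
  obtain l where "l \<in> partitions n" "psize n l = psize n k" and l2: "\<forall>y::nat \<Rightarrow> 'a. ysum n l y = ysum n k y"
    using ysum_eq_partition[of n k, where 'b = 'a] by blast
  then have l: "l \<in> bounded_partitions n d" using assms by simp
  have "ysum n k y = (\<Sum>l'\<in>bounded_partitions n d. (if l' = l then 1 else 0) * ysum n l' y)" for y :: "nat \<Rightarrow> 'a"
    using finite_partitions_psize_le[of n d] by (subst sum.remove[OF _ l]) (simp_all add: l2)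
  then show ?thesis unfolding ysum_span_def by (intro exI[of _ "\<lambda>l'. if l' = l then 1 else 0"]) blast
qed

lemma ysum_span_add: "ysum_span n d f \<Longrightarrow> ysum_span n d g \<Longrightarrow> ysum_span n d (\<lambda>y. f y + g y)"
  unfolding ysum_span_def
proof (elim exE)
  fix c e assume "\<forall>y. f y = (\<Sum>l\<in>bounded_partitions n d. c l * ysum n l y)" "\<forall>y. g y = (\<Sum>l\<in>bounded_partitions n d. e l * ysum n l y)"
  then show "\<exists>c. \<forall>y. f y + g y = (\<Sum>l\<in>bounded_partitions n d. c l * ysum n l y)"
    by (intro exI[of _ "\<lambda>l. c l + e l"]) (simp add: sum.distrib ring_distribs)
qed

lemma ysum_span_cmult: "ysum_span n d f \<Longrightarrow> ysum_span n d (\<lambda>y. a * f y)"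
  unfolding ysum_span_def
proof (elim exE)
  fix c assume "\<forall>y. f y = (\<Sum>l\<in>bounded_partitions n d. c l * ysum n l y)"
  then show "\<exists>c. \<forall>y. a * f y = (\<Sum>l\<in>bounded_partitions n d. c l * ysum n l y)"
    by (intro exI[of _ "\<lambda>l. a * c l"]) (simp add: sum_distrib_left mult.assoc)
qed

lemma ysum_span_sum: "(\<And>x. x \<in> X \<Longrightarrow> ysum_span n d (f x)) \<Longrightarrow> ysum_span n d (\<lambda>y. \<Sum>x\<in>X. f x y)"
proof (induction X rule: infinite_finite_induct)
  case (insert x X)
  then show ?case using ysum_span_add[of n d "f x" "\<lambda>y. \<Sum>x\<in>X. f x y"] by simp
qed (simp_all add: ysum_span_def exI[of _ "\<lambda>_. 0"])

lemma ysum_span_mult: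
  assumes "ysum_span n d f" "ysum_span n e g" "d + e \<le> k"
  shows "ysum_span n k (\<lambda>y. f y * g y)"
proof -
  obtain c where c: "\<And>y. f y = (\<Sum>l\<in>bounded_partitions n d. c l * ysum n l y)"
    using assms(1) unfolding ysum_span_def by blast
  obtain c' where c': "\<And>y. g y = (\<Sum>l\<in>bounded_partitions n e. c' l * ysum n l y)"
    using assms(2) unfolding ysum_span_def by blast
  have "f y * g y = (\<Sum>l\<in>bounded_partitions n d. \<Sum>l'\<in>bounded_partitions n e.
     (c l * c' l') * (\<Sum>t | t permutes {1..n}. ysum n (\<lambda>i. l i + l' (inv t i)) y))" for y
    unfolding c c' sum_product ysum_mult[symmetric] by (simp add: mult_ac)
  moreover have "ysum_span n k (\<lambda>y. \<Sum>l\<in>bounded_partitions n d. \<Sum>l'\<in>bounded_partitions n e.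
     (c l * c' l') * (\<Sum>t | t permutes {1..n}. ysum n (\<lambda>i. l i + l' (inv t i)) y))"
  proof (intro ysum_span_sum ysum_span_cmult ysum_span_ysum)
    fix l l' t assume *: "l \<in> bounded_partitions n d" "l' \<in> bounded_partitions n e" "t \<in> {t. t permutes {1..n}}"
    have "psize n (\<lambda>i. l i + l' (inv t i)) = psize n l + psize n (l' \<circ> inv t)"
      by (simp add: psize_def sum.distrib)
    also have "\<dots> = psize n l + psize n l'" using * by (simp add: psize_permute permutes_inv)
    finally show "psize n (\<lambda>i. l i + l' (inv t i)) \<le> k" using * assms(3) by simp
  qed
  ultimately show ?thesis by simp
qed

lemma symf_ysum_span: "symf n d f \<Longrightarrow> ysum_span n d f"
proof (induction rule: symf.induct)
  case (symf_const d c)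
  have "(\<lambda>y. c / fact n * ysum n (\<lambda>_. 0) y) = (\<lambda>_. c)"
    by (simp add: ysum_def card_permutations fun_eq_iff)
  then show ?case
    using ysum_span_cmult[OF ysum_span_ysum[of n "\<lambda>_. 0" d], of "c / fact n"] by (simp add: psize_def)
next
  case (symf_psum r d)
  let ?k = "\<lambda>j i. if i = j then r else 0"
  \<comment> \<open>With the exponent r at position j and 0 elsewhere, summing over j makes every
    permutation contribute the whole power sum; hence the factor \<open>fact n\<close>.\<close>
  have "(\<Sum>j=1..n. ysum n (?k j) y) = fact n * (\<Sum>i=1..n. y i ^ r)" for y :: "nat \<Rightarrow> 'a"
  proof -
    have "(\<Sum>j=1..n. ysum n (?k j) y) = (\<Sum>s | s permutes {1..n}. \<Sum>j=1..n. \<Prod>i=1..n. y (s i) ^ ?k j i)"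
      unfolding ysum_def by (rule sum.swap)
    also have "\<dots> = (\<Sum>s | s permutes {1..n}. \<Sum>j=1..n. y j ^ r)"
    proof (rule sum.cong[OF refl])
      fix s assume "s \<in> {s. s permutes {1..n}}"
      then have s: "s permutes {1..n}" by simp
      have "(\<Prod>i=1..n. y (s i) ^ ?k j i) = y (s j) ^ r" if "j \<in> {1..n}" for j
        using that by (subst prod.remove[of _ j]) auto
      then have "(\<Sum>j=1..n. \<Prod>i=1..n. y (s i) ^ ?k j i) = (\<Sum>j=1..n. y (s j) ^ r)" by (rule sum.cong[OF refl])
      also have "\<dots> = (\<Sum>j=1..n. y j ^ r)" using sum.permute[OF s, of "\<lambda>j. y j ^ r"] by (simp only: o_def)
      finally show "(\<Sum>j=1..n. \<Prod>i=1..n. y (s i) ^ ?k j i) = (\<Sum>j=1..n. y j ^ r)" .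
    qed
    also have "\<dots> = fact n * (\<Sum>i=1..n. y i ^ r)" by (simp add: card_permutations)
    finally show ?thesis .
  qed
  then have "(\<lambda>y :: nat \<Rightarrow> 'a. \<Sum>i=1..n. y i ^ r) = (\<lambda>y. 1 / fact n * (\<Sum>j=1..n. ysum n (?k j) y))"
    by (simp add: fun_eq_iff)
  moreover have "ysum_span n d (\<lambda>y. 1 / fact n * (\<Sum>j=1..n. ysum n (?k j) y))"
    using symf_psum by (intro ysum_span_cmult ysum_span_sum ysum_span_ysum) (simp add: psize_def)
  ultimately show ?case by simp
qed (auto intro: ysum_span_add ysum_span_mult)

text \<open>Solvability for every unit vector gives a right inverse of a square matrix; it is also a
  left inverse, so the kernel is trivial.\<close>

lemma square_system_injective:
  fixes A :: "'b \<Rightarrow> 'b \<Rightarrow> 'a::field"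
  assumes fin: "finite S"
    and surj: "\<And>t. t \<in> S \<Longrightarrow> \<exists>c. \<forall>s\<in>S. (\<Sum>k\<in>S. A s k * c k) = (if s = t then 1 else 0)"
    and zero: "\<And>s. s \<in> S \<Longrightarrow> (\<Sum>k\<in>S. A s k * x k) = 0" and k: "k \<in> S"
  shows "x k = 0"
proof -
  obtain C where C: "\<And>t s. t \<in> S \<Longrightarrow> s \<in> S \<Longrightarrow> (\<Sum>k\<in>S. A s k * C t k) = (if s = t then 1 else 0)"
    using surj by metis
  define N where "N = card S"
  obtain e where e: "bij_betw e {0..<N} S" using ex_bij_betw_nat_finite[OF fin] N_def by blast
  have reindex: "(\<Sum>k\<in>S. h k) = (\<Sum>i=0..<N. h (e i))" for h :: "'b \<Rightarrow> 'a"
    using sum.reindex_bij_betw[OF e, of h] by simp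
  have eS: "e i \<in> S" if "i < N" for i using e that by (auto simp: bij_betw_def)
  have einj: "e i = e j \<longleftrightarrow> i = j" if "i < N" "j < N" for i j
    using e that by (auto simp: bij_betw_def inj_on_def)
  define MA where "MA = mat N N (\<lambda>(i, j). A (e i) (e j))"
  define MC where "MC = mat N N (\<lambda>(i, j). C (e j) (e i))"
  have "MA * MC = 1\<^sub>m N"
    by (rule eq_matI) (auto simp: MA_def MC_def scalar_prod_def C[OF eS eS, unfolded reindex] einj)
  then have CA: "MC * MA = 1\<^sub>m N"
    by (rule mat_mult_left_right_inverse[rotated 2]) (auto simp: MA_def MC_def)
  obtain i0 where i0: "i0 < N" "k = e i0" using e k by (auto simp: bij_betw_def)
  have ent: "(\<Sum>j=0..<N. C (e j) (e i) * A (e j) (e l)) = (if i = l then 1 else 0)" if "i < N" "l < N" for i l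
  proof -
    have "(MC * MA) $$ (i, l) = (1\<^sub>m N) $$ (i, l)" by (simp only: CA)
    then show ?thesis using that by (simp add: MA_def MC_def scalar_prod_def)
  qed
  have "x (e i0) = (\<Sum>l=0..<N. (if i0 = l then 1 else 0) * x (e l))"
    using i0 by (simp add: if_distrib[of "\<lambda>a. a * _"] cong: if_cong)
  also have "\<dots> = (\<Sum>l=0..<N. \<Sum>j=0..<N. C (e j) (e i0) * A (e j) (e l) * x (e l))"
    using i0 by (intro sum.cong refl) (simp add: ent[symmetric] sum_distrib_right)
  also have "\<dots> = (\<Sum>j=0..<N. C (e j) (e i0) * (\<Sum>l=0..<N. A (e j) (e l) * x (e l)))"
    by (subst sum.swap) (simp add: sum_distrib_left mult.assoc)
  also have "\<dots> = 0"
    using zero[OF eS, unfolded reindex] by simp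
  finally show ?thesis using i0 by simp
qed

text \<open>The dimension count: unknown coefficients and nodes are indexed by the same finite set,
  so existence of interpolants already forces uniqueness. It concerns the coefficients themselves
  and therefore transfers to Laurent polynomials.\<close>

lemma ysum_coefficients_zero:
  fixes \<phi> :: "int \<Rightarrow> int \<Rightarrow> 'a::field_char_0"
  assumes inj: "\<And>a b a' b'. \<phi> a b = \<phi> a' b' \<Longrightarrow> a = a' \<and> b = b'"
    and zero: "\<And>l. l \<in> bounded_partitions n d \<Longrightarrow> (\<Sum>k\<in>bounded_partitions n d. c k * ysum n k (node \<phi> n l)) = 0"
    and k: "k \<in> bounded_partitions n d"
  shows "c k = 0"
proof (rule square_system_injective[of "bounded_partitions n d" "\<lambda>l k. ysum n k (node \<phi> n l)", OF finite_partitions_psize_le _ _ k])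
  fix t assume t: "t \<in> bounded_partitions n d"
  obtain f where f: "symf n d f" "\<forall>l\<in>partitions n. psize n l \<le> d \<longrightarrow> f (node \<phi> n l) = (if l = t then 1 else 0)"
    using interpolation_exists[of \<phi> n d "\<lambda>l. if l = t then 1 else 0"] inj by blast
  from symf_ysum_span[OF f(1)] obtain e where "\<And>y. f y = (\<Sum>l\<in>bounded_partitions n d. e l * ysum n l y)"
    unfolding ysum_span_def by blast
  then show "\<exists>e. \<forall>s\<in>bounded_partitions n d. (\<Sum>k\<in>bounded_partitions n d. ysum n k (node \<phi> n s) * e k) = (if s = t then 1 else 0)"
    using f(2) by (intro exI[of _ e]) (simp add: mult.commute)
qed (use zero in \<open>simp add: mult.commute\<close>)

lemma symf_unique:
  fixes \<phi> :: "int \<Rightarrow> int \<Rightarrow> 'a::field_char_0"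
  assumes inj: "\<And>a b a' b'. \<phi> a b = \<phi> a' b' \<Longrightarrow> a = a' \<and> b = b'"
    and f: "symf n d f" and zero: "\<And>l. l \<in> bounded_partitions n d \<Longrightarrow> f (node \<phi> n l) = 0"
  shows "f y = 0"
proof -
  from symf_ysum_span[OF f] obtain c where c: "\<And>y. f y = (\<Sum>l\<in>bounded_partitions n d. c l * ysum n l y)"
    unfolding ysum_span_def by blast
  have "c l = 0" if "l \<in> bounded_partitions n d" for l
    by (rule ysum_coefficients_zero[OF inj _ that]) (use zero c in simp)+
  then show ?thesis using c by simp
qed


section \<open>Extra vanishing\<close>

lemma partitions_increment_iff:
  assumes l: "l \<in> partitions n" and i: "i \<in> {1..n}"
  shows "l(i := Suc (l i)) \<in> partitions n \<longleftrightarrow> i = 1 \<or> l (i - 1) \<noteq> l i"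
proof
  assume u: "l(i := Suc (l i)) \<in> partitions n"
  show "i = 1 \<or> l (i - 1) \<noteq> l i"
  proof (rule ccontr)
    assume c: "\<not> (i = 1 \<or> l (i - 1) \<noteq> l i)"
    with i obtain j where "i = Suc j" "j \<in> {1..n}" by (cases i) auto
    then show False using partitions_mono[OF u, of j i] i c by auto
  qed
next
  assume c: "i = 1 \<or> l (i - 1) \<noteq> l i"
  have lt: "l i < l a" if "a \<in> {1..n}" "a < i" for a
  proof -
    have "l (i - 1) \<noteq> l i" using c that by auto
    moreover have "l i \<le> l (i - 1)" using that i by (intro partitions_mono[OF l]) auto
    moreover have "l (i - 1) \<le> l a" using that i by (intro partitions_mono[OF l]) auto
    ultimately show ?thesis by simp
  qed
  have "(l(i := Suc (l i))) b \<le> (l(i := Suc (l i))) a" if "a \<in> {1..n}" "b \<in> {1..n}" "a \<le> b" for a b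
    using partitions_mono[OF l that] lt[of a] that by (cases "a = i"; cases "b = i") auto
  then show "l(i := Suc (l i)) \<in> partitions n"
    using partitions_outside[OF l] i unfolding partitions_def by simp
qed

lemma partitions_decrement:
  assumes l: "l \<in> partitions n" and i: "i \<in> {1..n}" and c: "i = n \<or> l (Suc i) \<noteq> l i"
  shows "l(i := l i - 1) \<in> partitions n"
proof -
  have lt: "l a < l i" if "a \<in> {1..n}" "i < a" for a
  proof -
    have "l (Suc i) \<noteq> l i" using c that by auto
    moreover have "l (Suc i) \<le> l i" using that i by (intro partitions_mono[OF l]) auto
    moreover have "l a \<le> l (Suc i)" using that i by (intro partitions_mono[OF l]) auto
    ultimately show ?thesis by simp
  qed
  have "(l(i := l i - 1)) b \<le> (l(i := l i - 1)) a" if "a \<in> {1..n}" "b \<in> {1..n}" "a \<le> b" for a b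
    using partitions_mono[OF l that] lt[of b] that by (cases "a = i"; cases "b = i") auto
  then show ?thesis
    using partitions_outside[OF l] i unfolding partitions_def by simp
qed

lemma psize_update: "i \<in> {1..n} \<Longrightarrow> psize n (l(i := x)) + l i = psize n l + x"
proof -
  assume i: "i \<in> {1..n}"
  have "(\<Sum>j\<in>{1..n} - {i}. (l(i := x)) j) = (\<Sum>j\<in>{1..n} - {i}. l j)" by (intro sum.cong) auto
  then show ?thesis unfolding psize_def sum.remove[OF finite_atLeastAtMost i] by simp
qed

lemma node_update:
  "node \<phi> n (l(i := x)) = (node \<phi> n l)(i := \<phi> (int x) (int n - int i))"
  by (auto simp: node_def fun_eq_iff)

lemma inj_on_node:
  assumes "\<And>a b a' b'. \<phi> a b = \<phi> a' b' \<Longrightarrow> a = a' \<and> b = b'"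
  shows "inj_on (node \<phi> n l) A"
  unfolding node_def by (rule inj_onI) (drule assms, simp)

text \<open>Every down-term is zero: either the next row is as long and the product has a zero
  factor, or the last row is empty and \<open>gm 0 0 = 0\<close> applies, or the smaller partition
  is a zero of f. The products of the up-terms vanish exactly when the enlarged row would exceed the
  previous one.\<close>

lemma lowering_on_nodes:
  fixes \<phi> :: "int \<Rightarrow> int \<Rightarrow> 'a::field_char_0"
  assumes grid: "perfect_grid \<phi> \<delta>" and f: "symf n d f"
  shows "\<exists>G K. symf n (d - 1) G \<and>
    (\<forall>l\<in>partitions n. f (node \<phi> n l) = 0 \<longrightarrow>
      (\<forall>l'\<in>partitions n. psize n l' < psize n l \<longrightarrow> f (node \<phi> n l') = 0) \<longrightarrow>
      G (node \<phi> n l) = (\<Sum>i=1..n. K l i * f (node \<phi> n (l(i := Suc (l i)))))) \<and>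
    (\<forall>l\<in>partitions n. \<forall>i\<in>{1..n}.
      K l i = 0 \<longleftrightarrow> (int (l i) = a1 \<and> int n - int i = b1) \<or> l(i := Suc (l i)) \<notin> partitions n)"
proof -
  note inj = perfect_grid_inj[OF grid]
  obtain gm gp where adm: "admissible \<phi> gm gp" and gm0: "gm 0 0 = 0" and gp0: "\<And>a b. gp a b = 0 \<longleftrightarrow> a = a1 \<and> b = b1"
    using perfect_grid_admissible[OF grid] by blast
  let ?y = "node \<phi> n"
  let ?B = "\<lambda>i. int n - int i"
  define M where "M l i = gm (int (l i)) (?B i) / (\<phi> (int (l i) - 1) (?B i) - ?y l i) *
     (\<Prod>j\<in>{1..n} - {i}. (\<phi> (int (l i)) (?B i - 1) - ?y l j) / (?y l i - ?y l j))" for l i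
  define K where "K l i = gp (int (l i)) (?B i) / (\<phi> (int (l i) + 1) (?B i) - ?y l i) *
     (\<Prod>j\<in>{1..n} - {i}. (\<phi> (int (l i)) (?B i + 1) - ?y l j) / (?y l i - ?y l j))" for l i
  obtain G where G: "symf n (d - 1) G" and GL: "\<And>A B y. y = (\<lambda>i. \<phi> (A i) (B i)) \<Longrightarrow> inj_on y {1..n} \<Longrightarrow>
    G y = (\<Sum>i=1..n.
      gm (A i) (B i) / (\<phi> (A i - 1) (B i) - y i) * (\<Prod>j\<in>{1..n} - {i}. (\<phi> (A i) (B i - 1) - y j) / (y i - y j)) *
        (f (y(i := \<phi> (A i - 1) (B i))) - f y) +
      gp (A i) (B i) / (\<phi> (A i + 1) (B i) - y i) * (\<Prod>j\<in>{1..n} - {i}. (\<phi> (A i) (B i + 1) - y j) / (y i - y j)) *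
        (f (y(i := \<phi> (A i + 1) (B i))) - f y))"
    using lowering_operator[OF inj adm f] by blast
  have GM: "G (?y l) = (\<Sum>i=1..n. M l i * (f ((?y l)(i := \<phi> (int (l i) - 1) (?B i))) - f (?y l)) +
      K l i * (f ((?y l)(i := \<phi> (int (l i) + 1) (?B i))) - f (?y l)))" for l
    unfolding M_def K_def
  proof (rule GL)
    show "?y l = (\<lambda>i. \<phi> (int (l i)) (?B i))" by (simp add: node_def fun_eq_iff)
    show "inj_on (?y l) {1..n}" by (rule inj_on_node) (rule inj)
  qed
  show ?thesis
  proof (intro exI[of _ G] exI[of _ K] conjI ballI impI G)
    fix l assume l: "l \<in> partitions n" and f0: "f (?y l) = 0"
      and "\<forall>l'\<in>partitions n. psize n l' < psize n l \<longrightarrow> f (?y l') = 0"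
    then have below: "f (?y l') = 0" if "l' \<in> partitions n" "psize n l' < psize n l" for l'
      using that by blast
    have "M l i * f ((?y l)(i := \<phi> (int (l i) - 1) (?B i))) = 0" if i: "i \<in> {1..n}" for i
    proof (cases "i < n \<and> l (Suc i) = l i")
      case True
      then have "\<phi> (int (l i)) (?B i - 1) - ?y l (Suc i) = 0" by (simp add: node_def diff_diff_eq add.commute)
      then have "(\<Prod>j\<in>{1..n} - {i}. (\<phi> (int (l i)) (?B i - 1) - ?y l j) / (?y l i - ?y l j)) = 0"
        using True i by (intro prod_zero bexI[of _ "Suc i"]) auto
      then show ?thesis by (simp add: M_def)
    next
      case F: False
      show ?thesis
      proof (cases "l i = 0")
        case True
        \<comment> \<open>An empty row that is not followed by an equal one must be the last, and
          its grid coordinates are \<open>(0, 0)\<close>, where \<open>gm\<close> vanishes.\<close>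
        then have "i = n" using F i partitions_mono[OF l, of i "Suc i"] by auto
        then show ?thesis using True gm0 by (simp add: M_def)
      next
        case False
        have "l(i := l i - 1) \<in> partitions n" using F i by (intro partitions_decrement[OF l]) auto
        moreover have "psize n (l(i := l i - 1)) < psize n l" using psize_update[OF i, of l "l i - 1"] False by simp
        ultimately have "f (?y (l(i := l i - 1))) = 0" by (rule below)
        then show ?thesis using False by (simp add: node_update of_nat_diff)
      qed
    qed
    then show "G (?y l) = (\<Sum>i=1..n. K l i * f (?y (l(i := Suc (l i)))))"
      unfolding GM f0 node_update by (intro sum.cong refl) (simp add: add.commute)
  next
    fix l i assume l: "l \<in> partitions n" and i: "i \<in> {1..n}"
    have d1: "\<phi> (int (l i) + 1) (?B i) - ?y l i \<noteq> 0"
      using inj[of "int (l i) + 1" "?B i" "int (l i)" "?B i"] by (auto simp: node_def)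
    have d2: "?y l i - ?y l j \<noteq> 0" if "j \<in> {1..n} - {i}" for j
    proof
      assume "?y l i - ?y l j = 0"
      then have "\<phi> (int (l i)) (?B i) = \<phi> (int (l j)) (?B j)" by (simp add: node_def)
      from inj[OF this] that show False by auto
    qed
    have "(\<exists>j\<in>{1..n} - {i}. \<phi> (int (l i)) (?B i + 1) - ?y l j = 0) \<longleftrightarrow> i \<noteq> 1 \<and> l (i - 1) = l i"
    proof
      assume "\<exists>j\<in>{1..n} - {i}. \<phi> (int (l i)) (?B i + 1) - ?y l j = 0"
      then obtain j where j: "j \<in> {1..n} - {i}" and "\<phi> (int (l i)) (?B i + 1) - ?y l j = 0"
        by blast
      from this(2) have "\<phi> (int (l i)) (?B i + 1) = \<phi> (int (l j)) (?B j)" by (simp add: node_def)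
      from inj[OF this] have "l i = l j" "i = Suc j" by auto
      then show "i \<noteq> 1 \<and> l (i - 1) = l i" using j by simp
    next
      assume c: "i \<noteq> 1 \<and> l (i - 1) = l i"
      have "?B (i - 1) = ?B i + 1" using i by simp
      then have "\<phi> (int (l i)) (?B i + 1) - ?y l (i - 1) = 0" using c by (simp only: node_def) simp
      moreover have "i - 1 \<in> {1..n} - {i}" using c i by auto
      ultimately show "\<exists>j\<in>{1..n} - {i}. \<phi> (int (l i)) (?B i + 1) - ?y l j = 0" by blast
    qed
    moreover have "(\<Prod>j\<in>{1..n} - {i}. (\<phi> (int (l i)) (?B i + 1) - ?y l j) / (?y l i - ?y l j)) = 0 \<longleftrightarrow>
      (\<exists>j\<in>{1..n} - {i}. \<phi> (int (l i)) (?B i + 1) - ?y l j = 0)"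
      unfolding prod_zero_iff[OF finite_Diff[OF finite_atLeastAtMost]] divide_eq_0_iff using d2 by blast
    ultimately show "K l i = 0 \<longleftrightarrow> (int (l i) = a1 \<and> ?B i = b1) \<or> l(i := Suc (l i)) \<notin> partitions n"
      unfolding partitions_increment_iff[OF l i] K_def mult_eq_0_iff divide_eq_0_iff gp0 using d1 by blast
  qed
qed

text \<open>Expand G in the interpolation basis, with its values at the nodes as coefficients. At v
  only the basis elements of those k contained in v, or of size below d, can contribute, and their
  coefficients are zero by assumption.\<close>

lemma vanishing_from_cocovers:
  fixes \<phi> :: "int \<Rightarrow> int \<Rightarrow> 'a::field_char_0"
  assumes inj: "\<And>a b a' b'. \<phi> a b = \<phi> a' b' \<Longrightarrow> a = a' \<and> b = b'"
    and single: "\<And>h k. symf n d h \<Longrightarrow> k \<in> partitions n \<Longrightarrow> psize n k = d \<Longrightarrow>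
       (\<And>l. l \<in> bounded_partitions n d \<Longrightarrow> l \<noteq> k \<Longrightarrow> h (node \<phi> n l) = 0) \<Longrightarrow>
       \<not> contains n v k \<Longrightarrow> h (node \<phi> n v) = 0"
    and G: "symf n d G"
    and zero: "\<And>k. k \<in> bounded_partitions n d \<Longrightarrow> psize n k < d \<or> contains n v k \<Longrightarrow> G (node \<phi> n k) = 0"
  shows "G (node \<phi> n v) = 0"
proof -
  have "\<exists>h. symf n d h \<and> (\<forall>l\<in>partitions n. psize n l \<le> d \<longrightarrow> h (node \<phi> n l) = (if l = k then 1 else 0))" for k
    by (rule interpolation_exists) (rule inj)
  then obtain h where h: "\<And>k. symf n d (h k)" and
    hv: "\<And>k l. l \<in> partitions n \<Longrightarrow> psize n l \<le> d \<Longrightarrow> h k (node \<phi> n l) = (if l = k then 1 else 0)"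
    by metis
  let ?S = "\<lambda>y. \<Sum>k\<in>bounded_partitions n d. G (node \<phi> n k) * h k y"
  have "G (node \<phi> n v) - ?S (node \<phi> n v) = 0"
  proof (rule symf_unique[OF inj, where f = "\<lambda>y. G y - ?S y"])
    show "symf n d (\<lambda>y. G y - ?S y)" by (intro symf_diff G symf_sum symf_cmult h)
    fix l assume l: "l \<in> bounded_partitions n d"
    have "?S (node \<phi> n l) = (\<Sum>k\<in>bounded_partitions n d. if k = l then G (node \<phi> n k) else 0)"
      by (intro sum.cong refl) (use l in \<open>simp add: hv\<close>)
    then show "G (node \<phi> n l) - ?S (node \<phi> n l) = 0"
      using l finite_partitions_psize_le[of n d] by simp
  qed
  moreover have "?S (node \<phi> n v) = 0"
  proof (rule sum.neutral, rule ballI)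
    fix k assume k: "k \<in> bounded_partitions n d"
    show "G (node \<phi> n k) * h k (node \<phi> n v) = 0"
    proof (cases "psize n k < d \<or> contains n v k")
      case True
      then show ?thesis using zero[OF k] by simp
    next
      case False
      then have "h k (node \<phi> n v) = 0" using k by (intro single[of "h k" k] h) (auto simp: hv)
      then show ?thesis by simp
    qed
  qed
  ultimately show ?thesis by simp
qed

text \<open>If \<open>\<nu>\<close> has a nonzero last part, apply to \<open>f\<close> the lowering operator whose up-coefficient vanishes
  at the only corner through which \<open>\<nu>\<close> with one box removed could reach \<open>\<mu>\<close>; evaluated at that
  partition, the only surviving term is a nonzero multiple of the value of \<open>f\<close> at \<open>\<nu>\<close>.\<close>

theorem extra_vanishing:
  fixes \<phi> :: "int \<Rightarrow> int \<Rightarrow> 'a::field_char_0"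
  assumes "perfect_grid \<phi> \<delta>" and "symf n d f" and "m \<in> partitions n" and "psize n m = d"
    and "\<And>l. l \<in> bounded_partitions n d \<Longrightarrow> l \<noteq> m \<Longrightarrow> f (node \<phi> n l) = 0"
    and "v \<in> partitions n" and "psize n v = Suc d" and "\<not> contains n v m"
  shows "f (node \<phi> n v) = 0"
  using assms
proof (induction n arbitrary: \<phi> \<delta> d f m v)
  case 0
  then show ?case by (simp add: psize_def)
next
  case (Suc n)
  note IHn = Suc.IH
  note grid = Suc.prems(1)
  note inj = perfect_grid_inj[OF grid]
  \<comment> \<open>Three nested inductions: on the number of variables for a vanishing last part,
    on the degree for the lowered polynomial G, and on the last part of \<open>v\<close> for the
    terms that compete with \<open>v\<close> in the final sum.\<close>
  show ?case
    using Suc.prems(2-)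
  proof (induction d arbitrary: f m v rule: less_induct)
    case (less d)
    note IHd = less.IH
    note f = less.prems(1) and m = less.prems(2,3) and fz = less.prems(4)
    show ?case
      using less.prems(5-)
    proof (induction "v (Suc n)" arbitrary: v rule: less_induct)
      case less
      note IHv = less.hyps and v = less.prems
      show ?case
      proof (cases "v (Suc n) = 0")
        case True
        \<comment> \<open>All nodes with last part 0 lie on the hyperplane where the last variable
          is \<open>\<phi> 0 0\<close>, so f is restricted to it.\<close>
        let ?f = "\<lambda>y. f (y(Suc n := \<phi> 0 0))" and ?phi = "\<lambda>a b. \<phi> a (b + 1)"
        have grid': "perfect_grid ?phi (\<lambda>a b. \<delta> a (b + 1))" by (rule perfect_grid_shift[OF grid])
        have f': "symf n d ?f" by (rule symf_restrict[OF f])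
        have eq: "?f (node ?phi n l) = f (node \<phi> (Suc n) l)" if "l (Suc n) = 0" for l
          using that by (intro symf_cong[OF f]) (auto simp: node_def algebra_simps)
        have z: "?f (node ?phi n l) = 0" if "l \<in> bounded_partitions n d" "l \<noteq> m" for l
        proof -
          have l0: "l (Suc n) = 0" using that partitions_outside[of l n "Suc n"] by simp
          then show ?thesis using that unfolding eq[of l, OF l0] by (intro fz) (simp_all add: partitions_Suc_iff psize_Suc_eq)
        qed
        have vn: "v \<in> partitions n" "psize n v = Suc d"
          using v True by (simp_all add: partitions_Suc_iff psize_Suc_eq)
        have "?f (node ?phi n v) = 0"
        proof (cases "m (Suc n) = 0")
          case m0: True
          then have m': "m \<in> partitions n" "psize n m = d" "\<not> contains n v m"
            using m v(3) by (simp_all add: partitions_Suc_iff psize_Suc_eq contains_def atLeastAtMostSuc_conv)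
          show ?thesis by (rule IHn[OF grid' f' m'(1,2) z vn m'(3)])
        next
          case False
          \<comment> \<open>Here \<open>m\<close> does not occur among the partitions with fewer
            parts, so the restriction vanishes at all its nodes and is zero by uniqueness.\<close>
          then have "l \<noteq> m" if "l \<in> partitions n" for l using that partitions_outside[of l n "Suc n"] by auto
          then have z': "?f (node ?phi n l) = 0" if "l \<in> bounded_partitions n d" for l
            using that by (intro z) auto
          show ?thesis
          proof (rule symf_unique[of ?phi, OF _ f'])
            show "a = a' \<and> b = b'" if "?phi a b = ?phi a' b'" for a b a' b'
              using perfect_grid_inj[OF grid'] that by blast
          qed (rule z')
        qed
        then show ?thesis using eq[of v, OF True] by simp
      next
        case False
        let ?N = "Suc n"
        define la where "la = v(?N := v ?N - 1)"
        let ?up = "\<lambda>l i. l(i := Suc (l i)) :: nat \<Rightarrow> nat"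
        have N: "?N \<in> {1..?N}" by simp
        have l: "la \<in> partitions ?N" unfolding la_def by (rule partitions_decrement[OF v(1) N]) simp
        have lsize: "psize ?N la = d" using psize_update[OF N, of v "v ?N - 1"] False v(2) by (simp add: la_def)
        have upl: "?up la ?N = v" using False by (auto simp: la_def)
        have "la i \<le> v i" for i by (simp add: la_def)
        then have lm: "\<not> contains ?N la m" using v(3) order.trans unfolding contains_def by blast
        have d: "d \<noteq> 0"
        proof
          assume "d = 0"
          then have "psize ?N m = 0" using m(2) by simp
          then have "\<forall>i\<in>{1..?N}. m i = 0" unfolding psize_def by (subst (asm) sum_eq_0_iff) auto
          then show False using lm by (simp add: contains_def)
        qed
        \<comment> \<open>Two different enlargements differ from \<open>la\<close> in different
          rows, so \<open>m\<close> contained in both would be contained in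
          \<open>la\<close>.\<close>
        have uniq: "i = j" if "contains ?N (?up la i) m" "contains ?N (?up la j) m" for i j
        proof (rule ccontr)
          assume "i \<noteq> j"
          have "m k \<le> la k" if "k \<in> {1..?N}" for k
            using \<open>contains ?N (?up la i) m\<close> \<open>contains ?N (?up la j) m\<close> that \<open>i \<noteq> j\<close>
            unfolding contains_def by (cases "k = i") (metis fun_upd_apply)+
          then show False using lm by (simp add: contains_def)
        qed
        obtain a1 b1 where P: "\<And>j. j \<in> {1..?N} \<Longrightarrow> contains ?N (?up la j) m \<Longrightarrow> int (la j) = a1 \<and> int ?N - int j = b1"
          and Pne: "\<not> (int (la ?N) = a1 \<and> int ?N - int ?N = b1)"
        proof (cases "\<exists>j\<in>{1..?N}. contains ?N (?up la j) m")
          case True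
          then obtain j where j: "j \<in> {1..?N}" "contains ?N (?up la j) m" by blast
          then have jN: "j \<noteq> ?N" using upl v(3) by metis
          show ?thesis
          proof (rule that[of "int (la j)" "int ?N - int j"])
            show "int (la i) = int (la j) \<and> int ?N - int i = int ?N - int j"
              if "i \<in> {1..?N}" "contains ?N (?up la i) m" for i
              using uniq[OF that(2) j(2)] by simp
          qed (use jN in simp)
        next
          case F: False
          show ?thesis
          \<comment> \<open>No corner has to be blocked. The second coordinate 1 differs from the
            coordinate 0 of row \<open>?N\<close>, so the coefficient of \<open>v\<close> stays
            nonzero.\<close>
          proof (rule that[of "int (la ?N)" 1])
            show "int (la i) = int (la ?N) \<and> int ?N - int i = 1"
              if "i \<in> {1..?N}" "contains ?N (?up la i) m" for i
              using F that by blast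
          qed simp
        qed
        obtain G K where G: "symf ?N (d - 1) G"
          and GK': "\<forall>l\<in>partitions ?N. f (node \<phi> ?N l) = 0 \<longrightarrow>
            (\<forall>l'\<in>partitions ?N. psize ?N l' < psize ?N l \<longrightarrow> f (node \<phi> ?N l') = 0) \<longrightarrow>
            G (node \<phi> ?N l) = (\<Sum>i=1..?N. K l i * f (node \<phi> ?N (?up l i)))"
          and K': "\<forall>l\<in>partitions ?N. \<forall>i\<in>{1..?N}.
            K l i = 0 \<longleftrightarrow> (int (l i) = a1 \<and> int ?N - int i = b1) \<or> ?up l i \<notin> partitions ?N"
          using lowering_on_nodes[OF grid f, of a1 b1] by (elim exE conjE) (rule that)
        have GK: "G (node \<phi> ?N l) = (\<Sum>i=1..?N. K l i * f (node \<phi> ?N (?up l i)))"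
          if "l \<in> partitions ?N" "f (node \<phi> ?N l) = 0"
            "\<And>l'. l' \<in> partitions ?N \<Longrightarrow> psize ?N l' < psize ?N l \<Longrightarrow> f (node \<phi> ?N l') = 0" for l
          using GK' that by blast
        have K: "K l i = 0 \<longleftrightarrow> (int (l i) = a1 \<and> int ?N - int i = b1) \<or> ?up l i \<notin> partitions ?N"
          if "l \<in> partitions ?N" "i \<in> {1..?N}" for l i
          using K' that by blast
        have "G (node \<phi> ?N la) = 0"
        \<comment> \<open>The induction hypothesis in degree \<open>d - 1\<close> applies at
          \<open>la\<close>, whose size is d; what remains is that G vanishes at all smaller nodes
          and at those of size \<open>d - 1\<close> contained in \<open>la\<close>.\<close>
        proof (rule vanishing_from_cocovers[OF inj _ G])
          fix h k assume "symf ?N (d - 1) h" "k \<in> partitions ?N" "psize ?N k = d - 1"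
            "\<And>l. l \<in> bounded_partitions ?N (d - 1) \<Longrightarrow> l \<noteq> k \<Longrightarrow> h (node \<phi> ?N l) = 0" "\<not> contains ?N la k"
          then show "h (node \<phi> ?N la) = 0" using d l lsize by (intro IHd[of "d - 1" h k la]) auto
        next
          fix k assume k: "k \<in> bounded_partitions ?N (d - 1)" and kl: "psize ?N k < d - 1 \<or> contains ?N la k"
          have terms: "K k i * f (node \<phi> ?N (?up k i)) = 0" if i: "i \<in> {1..?N}" for i
          proof (cases "?up k i \<in> partitions ?N \<and> ?up k i = m")
            case True
            have usz: "psize ?N (?up k i) = Suc (psize ?N k)" using psize_update[OF i, of k "Suc (k i)"] by simp
            then have "psize ?N k = d - 1" using True m d by simp
            then have ck: "contains ?N la k" using kl by simp
            then have cm: "contains ?N (?up la i) m" using True by (auto simp: contains_def)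
            \<comment> \<open>The box leading from \<open>k\<close> to \<open>m\<close> lies outside
              \<open>la\<close>, since otherwise \<open>la\<close> would contain \<open>m\<close>.
              Hence \<open>k i = la i\<close> and the move starts at the blocked point
              \<open>(a1, b1)\<close>.\<close>
            have "\<not> k i < la i"
            proof
              assume "k i < la i"
              then have "contains ?N la m" using ck True by (auto simp: contains_def)
              then show False using lm by simp
            qed
            moreover have "k i \<le> la i" using ck i unfolding contains_def by blast
            ultimately have "k i = la i" by simp
            then have "K k i = 0" using P[OF i cm] K[of k i] k i by auto
            then show ?thesis by simp
          next
            case F: False
            show ?thesis
            proof (cases "?up k i \<in> partitions ?N")
              case True
              have "psize ?N (?up k i) = Suc (psize ?N k)" using psize_update[OF i, of k "Suc (k i)"] by simp
              moreover have "psize ?N k \<le> d - 1" using k by blast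
              ultimately have "psize ?N (?up k i) \<le> d" using d by linarith
              then have "f (node \<phi> ?N (?up k i)) = 0" using True F by (intro fz CollectI conjI) blast+
              then show ?thesis by simp
            next
              case False
              then show ?thesis using K[of k i] k i by simp
            qed
          qed
          have "G (node \<phi> ?N k) = (\<Sum>i=1..?N. K k i * f (node \<phi> ?N (?up k i)))"
            using k d m by (intro GK fz) auto
          also have "\<dots> = 0" using terms by (rule sum.neutral[OF ballI])
          finally show "G (node \<phi> ?N k) = 0" .
        qed
        moreover have "G (node \<phi> ?N la) = (\<Sum>i=1..?N. K la i * f (node \<phi> ?N (?up la i)))"
        proof (rule GK[OF l])
          have "la \<noteq> m" using lm by (auto simp: contains_def)
          then show "f (node \<phi> ?N la) = 0" using l lsize by (intro fz) auto
          show "f (node \<phi> ?N l') = 0" if "l' \<in> partitions ?N" "psize ?N l' < psize ?N la" for l'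
            using that m lsize by (intro fz) auto
        qed
        \<comment> \<open>The other enlargements of \<open>la\<close> are blocked, not partitions,
          or not above \<open>m\<close>; in the last case their last part is smaller than that of
          \<open>v\<close> and the innermost induction applies.\<close>
        moreover have "K la i * f (node \<phi> ?N (?up la i)) = 0" if i: "i \<in> {1..?N}" "i \<noteq> ?N" for i
        proof (cases "contains ?N (?up la i) m \<or> ?up la i \<notin> partitions ?N")
          case True
          then have "K la i = 0" using K[OF l i(1)] P[OF i(1)] by blast
          then show ?thesis by simp
        next
          case F: False
          have sz: "psize ?N (?up la i) = Suc d" using psize_update[OF i(1), of la "Suc (la i)"] lsize by simp
          have "(?up la i) ?N < v ?N" using i(2) False by (simp add: la_def)
          then have "f (node \<phi> ?N (?up la i)) = 0"
            using F sz by (intro IHv) blast+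
          then show ?thesis by simp
        qed
        then have "(\<Sum>i=1..?N. K la i * f (node \<phi> ?N (?up la i))) = K la ?N * f (node \<phi> ?N v)"
          unfolding sum.remove[OF finite_atLeastAtMost N] upl by (subst sum.neutral) auto
        moreover have "K la ?N \<noteq> 0" using K[OF l N] Pne upl v(1) by simp
        ultimately show ?thesis by simp
      qed
    qed
  qed
qed


section \<open>Laurent polynomials\<close>

abbreviation (input) "lk \<equiv> Poly_Mapping.lookup"
abbreviation (input) "ks \<equiv> Poly_Mapping.keys"

lemma poly_mapping_eq_sum_single: "f = (\<Sum>m\<in>ks f. Poly_Mapping.single m (lk f m))"
proof (rule poly_mapping_eqI)
  fix k
  have "(\<Sum>m\<in>ks f. lk (Poly_Mapping.single m (lk f m)) k) = (\<Sum>m\<in>ks f. if m = k then lk f k else 0)"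
    by (intro sum.cong refl) (auto simp: lookup_single when_def)
  also have "\<dots> = lk f k" by (simp add: in_keys_iff)
  finally show "lk f k = lk (\<Sum>m\<in>ks f. Poly_Mapping.single m (lk f m)) k" by (simp add: lookup_sum)
qed

lemma mult_eq_sum_single:
  fixes f g :: "'k::comm_monoid_add \<Rightarrow>\<^sub>0 'a::comm_semiring_1"
  shows "f * g = (\<Sum>a\<in>ks f. \<Sum>b\<in>ks g. Poly_Mapping.single (a + b) (lk f a * lk g b))"
proof -
  have "f * g = (\<Sum>a\<in>ks f. Poly_Mapping.single a (lk f a)) * (\<Sum>b\<in>ks g. Poly_Mapping.single b (lk g b))"
    using poly_mapping_eq_sum_single[of f] poly_mapping_eq_sum_single[of g] by (rule arg_cong2)
  then show ?thesis by (simp add: sum_product mult_single)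
qed

section \<open>Permutations acting on Laurent polynomials\<close>

definition lact :: "(nat \<Rightarrow> nat) \<Rightarrow> 'a::field laurent \<Rightarrow> 'a laurent" where
  "lact s f = Poly_Mapping.map_key (Poly_Mapping.map_key s) f"

text \<open>\<open>lact\<close> reindexes twice, the variables inside an exponent vector and the
  exponent vectors themselves; the rule for \<open>map_key\<close> needs injectivity at the outer
  level too.\<close>

lemma inj_map_key_bij:
  assumes "bij s"
  shows "inj (Poly_Mapping.map_key s :: ('b \<Rightarrow>\<^sub>0 'c::zero) \<Rightarrow> 'a \<Rightarrow>\<^sub>0 'c)"
proof (rule injI)
  fix p q :: "'b \<Rightarrow>\<^sub>0 'c"
  assume "Poly_Mapping.map_key s p = Poly_Mapping.map_key s q"
  then have "lk (Poly_Mapping.map_key s p) = lk (Poly_Mapping.map_key s q)" by simp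
  then have "lk p \<circ> s = lk q \<circ> s" using assms by (simp only: map_key.rep_eq bij_is_inj)
  then have "lk p i = lk q i" for i using bij_is_surj[OF assms] by (metis comp_apply surjD)
  then show "p = q" by (rule poly_mapping_eqI)
qed

context
  fixes s :: "nat \<Rightarrow> nat"
  assumes s: "bij s"
begin

lemma lookup_lact: "lk (lact s f) m = lk f (Poly_Mapping.map_key s m)"
  unfolding lact_def by (simp add: map_key.rep_eq[OF inj_map_key_bij[OF s]])

lemma lact_add: "lact s (f + g) = lact s f + lact s g"
  by (rule poly_mapping_eqI) (simp add: lookup_lact lookup_add)

lemma lact_zero: "lact s 0 = 0"
  by (rule poly_mapping_eqI) (simp add: lookup_lact)

lemma lact_sum: "lact s (\<Sum>x\<in>X. f x) = (\<Sum>x\<in>X. lact s (f x))"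
  by (induction X rule: infinite_finite_induct) (simp_all add: lact_zero lact_add)

lemma map_key_inv: "Poly_Mapping.map_key s (Poly_Mapping.map_key (inv s) m) = (m :: nat \<Rightarrow>\<^sub>0 int)"
  "Poly_Mapping.map_key (inv s) (Poly_Mapping.map_key s m) = m"
proof -
  have i: "inj s" "inj (inv s)" using s by (simp_all add: bij_is_inj bij_imp_bij_inv)
  show "Poly_Mapping.map_key s (Poly_Mapping.map_key (inv s) m) = m"
    using s by (intro poly_mapping_eqI) (simp add: map_key.rep_eq i bij_is_inj inv_f_f)
  show "Poly_Mapping.map_key (inv s) (Poly_Mapping.map_key s m) = m"
    using s by (intro poly_mapping_eqI) (simp add: map_key.rep_eq i bij_is_surj surj_f_inv_f)
qed

lemma lact_single: "lact s (Poly_Mapping.single m c) = Poly_Mapping.single (Poly_Mapping.map_key (inv s) m) c"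
proof (rule poly_mapping_eqI)
  fix k :: "nat \<Rightarrow>\<^sub>0 int"
  have "m = Poly_Mapping.map_key s k \<longleftrightarrow> Poly_Mapping.map_key (inv s) m = k"
    using map_key_inv(1)[of m] map_key_inv(2)[of k] by metis
  then show "lk (lact s (Poly_Mapping.single m c)) k = lk (Poly_Mapping.single (Poly_Mapping.map_key (inv s) m) c) k"
    by (simp add: lookup_lact lookup_single when_def)
qed

lemma lact_mult: "lact s (f * g) = lact s f * lact s g"
proof -
  have inj: "inj (inv s)" using s by (simp add: bij_is_inj bij_imp_bij_inv)
  have 1: "lact s f = (\<Sum>a\<in>ks f. Poly_Mapping.single (Poly_Mapping.map_key (inv s) a) (lk f a))" for f :: "'a::field laurent"
    by (subst poly_mapping_eq_sum_single[of f]) (simp only: lact_sum lact_single)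
  have "lact s (f * g) = (\<Sum>a\<in>ks f. \<Sum>b\<in>ks g. Poly_Mapping.single (Poly_Mapping.map_key (inv s) (a + b)) (lk f a * lk g b))"
    by (subst mult_eq_sum_single) (simp only: lact_sum lact_single)
  also have "\<dots> = lact s f * lact s g"
    unfolding 1 by (simp add: sum_product mult_single map_key_plus[OF inj])
  finally show ?thesis .
qed

lemma lact_lconst: "lact s (lconst c) = lconst c"
  unfolding lconst_def lact_single using s by (simp add: bij_is_inj bij_imp_bij_inv)

lemma lact_one: "lact s 1 = 1"
  using lact_lconst[of 1] by (simp add: lconst_def)

lemma lact_power: "lact s (f ^ k) = lact s f ^ k"
  by (induction k) (simp_all add: lact_one lact_mult)

lemma lact_prod: "lact s (\<Prod>x\<in>X. f x) = (\<Prod>x\<in>X. lact s (f x))"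
  by (induction X rule: infinite_finite_induct) (simp_all add: lact_one lact_mult)

lemma lact_lvar: "lact s (lvar i k) = lvar (s i) k"
proof -
  have "Poly_Mapping.map_key (inv s) (Poly_Mapping.single i k) = Poly_Mapping.single (s i) k"
    using s map_key_single[of "inv s" "s i" k] by (simp add: bij_is_inj bij_imp_bij_inv inv_f_f)
  then show ?thesis unfolding lvar_def lact_single by simp
qed

end

lemma lsymmetric_iff: "lsymmetric n f \<longleftrightarrow> (\<forall>s. s permutes {1..n} \<longrightarrow> lact s f = f)"
  unfolding lsymmetric_def poly_mapping_eq_iff fun_eq_iff
  using lookup_lact[OF permutes_bij] by metis

section \<open>Monomials and evaluation\<close>

definition lmon :: "(nat \<Rightarrow>\<^sub>0 int) \<Rightarrow> (nat \<Rightarrow> 'a::field) \<Rightarrow> 'a" where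
  "lmon m x = (\<Prod>i\<in>ks m. x i powi lk m i)"

lemma lmon_superset: "finite B \<Longrightarrow> ks m \<subseteq> B \<Longrightarrow> lmon m x = (\<Prod>i\<in>B. x i powi lk m i)"
  unfolding lmon_def by (rule prod.mono_neutral_left) (auto simp: in_keys_iff)

lemma lmon_add:
  assumes "\<And>i. x i \<noteq> 0 \<or> (lk a i \<ge> 0 \<and> lk b i \<ge> 0)"
  shows "lmon (a + b) x = lmon a x * lmon b x"
proof -
  let ?B = "ks a \<union> ks b"
  have "x i powi (lk a i + lk b i) = x i powi lk a i * x i powi lk b i" for i
  \<comment> \<open>At base 0 the power law can fail only when nonzero exponents cancel, because
    \<open>0 powi 0\<close> is 1; nonnegative exponents with sum 0 are both 0.\<close>
  proof (cases "x i = 0 \<and> lk a i + lk b i = 0")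
    case True
    then have "lk a i = 0" "lk b i = 0" using assms[of i] by linarith+
    then show ?thesis by simp
  qed (auto intro!: power_int_add)
  then show ?thesis
    by (subst (1 2 3) lmon_superset[of ?B]) (simp_all add: keys_add lookup_add prod.distrib)
qed

lemma leval_superset: "finite A \<Longrightarrow> ks f \<subseteq> A \<Longrightarrow> leval f x = (\<Sum>m\<in>A. lk f m * lmon m x)"
  unfolding leval_def lmon_def by (rule sum.mono_neutral_left) (auto simp: in_keys_iff)

lemma leval_add: "leval (f + g) x = leval f x + leval g x"
proof -
  let ?A = "ks f \<union> ks g"
  show ?thesis
    by (subst (1 2 3) leval_superset[of ?A]) (simp_all add: keys_add lookup_add sum.distrib ring_distribs)
qed

lemma leval_zero: "leval 0 x = 0"
  by (simp add: leval_def)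

lemma leval_sum: "leval (\<Sum>a\<in>A. f a) x = (\<Sum>a\<in>A. leval (f a) x)"
  by (induction A rule: infinite_finite_induct) (simp_all add: leval_zero leval_add)

lemma leval_single: "leval (Poly_Mapping.single m c) x = c * lmon m x"
  by (subst leval_superset[of "{m}"]) auto

lemma leval_lconst: "leval (lconst c) x = c"
  by (simp add: lconst_def leval_single lmon_def)

text \<open>Only where no variable with a negative exponent vanishes is evaluation multiplicative.\<close>

definition lregular :: "'a::field laurent \<Rightarrow> (nat \<Rightarrow> 'a) \<Rightarrow> bool" where
  "lregular f x \<longleftrightarrow> (\<forall>m\<in>ks f. \<forall>i. x i \<noteq> 0 \<or> lk m i \<ge> 0)"

lemma leval_mult:
  assumes "lregular f x" "lregular g x"
  shows "leval (f * g) x = leval f x * leval g x"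
proof -
  have "leval (f * g) x = (\<Sum>a\<in>ks f. \<Sum>b\<in>ks g. lk f a * lk g b * lmon (a + b) x)"
    by (subst mult_eq_sum_single) (simp only: leval_sum leval_single)
  also have "\<dots> = (\<Sum>a\<in>ks f. \<Sum>b\<in>ks g. (lk f a * lmon a x) * (lk g b * lmon b x))"
  proof (intro sum.cong refl)
    fix a b assume "a \<in> ks f" "b \<in> ks g"
    then have "lmon (a + b) x = lmon a x * lmon b x" using assms by (intro lmon_add) (auto simp: lregular_def)
    then show "lk f a * lk g b * lmon (a + b) x = (lk f a * lmon a x) * (lk g b * lmon b x)" by simp
  qed
  also have "\<dots> = leval f x * leval g x" by (simp add: leval_def lmon_def sum_product)
  finally show ?thesis .
qed

lemma lregular_mult:
  assumes "lregular f x" "lregular g x"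
  shows "lregular (f * g) x"
  unfolding lregular_def
proof (intro ballI allI)
  fix m i assume "m \<in> ks (f * g)"
  then obtain a b where "m = a + b" "a \<in> ks f" "b \<in> ks g" using keys_mult[of f g] by blast
  moreover from this have "x i \<noteq> 0 \<or> lk a i \<ge> 0" "x i \<noteq> 0 \<or> lk b i \<ge> 0"
    using assms unfolding lregular_def by blast+
  ultimately show "x i \<noteq> 0 \<or> lk m i \<ge> 0" by (auto simp: lookup_add)
qed

lemma lregular_add: "lregular f x \<Longrightarrow> lregular g x \<Longrightarrow> lregular (f + g) x"
  unfolding lregular_def using keys_add[of f g] by blast

lemma lregular_lconst: "lregular (lconst c) x"
  by (auto simp: lregular_def lconst_def split: if_splits)

lemma one_eq_lconst: "(1 :: 'a::field laurent) = lconst 1"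
  by (simp add: lconst_def)

lemma lregular_power: "lregular f x \<Longrightarrow> lregular (f ^ k) x \<and> leval (f ^ k) x = leval f x ^ k"
  by (induction k) (auto simp: lregular_mult leval_mult lregular_lconst leval_lconst one_eq_lconst)

lemma lregular_prod:
  "(\<And>a. a \<in> A \<Longrightarrow> lregular (f a) x) \<Longrightarrow> lregular (\<Prod>a\<in>A. f a) x \<and> leval (\<Prod>a\<in>A. f a) x = (\<Prod>a\<in>A. leval (f a) x)"
  by (induction A rule: infinite_finite_induct) (auto simp: lregular_mult leval_mult lregular_lconst leval_lconst one_eq_lconst)

lemma lregular_sum: "(\<And>a. a \<in> A \<Longrightarrow> lregular (f a) x) \<Longrightarrow> lregular (\<Sum>a\<in>A. f a) x"
proof (induction A rule: infinite_finite_induct)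
  case (insert a A)
  then show ?case by (simp add: lregular_add)
qed (simp_all add: lregular_def)

section \<open>Degree with absolute exponents\<close>

definition exp_degree :: "(nat \<Rightarrow>\<^sub>0 int) \<Rightarrow> nat" where
  "exp_degree m = (\<Sum>i\<in>ks m. nat \<bar>lk m i\<bar>)"

lemma ldegree_le_iff: "ldegree f \<le> d \<longleftrightarrow> (\<forall>m\<in>ks f. exp_degree m \<le> d)"
  unfolding ldegree_def exp_degree_def by (subst Max_le_iff) auto

lemma exp_degree_superset: "finite B \<Longrightarrow> ks m \<subseteq> B \<Longrightarrow> exp_degree m = (\<Sum>i\<in>B. nat \<bar>lk m i\<bar>)"
  unfolding exp_degree_def by (rule sum.mono_neutral_left) (auto simp: in_keys_iff)

lemma exp_degree_add: "exp_degree (a + b) \<le> exp_degree a + exp_degree b"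
proof -
  let ?B = "ks a \<union> ks b"
  show ?thesis
    by (subst (1 2 3) exp_degree_superset[of ?B])
       (auto simp: keys_add lookup_add sum.distrib[symmetric] intro!: sum_mono)
qed

lemma ldegree_mult: "ldegree f \<le> d \<Longrightarrow> ldegree g \<le> e \<Longrightarrow> ldegree (f * g) \<le> d + e"
  unfolding ldegree_le_iff
proof
  fix m assume *: "\<forall>m\<in>ks f. exp_degree m \<le> d" "\<forall>m\<in>ks g. exp_degree m \<le> e" "m \<in> ks (f * g)"
  then obtain a b where "m = a + b" "a \<in> ks f" "b \<in> ks g" using keys_mult[of f g] by blast
  then show "exp_degree m \<le> d + e" using exp_degree_add[of a b] * by fastforce
qed

lemma ldegree_add: "ldegree f \<le> d \<Longrightarrow> ldegree g \<le> d \<Longrightarrow> ldegree (f + g) \<le> d"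
  unfolding ldegree_le_iff using keys_add[of f g] by blast

lemma ldegree_lconst: "ldegree (lconst c) \<le> d"
  unfolding ldegree_le_iff by (auto simp: lconst_def exp_degree_def split: if_splits)

lemma ldegree_sum: "(\<And>a. a \<in> A \<Longrightarrow> ldegree (f a) \<le> d) \<Longrightarrow> ldegree (\<Sum>a\<in>A. f a) \<le> d"
proof (induction A rule: infinite_finite_induct)
  case (insert a A)
  then show ?case by (simp add: ldegree_add)
qed (simp_all add: ldegree_le_iff)

lemma ldegree_power: "ldegree f \<le> d \<Longrightarrow> ldegree (f ^ k) \<le> d * k"
proof (induction k)
  case 0
  then show ?case using ldegree_lconst[of 1 0] by (simp add: one_eq_lconst)
next
  case (Suc k)
  then show ?case using ldegree_mult[of f d "f ^ k" "d * k"] by simp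
qed

lemma ldegree_prod: "finite A \<Longrightarrow> (\<And>a. a \<in> A \<Longrightarrow> ldegree (f a) \<le> d a) \<Longrightarrow> ldegree (\<Prod>a\<in>A. f a) \<le> (\<Sum>a\<in>A. d a)"
proof (induction A rule: finite_induct)
  case empty
  then show ?case using ldegree_lconst[of 1 0] by (simp add: one_eq_lconst)
next
  case (insert x A)
  then show ?case by (simp add: ldegree_mult)
qed

text \<open>A leading monomial for the componentwise order on absolute exponents. It treats
  \<open>lvar i 1 + lvar i (- 1)\<close> like a plain power of a variable, and its coefficient
  cannot cancel in products.\<close>

definition dominant :: "(nat \<Rightarrow>\<^sub>0 int) \<Rightarrow> 'a::field laurent \<Rightarrow> bool" where
  "dominant m f \<longleftrightarrow> (\<forall>k\<in>ks f. \<forall>i. \<bar>lk k i\<bar> \<le> lk m i) \<and> lk f m = 1"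

text \<open>If two exponents within the bounds add up to \<open>m + k\<close>, both bounds are
  attained, so a single pair of monomials contributes to the top coefficient.\<close>

lemma dominant_mult:
  assumes "dominant m f" "dominant k g"
  shows "dominant (m + k) (f * g)"
  unfolding dominant_def
proof (intro conjI ballI allI)
  fix e i assume "e \<in> ks (f * g)"
  then obtain a b where "e = a + b" "a \<in> ks f" "b \<in> ks g" using keys_mult[of f g] by blast
  moreover from this have "\<bar>lk a i\<bar> \<le> lk m i" "\<bar>lk b i\<bar> \<le> lk k i"
    using assms unfolding dominant_def by blast+
  ultimately show "\<bar>lk e i\<bar> \<le> lk (m + k) i" by (simp add: lookup_add)
next
  have eq: "a = m \<and> b = k" if "a \<in> ks f" "b \<in> ks g" "a + b = m + k" for a b
  proof -
    have "lk a i = lk m i \<and> lk b i = lk k i" for i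
    proof -
      have "\<bar>lk a i\<bar> \<le> lk m i" "\<bar>lk b i\<bar> \<le> lk k i"
        using assms that unfolding dominant_def by blast+
      moreover have "lk a i + lk b i = lk m i + lk k i" using that(3) by (metis lookup_add)
      ultimately show ?thesis by linarith
    qed
    then show ?thesis by (auto intro: poly_mapping_eqI)
  qed
  have mk: "m \<in> ks f" "k \<in> ks g" using assms by (auto simp: dominant_def in_keys_iff)
  have "lk (f * g) (m + k) = (\<Sum>a\<in>ks f. \<Sum>b\<in>ks g. if a + b = m + k then lk f a * lk g b else 0)"
    by (subst mult_eq_sum_single) (simp add: lookup_sum lookup_single when_def)
  also have "\<dots> = (\<Sum>a\<in>ks f. \<Sum>b\<in>ks g. if a = m \<and> b = k then lk f a * lk g b else 0)"
    using eq by (intro sum.cong refl) auto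
  also have "\<dots> = (\<Sum>a\<in>ks f. if a = m then lk f m * lk g k else 0)"
    using mk by (intro sum.cong refl) simp
  also have "\<dots> = 1" using mk assms by (simp add: dominant_def)
  finally show "lk (f * g) (m + k) = 1" .
qed

lemma dominant_one: "dominant 0 1"
  by (simp add: dominant_def)

lemma dominant_power: "dominant (Poly_Mapping.single i w) f \<Longrightarrow> dominant (Poly_Mapping.single i (w * int k)) (f ^ k)"
proof (induction k)
  case 0
  then show ?case by (simp add: dominant_one)
next
  case (Suc k)
  then show ?case using dominant_mult[of "Poly_Mapping.single i w" f "Poly_Mapping.single i (w * int k)" "f ^ k"]
    by (simp add: single_add[symmetric] algebra_simps)
qed

lemma dominant_prod:
  "finite A \<Longrightarrow> (\<And>a. a \<in> A \<Longrightarrow> dominant (m a) (f a)) \<Longrightarrow> dominant (\<Sum>a\<in>A. m a) (\<Prod>a\<in>A. f a)"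
  by (induction A rule: finite_induct) (auto simp: dominant_one dominant_mult)


section \<open>The symmetric ring of a family\<close>

lemma lconst_add: "lconst (a + b) = lconst a + lconst b"
  by (simp add: lconst_def single_add)

lemma lconst_mult: "lconst (a * b) = lconst a * lconst b"
  by (simp add: lconst_def mult_single)

lemma lconst_sum: "lconst (\<Sum>x\<in>A. f x) = (\<Sum>x\<in>A. lconst (f x))"
proof (induction A rule: infinite_finite_induct)
  case (insert a A)
  then show ?case by (simp add: lconst_add)
qed (simp_all add: lconst_def)

lemma lconst_of_nat: "lconst (of_nat k) = of_nat k"
  by (simp add: lconst_def)

lemma adjoin_sum: "(\<And>a. a \<in> A \<Longrightarrow> f a \<in> adjoin X) \<Longrightarrow> (\<Sum>a\<in>A. f a) \<in> adjoin X"
proof (induction A rule: infinite_finite_induct)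
  case (insert a A)
  then show ?case by (simp add: adjoin_add)
qed (use adjoin_const[of 0 X] in \<open>simp_all add: lconst_def\<close>)

lemma adjoin_power: "f \<in> adjoin X \<Longrightarrow> f ^ k \<in> adjoin X"
proof (induction k)
  case 0
  then show ?case using adjoin_const[of 1 X] by (simp add: one_eq_lconst)
next
  case (Suc k)
  then show ?case by (simp add: adjoin_mult)
qed

lemma adjoin_prod: "(\<And>a. a \<in> A \<Longrightarrow> f a \<in> adjoin X) \<Longrightarrow> (\<Prod>a\<in>A. f a) \<in> adjoin X"
proof (induction A rule: infinite_finite_induct)
  case (insert a A)
  then show ?case by (simp add: adjoin_mult)
qed (use adjoin_const[of 1 X] in \<open>simp_all add: one_eq_lconst\<close>)

lemma permutes_in_interval: "s \<in> {s. s permutes {1..n}} \<Longrightarrow> i \<in> {1..n} \<Longrightarrow> s i \<in> {1..n::nat}"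
  using permutes_in_image[of s "{1..n}" i] by simp

text \<open>The assumptions on \<open>gen\<close> let symmetric polynomials in the generators be
  handled as functions of the grid values, with degrees scaled by \<open>w\<close>. The last one
  keeps the denominators of the chain weights nonzero.\<close>

locale grid_family =
  fixes F :: "'a::field_char_0 family" and \<phi> \<delta> :: "int \<Rightarrow> int \<Rightarrow> 'a" and n w :: nat
  assumes nvars: "nvars F = n" and deg: "deg_factor F = w" "w \<ge> 1"
    and grid: "perfect_grid \<phi> \<delta>"
    and gen_lact: "s permutes {1..n} \<Longrightarrow> i \<in> {1..n} \<Longrightarrow> lact s (gen F i) = gen F (s i)"
    and gen_dominant: "i \<in> {1..n} \<Longrightarrow> dominant (Poly_Mapping.single i (int w)) (gen F i)"
    and gen_regular: "l \<in> partitions n \<Longrightarrow> i \<in> {1..n} \<Longrightarrow> lregular (gen F i) (shifted F l)"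
    and gen_eval: "l \<in> partitions n \<Longrightarrow> i \<in> {1..n} \<Longrightarrow> leval (gen F i) (shifted F l) = node \<phi> n l i"
    and pnorm_eq: "l \<in> partitions n \<Longrightarrow> pnorm F (shifted F l) = (\<Sum>i=1..n. node \<phi> n l i)"
    and pnorm_separates: "l \<in> partitions n \<Longrightarrow> m \<in> partitions n \<Longrightarrow> psize n l \<noteq> psize n m \<Longrightarrow>
      (\<Sum>i=1..n. node \<phi> n l i) \<noteq> (\<Sum>i=1..n. node \<phi> n m i)"
begin

definition gmon :: "(nat \<Rightarrow> nat) \<Rightarrow> 'a laurent" where
  "gmon k = (\<Prod>i=1..n. gen F i ^ k i)"

lemma gmon_add: "gmon (\<lambda>i. k i + k' i) = gmon k * gmon k'"
  by (simp add: gmon_def power_add prod.distrib)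

lemma ldegree_gen: "i \<in> {1..n} \<Longrightarrow> ldegree (gen F i) \<le> w"
  unfolding ldegree_le_iff
proof
  fix m assume i: "i \<in> {1..n}" and m: "m \<in> ks (gen F i)"
  have b: "\<bar>lk m j\<bar> \<le> lk (Poly_Mapping.single i (int w)) j" for j
    using gen_dominant[OF i] m unfolding dominant_def by blast
  have "ks m \<subseteq> {i}"
  proof
    fix j assume "j \<in> ks m"
    then show "j \<in> {i}" using b[of j] by (cases "j = i") (auto simp: lookup_single in_keys_iff)
  qed
  then have "exp_degree m = nat \<bar>lk m i\<bar>" by (subst exp_degree_superset[of "{i}"]) auto
  then show "exp_degree m \<le> w" using b[of i] by simp
qed

lemma sum_lact_gmon: "(\<Sum>s | s permutes {1..n}. lact s (gmon k)) = ysum n k (gen F)"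
  unfolding ysum_def gmon_def
proof (intro sum.cong refl)
  fix s assume "s \<in> {s. s permutes {1..n}}"
  then have s: "s permutes {1..n}" by simp
  show "lact s (\<Prod>i=1..n. gen F i ^ k i) = (\<Prod>i=1..n. gen F (s i) ^ k i)"
    unfolding lact_prod[OF permutes_bij[OF s]]
    by (intro prod.cong refl) (simp only: lact_power[OF permutes_bij[OF s]] gen_lact[OF s])
qed

section \<open>Symmetrised generator monomials inside the symmetric ring\<close>

abbreviation lspan :: "nat \<Rightarrow> ((nat \<Rightarrow> nat) \<Rightarrow> 'a) \<Rightarrow> 'a laurent" where
  "lspan d c \<equiv> \<Sum>l\<in>bounded_partitions n d. lconst (c l) * ysum n l (gen F)"

lemma ysum_lsymmetric: "lsymmetric n (ysum n k (gen F))"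
  unfolding lsymmetric_iff
proof (intro allI impI)
  fix t assume t: "t permutes {1..n}"
  have "lact t (ysum n k (gen F)) = (\<Sum>s | s permutes {1..n}. \<Prod>i=1..n. gen F ((t \<circ> s) i) ^ k i)"
    unfolding ysum_def lact_sum[OF permutes_bij[OF t]]
  proof (intro sum.cong refl)
    fix s assume "s \<in> {s. s permutes {1..n}}"
    then have s: "s i \<in> {1..n}" if "i \<in> {1..n}" for i using that by (rule permutes_in_interval)
    show "lact t (\<Prod>i=1..n. gen F (s i) ^ k i) = (\<Prod>i=1..n. gen F ((t \<circ> s) i) ^ k i)"
      unfolding lact_prod[OF permutes_bij[OF t]] lact_power[OF permutes_bij[OF t]]
      by (intro prod.cong refl) (simp only: gen_lact[OF t s] comp_apply)
  qed
  also have "\<dots> = ysum n k (gen F)"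
    unfolding ysum_def by (rule sum_permutes_compose_left[OF t])
  finally show "lact t (ysum n k (gen F)) = ysum n k (gen F)" .
qed

lemma ysum_gen_in_adjoin: "ysum n k (gen F) \<in> adjoin (gen F ` {1..n})"
  unfolding ysum_def
proof (intro adjoin_sum adjoin_prod adjoin_power adjoin_gen imageI)
  show "s i \<in> {1..n}" if "s \<in> {s. s permutes {1..n}}" "i \<in> {1..n}" for s i
    using that by (rule permutes_in_interval)
qed

lemma ldegree_ysum: "ldegree (ysum n k (gen F)) \<le> w * psize n k"
  unfolding ysum_def psize_def sum_distrib_left
proof (intro ldegree_sum ldegree_prod ldegree_power ldegree_gen)
  show "s i \<in> {1..n}" if "s \<in> {s. s permutes {1..n}}" "i \<in> {1..n}" for s i
    using that by (rule permutes_in_interval)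
qed simp

lemma lregular_leval_ysum:
  assumes l: "l \<in> partitions n"
  shows "lregular (ysum n k (gen F)) (shifted F l)" "leval (ysum n k (gen F)) (shifted F l) = ysum n k (node \<phi> n l)"
proof -
  let ?x = "shifted F l"
  have g: "lregular (gen F (s i) ^ k i) ?x \<and> leval (gen F (s i) ^ k i) ?x = node \<phi> n l (s i) ^ k i"
    if "s \<in> {s. s permutes {1..n}}" "i \<in> {1..n}" for s i
    using lregular_power[OF gen_regular[OF l permutes_in_interval[OF that]], of "k i"]
      gen_eval[OF l permutes_in_interval[OF that]] by simp
  have p: "lregular (\<Prod>i=1..n. gen F (s i) ^ k i) ?x \<and>
      leval (\<Prod>i=1..n. gen F (s i) ^ k i) ?x = (\<Prod>i=1..n. leval (gen F (s i) ^ k i) ?x)"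
    if "s \<in> {s. s permutes {1..n}}" for s
    by (rule lregular_prod) (use g[OF that] in blast)
  show "lregular (ysum n k (gen F)) ?x" unfolding ysum_def using p by (intro lregular_sum) blast
  have "leval (\<Prod>i=1..n. gen F (s i) ^ k i) ?x = (\<Prod>i=1..n. node \<phi> n l (s i) ^ k i)"
    if "s \<in> {s. s permutes {1..n}}" for s
    unfolding p[OF that, THEN conjunct2] by (rule prod.cong[OF refl]) (use g[OF that] in blast)
  then show "leval (ysum n k (gen F)) ?x = ysum n k (node \<phi> n l)"
    unfolding ysum_def leval_sum by (rule sum.cong[OF refl])
qed

lemma lspan_props:
  shows "lspan d c \<in> Lambda F" "ldegree (lspan d c) \<le> w * d"
    "l \<in> partitions n \<Longrightarrow> leval (lspan d c) (shifted F l) = (\<Sum>k\<in>bounded_partitions n d. c k * ysum n k (node \<phi> n l))"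
proof -
  have "lspan d c \<in> adjoin (gen F ` {1..n})"
    by (intro adjoin_sum adjoin_mult adjoin_const ysum_gen_in_adjoin)
  moreover have "lsymmetric n (lspan d c)"
    unfolding lsymmetric_iff
  proof (intro allI impI)
    fix t assume t: "t permutes {1..n}"
    have "lact t (ysum n k (gen F)) = ysum n k (gen F)" for k
      using ysum_lsymmetric t unfolding lsymmetric_iff by blast
    then show "lact t (lspan d c) = lspan d c"
      by (simp only: lact_sum[OF permutes_bij[OF t]] lact_mult[OF permutes_bij[OF t]] lact_lconst[OF permutes_bij[OF t]])
  qed
  ultimately show "lspan d c \<in> Lambda F" by (simp add: Lambda_def nvars)
  show "ldegree (lspan d c) \<le> w * d"
  proof (rule ldegree_sum)
    fix l assume l: "l \<in> bounded_partitions n d"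
    then have "w * psize n l \<le> w * d" by simp
    then have "ldegree (ysum n l (gen F)) \<le> w * d" by (rule order.trans[OF ldegree_ysum])
    then show "ldegree (lconst (c l) * ysum n l (gen F)) \<le> w * d"
      using ldegree_mult[OF ldegree_lconst[of "c l" 0], of "ysum n l (gen F)" "w * d"] by simp
  qed
  show "leval (lspan d c) (shifted F l) = (\<Sum>k\<in>bounded_partitions n d. c k * ysum n k (node \<phi> n l))" if "l \<in> partitions n"
    unfolding leval_sum
    by (intro sum.cong refl)
       (simp only: leval_mult[OF lregular_lconst lregular_leval_ysum(1)[OF that]] leval_lconst lregular_leval_ysum(2)[OF that])
qed

text \<open>Exponents outside \<open>{1..n}\<close> are pinned to \<open>0\<close>, so that distinct exponents give distinct monomials.\<close>

definition gspan :: "'a laurent set" where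
  "gspan = {f. \<exists>A c. finite A \<and> A \<subseteq> {k. \<forall>i. i \<notin> {1..n} \<longrightarrow> k i = 0} \<and> f = (\<Sum>k\<in>A. lconst (c k) * gmon k)}"

lemma gspan_term: "(\<And>i. i \<notin> {1..n} \<Longrightarrow> k i = 0) \<Longrightarrow> lconst c * gmon k \<in> gspan"
  unfolding gspan_def by (intro CollectI exI[of _ "{k}"] exI[of _ "\<lambda>_. c"]) auto

lemma gspan_add:
  assumes "f \<in> gspan" "g \<in> gspan"
  shows "f + g \<in> gspan"
proof -
  obtain A c where A: "finite A" "A \<subseteq> {k. \<forall>i. i \<notin> {1..n} \<longrightarrow> k i = 0}" "f = (\<Sum>k\<in>A. lconst (c k) * gmon k)"
    using assms(1) unfolding gspan_def by blast
  obtain B e where B: "finite B" "B \<subseteq> {k. \<forall>i. i \<notin> {1..n} \<longrightarrow> k i = 0}" "g = (\<Sum>k\<in>B. lconst (e k) * gmon k)"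
    using assms(2) unfolding gspan_def by blast
  let ?c = "\<lambda>k. if k \<in> A then c k else 0" and ?e = "\<lambda>k. if k \<in> B then e k else 0"
  have z: "lconst 0 = (0 :: 'a laurent)" by (simp add: lconst_def)
  have "f = (\<Sum>k\<in>A \<union> B. lconst (?c k) * gmon k)"
    unfolding A(3) using A(1) B(1) by (intro sum.mono_neutral_cong_left) (auto simp: z)
  moreover have "g = (\<Sum>k\<in>A \<union> B. lconst (?e k) * gmon k)"
    unfolding B(3) using A(1) B(1) by (intro sum.mono_neutral_cong_left) (auto simp: z)
  ultimately have eq: "f + g = (\<Sum>k\<in>A \<union> B. lconst (?c k + ?e k) * gmon k)"
    by (simp only: lconst_add ring_distribs sum.distrib)
  have "finite (A \<union> B)" "A \<union> B \<subseteq> {k. \<forall>i. i \<notin> {1..n} \<longrightarrow> k i = 0}" using A(1,2) B(1,2) by simp_all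
  then show ?thesis unfolding gspan_def using eq by (intro CollectI exI conjI)
qed

lemma gspan_sum: "(\<And>a. a \<in> A \<Longrightarrow> f a \<in> gspan) \<Longrightarrow> (\<Sum>a\<in>A. f a) \<in> gspan"
proof (induction A rule: infinite_finite_induct)
  case (insert a A)
  then show ?case by (simp add: gspan_add)
next
  case empty
  show ?case unfolding gspan_def by (intro CollectI exI[of _ "{}"]) simp
next
  case (infinite A)
  then show ?case unfolding gspan_def by (intro CollectI exI[of _ "{}"]) simp
qed

lemma gspan_mult:
  assumes "f \<in> gspan" "g \<in> gspan"
  shows "f * g \<in> gspan"
proof -
  obtain A c where A: "finite A" "A \<subseteq> {k. \<forall>i. i \<notin> {1..n} \<longrightarrow> k i = 0}" "f = (\<Sum>k\<in>A. lconst (c k) * gmon k)"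
    using assms(1) unfolding gspan_def by blast
  obtain B e where B: "finite B" "B \<subseteq> {k. \<forall>i. i \<notin> {1..n} \<longrightarrow> k i = 0}" "g = (\<Sum>k\<in>B. lconst (e k) * gmon k)"
    using assms(2) unfolding gspan_def by blast
  have "f * g = (\<Sum>k\<in>A. \<Sum>k'\<in>B. lconst (c k * e k') * gmon (\<lambda>i. k i + k' i))"
    unfolding A(3) B(3) sum_product gmon_add lconst_mult by (simp only: mult_ac)
  then show ?thesis using A(2) B(2) by (simp only:) (intro gspan_sum gspan_term, auto)
qed

lemma adjoin_gspan: "f \<in> adjoin (gen F ` {1..n}) \<Longrightarrow> f \<in> gspan"
proof (induction rule: adjoin.induct)
  case (adjoin_const c)
  have "lconst c * gmon (\<lambda>_. 0) \<in> gspan" by (rule gspan_term) simp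
  then show ?case by (simp add: gmon_def)
next
  case (adjoin_gen g)
  then obtain i where i: "i \<in> {1..n}" "g = gen F i" by blast
  have "lconst 1 * gmon (\<lambda>j. if j = i then 1 else 0) \<in> gspan" using i by (intro gspan_term) auto
  moreover have "gmon (\<lambda>j. if j = i then 1 else 0) = gen F i"
  proof -
    have "gmon (\<lambda>j. if j = i then 1 else 0) = (\<Prod>j=1..n. if j = i then gen F i else 1)"
      unfolding gmon_def by (intro prod.cong) auto
    then show ?thesis using i by simp
  qed
  ultimately show ?case using i by (simp flip: one_eq_lconst)
qed (simp_all add: gspan_add gspan_mult)

text \<open>Among the exponents of size above d with nonzero coefficient take one, m, of maximal
  size. Its dominant monomial occurs in \<open>gmon k\<close> only if k is componentwise at least m,
  which by maximality means \<open>k = m\<close>; it therefore survives in f and violates the degree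
  bound.\<close>

lemma gspan_coeff_zero:
  assumes A: "finite A" "A \<subseteq> {k. \<forall>i. i \<notin> {1..n} \<longrightarrow> k i = 0}" and f: "f = (\<Sum>k\<in>A. lconst (c k) * gmon k)"
    and d: "ldegree f \<le> w * d" and k: "k \<in> A" "psize n k > d"
  shows "c k = 0"
proof (rule ccontr)
  assume "c k \<noteq> 0"
  let ?B = "{k \<in> A. c k \<noteq> 0 \<and> psize n k > d}"
  have B: "finite ?B" "?B \<noteq> {}" using A k \<open>c k \<noteq> 0\<close> by auto
  then have "Max (psize n ` ?B) \<in> psize n ` ?B" by (intro Max_in) auto
  then obtain m where m: "m \<in> ?B" and "Max (psize n ` ?B) = psize n m" by blast
  then have max: "psize n k \<le> psize n m" if "k \<in> ?B" for k
    using Max_ge[of "psize n ` ?B" "psize n k"] B(1) that by simp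
  define e where "e k = (\<Sum>i=1..n. Poly_Mapping.single i (int w * int (k i)))" for k :: "nat \<Rightarrow> nat"
  have le: "lk (e k) i = (if i \<in> {1..n} then int w * int (k i) else 0)" for k i
  proof -
    have "lk (e k) i = (\<Sum>j=1..n. if j = i then int w * int (k i) else 0)"
      unfolding e_def lookup_sum by (intro sum.cong refl) (auto simp: lookup_single)
    then show ?thesis by simp
  qed
  have dom: "dominant (e k) (gmon k)" for k
    unfolding e_def gmon_def by (intro dominant_prod dominant_power gen_dominant) auto
  have scale: "lk (lconst a * g) x = a * lk g x" for a and g :: "'a laurent" and x
    unfolding lconst_def mult_map_scale_conv_mult[symmetric] by (simp add: map.rep_eq when_def)
  have other: "lk (lconst (c k) * gmon k) (e m) = 0" if "k \<in> A" "k \<noteq> m" for k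
  proof (rule ccontr)
    assume "lk (lconst (c k) * gmon k) (e m) \<noteq> 0"
    then have ck: "c k \<noteq> 0" and "lk (gmon k) (e m) \<noteq> 0" by (auto simp: scale)
    then have "e m \<in> ks (gmon k)" by (simp add: in_keys_iff)
    then have "\<bar>lk (e m) i\<bar> \<le> lk (e k) i" for i using dom[of k] unfolding dominant_def by blast
    then have b: "\<bar>lk (e m) i\<bar> \<le> lk (e k) i" for i .
    have mk: "m i \<le> k i" if i: "i \<in> {1..n}" for i
    proof -
      have "int w * int (m i) \<le> int w * int (k i)" using b[of i] unfolding le if_P[OF i] by linarith
      then have "w * m i \<le> w * k i" unfolding of_nat_mult[symmetric] of_nat_le_iff .
      then show ?thesis using deg(2) by simp
    qed
    have "psize n k \<le> psize n m"
    proof (cases "psize n k > d")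
      case True
      then show ?thesis using max that(1) ck by blast
    next
      case False
      then show ?thesis using m by simp
    qed
    then have "(\<Sum>i=1..n. m i) = (\<Sum>i=1..n. k i)"
      unfolding psize_def using sum_mono[OF mk, of "{1..n}" "\<lambda>i. i"] by linarith
    then have "m i = k i" if "i \<in> {1..n}" for i
      by (rule sum_mono_inv) (rule mk, assumption, rule that, simp)
    moreover have "m i = k i" if "i \<notin> {1..n}" for i
    proof -
      have "m \<in> A" using m by blast
      then have "m i = 0" "k i = 0" using A(2) \<open>k \<in> A\<close> that by blast+
      then show ?thesis by simp
    qed
    ultimately have "m i = k i" for i by blast
    then show False using that(2) by auto
  qed
  have "lk f (e m) = (\<Sum>k\<in>A. lk (lconst (c k) * gmon k) (e m))"
    unfolding f lookup_sum ..
  also have "\<dots> = (\<Sum>k\<in>A. if k = m then c m else 0)"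
    using other dom[of m] by (intro sum.cong refl) (auto simp: scale dominant_def)
  also have "\<dots> = c m" using m A(1) by simp
  finally have "e m \<in> ks f" using m by (simp add: in_keys_iff)
  then have "exp_degree (e m) \<le> w * d" using d unfolding ldegree_le_iff by blast
  moreover have "exp_degree (e m) = (\<Sum>i=1..n. nat \<bar>lk (e m) i\<bar>)"
    by (rule exp_degree_superset) (auto simp: in_keys_iff le split: if_splits)
  moreover have "\<dots> = w * psize n m"
    unfolding psize_def sum_distrib_left by (intro sum.cong refl) (simp add: le nat_mult_distrib)
  ultimately show False using m deg(2) by simp
qed

text \<open>Averaging over permutations: f is fixed by all of them, while each generator monomial
  becomes a symmetrised one. Excess degrees are discarded before averaging, and the division by n!
  is possible in characteristic 0.\<close>

lemma Lambda_lspan: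
  assumes "f \<in> Lambda F" "ldegree f \<le> w * d"
  shows "\<exists>c. f = lspan d c"
proof -
  have "f \<in> gspan" and sym: "lsymmetric n f" using assms(1) adjoin_gspan unfolding Lambda_def nvars by auto
  then obtain A c where A: "finite A" "A \<subseteq> {k. \<forall>i. i \<notin> {1..n} \<longrightarrow> k i = 0}" and f: "f = (\<Sum>k\<in>A. lconst (c k) * gmon k)"
    unfolding gspan_def by blast
  let ?A = "{k \<in> A. psize n k \<le> d}"
  have z: "lconst 0 = (0 :: 'a laurent)" by (simp add: lconst_def)
  have fA: "f = (\<Sum>k\<in>?A. lconst (c k) * gmon k)"
  proof -
    have "(\<Sum>k\<in>A. lconst (c k) * gmon k) = (\<Sum>k\<in>?A. lconst (c k) * gmon k)"
      using A(1) gspan_coeff_zero[OF A f assms(2)] z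
      by (intro sum.mono_neutral_right) (auto simp: not_le)
    then show ?thesis using f by simp
  qed
  let ?srt = "\<lambda>k l. l \<in> partitions n \<and> psize n l = psize n k \<and> (\<forall>y::nat \<Rightarrow> 'a laurent. ysum n l y = ysum n k y)"
  define srt where "srt k = (SOME l. ?srt k l)" for k
  have srt: "?srt k (srt k)" for k
    unfolding srt_def by (rule someI_ex[of "?srt k"]) (use ysum_eq_partition[of n k] in blast)
  have "(\<Sum>s | s permutes {1..n}. lact s f) = (\<Sum>s | s permutes {1..n}. f)"
    using sym unfolding lsymmetric_iff by (intro sum.cong refl) simp
  also have "\<dots> = lconst (fact n) * f"
    using lconst_of_nat[of "fact n", where 'a = 'a] by (simp add: card_permutations)
  finally have "lconst (fact n) * f = (\<Sum>s | s permutes {1..n}. \<Sum>k\<in>?A. lact s (lconst (c k) * gmon k))"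
    unfolding fA by (simp add: lact_sum permutes_bij)
  also have "\<dots> = (\<Sum>k\<in>?A. \<Sum>s | s permutes {1..n}. lconst (c k) * lact s (gmon k))"
    unfolding sum.swap[of _ ?A]
    by (intro sum.cong refl) (simp only: mem_Collect_eq permutes_bij lact_mult lact_lconst)
  also have "\<dots> = (\<Sum>k\<in>?A. lconst (c k) * ysum n (srt k) (gen F))"
    by (simp only: sum_distrib_left[symmetric] sum_lact_gmon srt)
  \<comment> \<open>Different exponent vectors may sort to the same partition, so their coefficients
    are collected.\<close>
  also have "\<dots> = (\<Sum>l\<in>bounded_partitions n d. \<Sum>k\<in>{k \<in> ?A. srt k = l}. lconst (c k) * ysum n (srt k) (gen F))"
    by (rule sum.group[symmetric]) (use A(1) srt finite_partitions_psize_le[of n d] in auto)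
  also have "\<dots> = (\<Sum>l\<in>bounded_partitions n d. lconst (\<Sum>k\<in>{k \<in> ?A. srt k = l}. c k) * ysum n l (gen F))"
    by (intro sum.cong refl) (simp add: lconst_sum sum_distrib_right)
  finally have "lconst (1 / fact n) * (lconst (fact n) * f) = (\<Sum>l\<in>bounded_partitions n d.
      lconst (1 / fact n) * (lconst (\<Sum>k\<in>{k \<in> ?A. srt k = l}. c k) * ysum n l (gen F)))"
    unfolding sum_distrib_left[symmetric] by (rule arg_cong)
  also have "\<dots> = lspan d (\<lambda>l. 1 / fact n * (\<Sum>k\<in>{k \<in> ?A. srt k = l}. c k))"
    by (simp only: lconst_mult mult.assoc)
  finally have "lconst (1 / fact n) * (lconst (fact n) * f) =
      lspan d (\<lambda>l. 1 / fact n * (\<Sum>k\<in>{k \<in> ?A. srt k = l}. c k))" .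
  moreover have "lconst (1 / fact n) * (lconst (fact n) * f) = f"
  proof -
    have "lconst (1 / fact n) * lconst (fact n) = (1 :: 'a laurent)"
      unfolding lconst_mult[symmetric] one_eq_lconst by simp
    then show ?thesis unfolding mult.assoc[symmetric] by simp
  qed
  ultimately have "f = lspan d (\<lambda>l. 1 / fact n * (\<Sum>k\<in>{k \<in> ?A. srt k = l}. c k))" by (simp only:)
  then show ?thesis by (rule exI[of "\<lambda>c. f = lspan d c"])
qed

end


section \<open>Pieri rule and sum over chains\<close>

context grid_family
begin

lemma phi_inj: "\<phi> a b = \<phi> a' b' \<Longrightarrow> a = a' \<and> b = b'"
  by (rule perfect_grid_inj[OF grid])

text \<open>Resolves the definite description: the interpolating symmetric polynomial is lifted to
  Laurent polynomials with the same coefficients, and any competitor in \<open>Lambda F\<close> has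
  an expansion of the same shape, whose coefficients the nodes determine.\<close>

lemma binom_eq_symf:
  assumes m: "m \<in> partitions n"
  shows "\<exists>f. symf n (psize n m) f \<and>
     (\<forall>l\<in>bounded_partitions n (psize n m). f (node \<phi> n l) = (if l = m then 1 else 0)) \<and>
     (\<forall>l\<in>partitions n. binom F l m = f (node \<phi> n l))"
proof -
  let ?d = "psize n m"
  have "\<exists>f. symf n ?d f \<and> (\<forall>l\<in>partitions n. psize n l \<le> ?d \<longrightarrow> f (node \<phi> n l) = (if l = m then 1 else 0))"
    by (rule interpolation_exists) (rule phi_inj)
  then obtain f where f: "symf n ?d f"
    and fv: "\<And>l. l \<in> bounded_partitions n ?d \<Longrightarrow> f (node \<phi> n l) = (if l = m then 1 else 0)" by blast
  from symf_ysum_span[OF f] obtain c where c: "\<And>y. f y = (\<Sum>l\<in>bounded_partitions n ?d. c l * ysum n l y)"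
    unfolding ysum_span_def by blast
  have ev: "leval (lspan ?d c) (shifted F l) = f (node \<phi> n l)" if "l \<in> partitions n" for l
    unfolding c by (rule lspan_props(3)[OF that])
  have "interp_poly F m = lspan ?d c"
    unfolding interp_poly_def
  proof (rule the_equality)
    show "is_interp_poly F m (lspan ?d c)"
      unfolding is_interp_poly_def nvars deg(1) using lspan_props(1,2) ev fv by auto
    fix h assume "is_interp_poly F m h"
    then have h: "h \<in> Lambda F" "ldegree h \<le> w * ?d"
      and hv: "\<And>l. l \<in> partitions n \<Longrightarrow> psize n l \<le> ?d \<Longrightarrow> leval h (shifted F l) = (if l = m then 1 else 0)"
      unfolding is_interp_poly_def nvars deg(1) by auto
    obtain e where e: "h = lspan ?d e" using Lambda_lspan[OF h] by blast
    have "e k - c k = 0" if "k \<in> bounded_partitions n ?d" for k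
    proof (rule ysum_coefficients_zero[where c = "\<lambda>k. e k - c k", OF phi_inj _ that])
      fix l assume l: "l \<in> bounded_partitions n ?d"
      then have "leval h (shifted F l) = f (node \<phi> n l)" using hv fv by simp
      then have "(\<Sum>k\<in>bounded_partitions n ?d. e k * ysum n k (node \<phi> n l)) =
          (\<Sum>k\<in>bounded_partitions n ?d. c k * ysum n k (node \<phi> n l))"
        using lspan_props(3)[where l = l and d = ?d and c = e] l unfolding e c by simp
      then show "(\<Sum>k\<in>bounded_partitions n ?d. (e k - c k) * ysum n k (node \<phi> n l)) = 0"
        by (simp only: left_diff_distrib sum_subtractf) simp
    qed
    then show "h = lspan ?d c" unfolding e by (intro sum.cong refl) simp
  qed
  then have "binom F l m = f (node \<phi> n l)" if "l \<in> partitions n" for l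
    unfolding binom_def using ev[OF that] by simp
  then show ?thesis using f fv by blast
qed

lemma binom_le:
  assumes "m \<in> partitions n" "l \<in> partitions n" "psize n l \<le> psize n m"
  shows "binom F l m = (if l = m then 1 else 0)"
  using binom_eq_symf[OF assms(1)] assms(2,3) by auto

abbreviation nsum :: "(nat \<Rightarrow> nat) \<Rightarrow> 'a" where
  "nsum l \<equiv> \<Sum>i=1..n. node \<phi> n l i"

text \<open>Both sides are the values at \<open>\<lambda>\<close> of symmetric polynomials of degree \<open>\<bar>\<mu>\<bar> + 1\<close> that agree on
  all nodes up to that degree.\<close>

lemma binom_Pieri:
  assumes m: "m \<in> partitions n" and l: "l \<in> partitions n"
  shows "(nsum l - nsum m) * binom F l m =
    (\<Sum>v\<in>{v \<in> partitions n. covers n v m}. binom F l v * ((nsum v - nsum m) * binom F v m))"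
proof -
  let ?d = "psize n m"
  obtain f where f: "symf n ?d f"
    and fv: "\<And>l. l \<in> bounded_partitions n ?d \<Longrightarrow> f (node \<phi> n l) = (if l = m then 1 else 0)"
    and fb: "\<And>l. l \<in> partitions n \<Longrightarrow> binom F l m = f (node \<phi> n l)"
    using binom_eq_symf[OF m] by blast
  let ?P = "\<lambda>v h. symf n (psize n v) h \<and>
     (\<forall>l\<in>bounded_partitions n (psize n v). h (node \<phi> n l) = (if l = v then 1 else 0)) \<and>
     (\<forall>l\<in>partitions n. binom F l v = h (node \<phi> n l))"
  define h where "h v = (SOME h. ?P v h)" for v
  have h: "?P v (h v)" if "v \<in> partitions n" for v
    unfolding h_def by (rule someI_ex[of "?P v"]) (rule binom_eq_symf[OF that])
  have h1: "symf n (psize n v) (h v)" if "v \<in> partitions n" for v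
    by (rule h[OF that, THEN conjunct1])
  have h2: "h v (node \<phi> n l) = (if l = v then 1 else 0)" if "v \<in> partitions n" "l \<in> bounded_partitions n (psize n v)" for v l
    by (rule h[OF that(1), THEN conjunct2, THEN conjunct1, rule_format, OF that(2)])
  have h3: "binom F l v = h v (node \<phi> n l)" if "v \<in> partitions n" "l \<in> partitions n" for v l
    by (rule h[OF that(1), THEN conjunct2, THEN conjunct2, rule_format, OF that(2)])
  let ?V = "{v \<in> partitions n. psize n v = Suc ?d}"
  have finV: "finite ?V" by (rule finite_subset[OF _ finite_partitions_psize_le[of n "Suc ?d"]]) auto
  let ?H = "\<lambda>y. ((\<Sum>i=1..n. y i) - nsum m) * f y"
  let ?S = "\<lambda>y. \<Sum>v\<in>?V. ?H (node \<phi> n v) * h v y"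
  have "?H (node \<phi> n l) - ?S (node \<phi> n l) = 0"
  proof (rule symf_unique[where f = "\<lambda>y. ?H y - ?S y" and d = "Suc ?d" and n = n, OF phi_inj])
    have "symf n 1 (\<lambda>y. \<Sum>i=1..n. y i ^ 1 :: 'a)" by (rule symf_psum) simp
    then have "symf n 1 (\<lambda>y. (\<Sum>i=1..n. y i) - nsum m)" by (intro symf_diff symf_const) simp
    from symf_mult[OF this f] have "symf n (Suc ?d) ?H" by simp
    moreover have "symf n (Suc ?d) ?S"
    proof (intro symf_sum symf_cmult)
      fix v assume v: "v \<in> ?V"
      then show "symf n (Suc ?d) (h v)" using h1[of v] by simp
    qed
    ultimately show "symf n (Suc ?d) (\<lambda>y. ?H y - ?S y)" by (rule symf_diff)
    fix k assume k: "k \<in> bounded_partitions n (Suc ?d)"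
    have hk: "h v (node \<phi> n k) = (if k = v then 1 else 0)" if "v \<in> ?V" for v
      by (rule h2) (use that k in auto)
    have "?S (node \<phi> n k) = (\<Sum>v\<in>?V. if v = k then ?H (node \<phi> n k) else 0)"
      by (intro sum.cong refl) (simp add: hk)
    also have "\<dots> = (if k \<in> ?V then ?H (node \<phi> n k) else 0)" using finV by simp
    also have "\<dots> = ?H (node \<phi> n k)"
    proof (cases "k \<in> ?V")
      \<comment> \<open>At sizes up to \<open>?d\<close> the factor f vanishes except at m, where
        the norm difference does.\<close>
      case False
      then have "k \<in> bounded_partitions n ?d" using k by auto
      then have "?H (node \<phi> n k) = 0" using fv[of k] by (cases "k = m") simp_all
      then show ?thesis using False by simp
    qed simp
    finally show "?H (node \<phi> n k) - ?S (node \<phi> n k) = 0" by simp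
  qed
  then have "(nsum l - nsum m) * binom F l m = (\<Sum>v\<in>?V. ?H (node \<phi> n v) * h v (node \<phi> n l))"
    by (simp only: fb[OF l]) simp
  also have "\<dots> = (\<Sum>v\<in>?V. binom F l v * ((nsum v - nsum m) * binom F v m))"
  proof (intro sum.cong refl)
    fix v assume v: "v \<in> ?V"
    then have "binom F l v = h v (node \<phi> n l)" by (intro h3 l) simp
    moreover have "binom F v m = f (node \<phi> n v)" using v by (intro fb) simp
    ultimately show "?H (node \<phi> n v) * h v (node \<phi> n l) = binom F l v * ((nsum v - nsum m) * binom F v m)"
      by (simp only: mult.commute)
  qed
  \<comment> \<open>Extra vanishing discards the partitions of the right size that do not contain
    m.\<close>
  also have "\<dots> = (\<Sum>v\<in>{v \<in> partitions n. covers n v m}. binom F l v * ((nsum v - nsum m) * binom F v m))"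
  proof (rule sum.mono_neutral_right[OF finV])
    show "{v \<in> partitions n. covers n v m} \<subseteq> ?V" by (auto simp: covers_def)
    have fvm: "f (node \<phi> n l) = 0" if "l \<in> bounded_partitions n ?d" "l \<noteq> m" for l
      using fv[OF that(1)] that(2) by simp
    show "\<forall>v\<in>?V - {v \<in> partitions n. covers n v m}. binom F l v * ((nsum v - nsum m) * binom F v m) = 0"
    proof
      fix v assume v: "v \<in> ?V - {v \<in> partitions n. covers n v m}"
      then have "f (node \<phi> n v) = 0"
        by (intro extra_vanishing[OF grid f m refl fvm]) (auto simp: covers_def)
      then show "binom F l v * ((nsum v - nsum m) * binom F v m) = 0" using v fb[of v] by simp
    qed
  qed
  finally show ?thesis .
qed

section \<open>Recursion for the sum over chains\<close>

definition chain_sum :: "(nat \<Rightarrow> nat) \<Rightarrow> (nat \<Rightarrow> nat) \<Rightarrow> 'a" where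
  "chain_sum l m = (\<Sum>z\<in>saturated_chains n l m.
     chain_wt F z * (\<Prod>i<psize n l - psize n m. binom F (z ! i) (z ! Suc i)))"

lemma saturated_chains_snoc:
  assumes m: "m \<in> partitions n" and lt: "psize n m < psize n l"
  shows "bij_betw (\<lambda>(v, z). z @ [m]) (SIGMA v:{v \<in> partitions n. covers n v m}. saturated_chains n l v) (saturated_chains n l m)"
proof (rule bij_betw_byWitness[where f' = "\<lambda>z. (last (butlast z), butlast z)"])
  let ?X = "SIGMA v:{v \<in> partitions n. covers n v m}. saturated_chains n l v"
  show "\<forall>x\<in>?X. (\<lambda>z. (last (butlast z), butlast z)) ((\<lambda>(v, z). z @ [m]) x) = x"
    by (auto simp: saturated_chains_def)
  have ne: "butlast z \<noteq> [] \<and> z = butlast z @ [m]" if z: "z \<in> saturated_chains n l m" for z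
  proof -
    have "length z \<ge> 2" using saturated_chain_length(2)[OF z] lt by simp
    moreover have "z \<noteq> []" "last z = m" using z by (auto simp: saturated_chains_def)
    ultimately show ?thesis using append_butlast_last_id[of z] by (cases z rule: rev_cases) auto
  qed
  show "\<forall>z\<in>saturated_chains n l m. (\<lambda>(v, z). z @ [m]) (last (butlast z), butlast z) = z"
    using ne by auto
  show "(\<lambda>(v, z). z @ [m]) ` ?X \<subseteq> saturated_chains n l m"
    using m by (auto simp: saturated_chains_def successively_append_iff)
  show "(\<lambda>z. (last (butlast z), butlast z)) ` saturated_chains n l m \<subseteq> ?X"
  proof (rule image_subsetI)
    fix z assume z: "z \<in> saturated_chains n l m"
    define x where "x = butlast z"
    have x: "x \<noteq> []" "z = x @ [m]" using ne[OF z] by (auto simp: x_def)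
    have "set x \<subseteq> partitions n" "hd x = l" "successively (covers n) x" "covers n (last x) m"
      using z x(1) unfolding x(2) saturated_chains_def by (auto simp: successively_append_iff)
    moreover have "last x \<in> partitions n" using calculation(1) x(1) by auto
    ultimately show "(last (butlast z), butlast z) \<in> ?X"
      using x(1) unfolding x_def[symmetric] by (simp add: saturated_chains_def)
  qed
qed

text \<open>All denominators of a weight refer to the top of the chain, so the bottom step is split
  off: the remaining factors are the weight of the shorter chain with the same top. The Pieri rule
  has the same shape.\<close>

lemma chain_sum_step:
  assumes m: "m \<in> partitions n" and l: "l \<in> partitions n" and lt: "psize n m < psize n l"
  shows "chain_sum l m = (\<Sum>v\<in>{v \<in> partitions n. covers n v m}.
     chain_sum l v * ((nsum v - nsum m) / (nsum l - nsum m) * binom F v m))"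
proof -
  let ?V = "{v \<in> partitions n. covers n v m}"
  let ?k = "psize n l - psize n m"
  let ?g = "\<lambda>z. chain_wt F z * (\<Prod>i<?k. binom F (z ! i) (z ! Suc i))"
  have finV: "finite ?V"
    by (rule finite_subset[OF _ finite_partitions_psize_le[of n "Suc (psize n m)"]]) (auto simp: covers_def)
  have step: "?g (z @ [m]) = chain_wt F z * (\<Prod>i<psize n l - psize n v. binom F (z ! i) (z ! Suc i)) *
      ((nsum v - nsum m) / (nsum l - nsum m) * binom F v m)"
    if v: "v \<in> ?V" and z: "z \<in> saturated_chains n l v" for v z
  proof -
    have zz: "z \<noteq> []" "hd z = l" "last z = v" using z by (auto simp: saturated_chains_def)
    define j where "j = length z - 1"
    have len: "length z = Suc j" using zz(1) by (simp add: j_def)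
    have k: "psize n l - psize n v = j" "?k = Suc j"
      using saturated_chain_length[OF z] v by (auto simp: covers_def j_def)
    have z0: "z ! 0 = l" using zz by (simp add: hd_conv_nth)
    have zj: "z ! j = v" using zz by (simp add: last_conv_nth j_def)
    have nth: "(z @ [m]) ! i = z ! i" if "i < Suc j" for i using that len by (simp add: nth_append)
    have last: "(z @ [m]) ! Suc j = m" using len by (simp add: nth_append)
    have nth0: "(z @ [m]) ! 0 = l" using nth[of 0] z0 by simp
    have wt: "chain_wt F (z @ [m]) = chain_wt F z * ((nsum v - nsum m) / (nsum l - nsum m))"
    proof -
      have "chain_wt F (z @ [m]) = (\<Prod>i<Suc j.
          (pnorm F (shifted F ((z @ [m]) ! i)) - pnorm F (shifted F ((z @ [m]) ! Suc i))) /
          (pnorm F (shifted F l) - pnorm F (shifted F ((z @ [m]) ! Suc i))))"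
        unfolding chain_wt_def nth0 by (simp add: len)
      also have "\<dots> = (\<Prod>i<j.
          (pnorm F (shifted F (z ! i)) - pnorm F (shifted F (z ! Suc i))) /
          (pnorm F (shifted F l) - pnorm F (shifted F (z ! Suc i)))) *
          ((pnorm F (shifted F v) - pnorm F (shifted F m)) / (pnorm F (shifted F l) - pnorm F (shifted F m)))"
        unfolding prod.lessThan_Suc last nth[OF lessI] zj
        by (intro arg_cong2[where f = times] prod.cong refl) (simp add: nth)
      also have "\<dots> = chain_wt F z * ((nsum v - nsum m) / (nsum l - nsum m))"
        unfolding chain_wt_def z0 using v m l by (simp add: pnorm_eq j_def)
      finally show ?thesis .
    qed
    have "(\<Prod>i<Suc j. binom F ((z @ [m]) ! i) ((z @ [m]) ! Suc i)) = (\<Prod>i<j. binom F (z ! i) (z ! Suc i)) * binom F v m"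
      unfolding prod.lessThan_Suc last nth[OF lessI] zj
      by (intro arg_cong2[where f = times] prod.cong refl) (simp add: nth)
    then show ?thesis unfolding wt k by (simp only: mult_ac)
  qed
  have "chain_sum l m = (\<Sum>x\<in>(SIGMA v:?V. saturated_chains n l v). ?g ((\<lambda>(v, z). z @ [m]) x))"
    unfolding chain_sum_def by (rule sum.reindex_bij_betw[OF saturated_chains_snoc[OF m lt], symmetric])
  also have "\<dots> = (\<Sum>v\<in>?V. \<Sum>z\<in>saturated_chains n l v. ?g (z @ [m]))"
    using finV finite_saturated_chains by (subst sum.Sigma) (auto simp: case_prod_beta)
  also have "\<dots> = (\<Sum>v\<in>?V. chain_sum l v * ((nsum v - nsum m) / (nsum l - nsum m) * binom F v m))"
    unfolding chain_sum_def sum_distrib_right by (intro sum.cong refl step)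
  finally show ?thesis .
qed

text \<open>With l fixed and m growing, the Pieri rule divided by \<open>nsum l - nsum m\<close> is
  the recursion of \<open>chain_sum\<close>; the difference is nonzero because the sizes
  differ.\<close>

theorem binom_eq_chain_sum:
  assumes "l \<in> partitions n" "m \<in> partitions n"
  shows "binom F l m = chain_sum l m"
  using assms(2)
proof (induction "psize n l - psize n m" arbitrary: m rule: less_induct)
  case less
  show ?case
  proof (cases "psize n m < psize n l")
    case True
    have ne: "nsum l - nsum m \<noteq> 0" using pnorm_separates[OF assms(1) less.prems] True by simp
    have "chain_sum l m = (\<Sum>v\<in>{v \<in> partitions n. covers n v m}.
       binom F l v * ((nsum v - nsum m) * binom F v m) / (nsum l - nsum m))"
      unfolding chain_sum_step[OF less.prems assms(1) True]
    proof (intro sum.cong refl)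
      fix v assume v: "v \<in> {v \<in> partitions n. covers n v m}"
      then have "binom F l v = chain_sum l v" using True by (intro less.hyps) (auto simp: covers_def)
      then show "chain_sum l v * ((nsum v - nsum m) / (nsum l - nsum m) * binom F v m) =
        binom F l v * ((nsum v - nsum m) * binom F v m) / (nsum l - nsum m)" by simp
    qed
    also have "\<dots> = (nsum l - nsum m) * binom F l m / (nsum l - nsum m)"
      unfolding binom_Pieri[OF less.prems assms(1)] sum_divide_distrib ..
    also have "\<dots> = binom F l m" using ne by simp
    finally show ?thesis ..
  next
    case False
    \<comment> \<open>A chain loses one box per step, so here it has a single entry; this matches
      the interpolation conditions defining the binomial.\<close>
    have "saturated_chains n l m = (if l = m then {[l]} else {})"
    proof -
      have "z = [l] \<and> l = m" if z: "z \<in> saturated_chains n l m" for z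
      proof -
        have "length z = 1" using saturated_chain_length(2)[OF z] False by simp
        then obtain a where "z = [a]" by (auto simp: length_Suc_conv)
        then show ?thesis using z by (auto simp: saturated_chains_def)
      qed
      moreover have "[l] \<in> saturated_chains n l l" using assms(1) by (simp add: saturated_chains_def)
      ultimately show ?thesis by auto
    qed
    then show ?thesis
      using False binom_le[OF less.prems assms(1)] by (simp add: chain_sum_def chain_wt_def)
  qed
qed

end


section \<open>The four families\<close>

lemma perfect_grid_linear:
  fixes \<tau> :: "'a::field_char_0"
  assumes ind: "\<And>a b. of_int a + of_int b * \<tau> = 0 \<Longrightarrow> a = 0 \<and> b = 0"
  shows "perfect_grid (\<lambda>a b. of_int a + of_int b * \<tau>) (\<lambda>_ _. 1)"
proof -
  let ?x = "\<lambda>a b. of_int a + of_int b * \<tau>"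
  have inj: "a = a' \<and> b = b'" if "?x a b = ?x a' b'" for a b a' b'
    using ind[of "a - a'" "b - b'"] that by (simp add: algebra_simps)
  show ?thesis
    unfolding perfect_grid_def
  proof (intro conjI allI impI)
    show "\<exists>Q. degree Q \<le> 2 \<and> (\<forall>a b. 1\<^sup>2 = poly Q (?x a b))"
      by (intro exI[of _ 1]) simp
    show "\<exists>U u. degree U \<le> 1 \<and> (\<forall>a b. ?x (a - 1) b = poly U (?x a b) + u * 1 \<and> ?x (a + 1) b = poly U (?x a b) - u * 1)"
      by (intro exI[of _ "[:0, 1:]"] exI[of _ "- 1"]) (simp add: algebra_simps)
    show "\<exists>W w. degree W \<le> 1 \<and> (\<forall>a b. ?x a (b - 1) = poly W (?x a b) + w * 1 \<and> ?x a (b + 1) = poly W (?x a b) - w * 1)"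
      by (intro exI[of _ "[:0, 1:]"] exI[of _ "- \<tau>"]) (simp add: algebra_simps)
    have cancel: "p - r = s - r \<Longrightarrow> p = s" for p r s :: 'a by simp
    fix a b a' b' a0 b0
    assume "(?x a b - ?x a0 b0) * (1 + 1) = (?x a' b' - ?x a0 b0) * (1 + 1)"
    then have "?x a b - ?x a0 b0 = ?x a' b' - ?x a0 b0" by (subst (asm) mult_right_cancel) simp_all
    then have "?x a b = ?x a' b'" by (rule cancel)
    from inj[OF this] show "a = a'" "b = b'" by simp_all
  qed (use inj in simp_all)
qed

lemma perfect_grid_square:
  fixes \<tau> \<alpha> :: "'a::field_char_0"
  assumes ind: "\<And>a b c. of_int a + of_int b * \<tau> + of_int c * \<alpha> = 0 \<Longrightarrow> a = 0 \<and> b = 0 \<and> c = 0"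
  shows "perfect_grid (\<lambda>a b. (of_int a + of_int b * \<tau> + \<alpha>)\<^sup>2) (\<lambda>a b. of_int a + of_int b * \<tau> + \<alpha>)"
proof -
  let ?x = "\<lambda>a b. of_int a + of_int b * \<tau> + \<alpha>"
  have inj: "a = a' \<and> b = b'" if "?x a b - ?x a' b' = 0" for a b a' b'
    using ind[of "a - a'" "b - b'" 0] that by (simp add: algebra_simps)
  \<comment> \<open>The sum has \<alpha>-coefficient 2 and cannot vanish; this excludes sign
    coincidences between squares.\<close>
  have plus: "?x a b + ?x a' b' \<noteq> 0" for a b a' b'
    using ind[of "a + a'" "b + b'" 2] by (auto simp: algebra_simps)
  show ?thesis
    unfolding perfect_grid_def
  proof (intro conjI allI impI)
    show "?x a b \<noteq> 0" for a b using ind[of a b 1] by auto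
    show "\<exists>Q. degree Q \<le> 2 \<and> (\<forall>a b. (?x a b)\<^sup>2 = poly Q ((?x a b)\<^sup>2))"
      by (intro exI[of _ "[:0, 1:]"]) simp
    show "\<exists>U u. degree U \<le> 1 \<and> (\<forall>a b. (?x (a - 1) b)\<^sup>2 = poly U ((?x a b)\<^sup>2) + u * ?x a b \<and> (?x (a + 1) b)\<^sup>2 = poly U ((?x a b)\<^sup>2) - u * ?x a b)"
      by (intro exI[of _ "[:1, 1:]"] exI[of _ "- 2"]) (simp add: algebra_simps power2_eq_square)
    show "\<exists>W w. degree W \<le> 1 \<and> (\<forall>a b. (?x a (b - 1))\<^sup>2 = poly W ((?x a b)\<^sup>2) + w * ?x a b \<and> (?x a (b + 1))\<^sup>2 = poly W ((?x a b)\<^sup>2) - w * ?x a b)"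
      by (intro exI[of _ "[:\<tau>\<^sup>2, 1:]"] exI[of _ "- 2 * \<tau>"]) (simp add: algebra_simps power2_eq_square)
  next
    fix a b a' b' assume "(?x a b)\<^sup>2 = (?x a' b')\<^sup>2"
    have fac: "u\<^sup>2 = v\<^sup>2 \<Longrightarrow> (u - v) * (u + v) = 0" for u v :: 'a
      by (simp add: algebra_simps power2_eq_square)
    have "(?x a b - ?x a' b') * (?x a b + ?x a' b') = 0" by (rule fac) fact
    then have "?x a b - ?x a' b' = 0" using plus[of a b a' b'] by (simp only: mult_eq_0_iff simp_thms)
    from inj[OF this] show "a = a'" "b = b'" by simp_all
  next
    fix a b a' b' a0 b0
    \<comment> \<open>The difference of the two sides is \<open>(x + z) * (y + z) * (x - y)\<close>,
      in which only the last factor can be zero.\<close>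
    have fac: "(x\<^sup>2 - z\<^sup>2) * (y + z) = (y\<^sup>2 - z\<^sup>2) * (x + z) \<Longrightarrow> (x + z) * ((y + z) * (x - y)) = 0" for x y z :: 'a
      by (simp add: algebra_simps power2_eq_square)
    assume "((?x a b)\<^sup>2 - (?x a0 b0)\<^sup>2) * (?x a' b' + ?x a0 b0) = ((?x a' b')\<^sup>2 - (?x a0 b0)\<^sup>2) * (?x a b + ?x a0 b0)"
    from fac[OF this] have "?x a b - ?x a' b' = 0" using plus by (simp only: mult_eq_0_iff simp_thms)
    from inj[OF this] show "a = a'" "b = b'" by simp_all
  qed
qed

text \<open>Splits a multiplicative step into its even and odd parts under exchanging
  \<open>x\<close> and \<open>y\<close>. Taking \<open>y\<close> as the inverse of \<open>x\<close>
  gives the hyperbolic grid, \<open>y = 0\<close> the exponential one.\<close>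

lemma poly_half_step:
  fixes x y q :: "'a::field_char_0"
  shows "x / q + y * q = (1 / q + q) / 2 * (x + y) + (1 / q - q) / 2 * (x - y)"
    "x * q + y / q = (1 / q + q) / 2 * (x + y) - (1 / q - q) / 2 * (x - y)"
proof -
  have half: "a / 2 * b + c / 2 * d = (a * b + c * d) / 2" "a / 2 * b - c / 2 * d = (a * b - c * d) / 2" for a b c d :: 'a
    by (simp_all add: add_divide_distrib diff_divide_distrib)
  have "(p + q) * (x + y) + (p - q) * (x - y) = 2 * (x * p + y * q)"
    "(p + q) * (x + y) - (p - q) * (x - y) = 2 * (x * q + y * p)" for p
    by (simp_all add: algebra_simps)
  then show "x / q + y * q = (1 / q + q) / 2 * (x + y) + (1 / q - q) / 2 * (x - y)"
    "x * q + y / q = (1 / q + q) / 2 * (x + y) - (1 / q - q) / 2 * (x - y)"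
    unfolding half by simp_all
qed

lemma poly_half_step_poly:
  fixes x y q :: "'a::field_char_0"
  shows "x / q + y * q = poly [:0, (1 / q + q) / 2:] (x + y) + (1 / q - q) / 2 * (x - y)"
    "x * q + y / q = poly [:0, (1 / q + q) / 2:] (x + y) - (1 / q - q) / 2 * (x - y)"
    "x / q = poly [:0, (1 / q + q) / 2:] x + (1 / q - q) / 2 * x"
    "x * q = poly [:0, (1 / q + q) / 2:] x - (1 / q - q) / 2 * x"
    "degree [:0, (1 / q + q) / 2:] \<le> 1"
proof -
  have p: "poly [:0, c:] z = c * z" for c z :: 'a by simp
  show 1: "x / q + y * q = poly [:0, (1 / q + q) / 2:] (x + y) + (1 / q - q) / 2 * (x - y)"
    and 2: "x * q + y / q = poly [:0, (1 / q + q) / 2:] (x + y) - (1 / q - q) / 2 * (x - y)" for y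
    unfolding p by (rule poly_half_step)+
  show "x / q = poly [:0, (1 / q + q) / 2:] x + (1 / q - q) / 2 * x"
    using 1[of 0] by (simp only: mult_zero_left add_0_right diff_0_right)
  show "x * q = poly [:0, (1 / q + q) / 2:] x - (1 / q - q) / 2 * x"
    using 2[of 0] by (simp only: div_0 add_0_right diff_0_right)
qed simp

text \<open>Separation when \<delta> equals \<phi>; the hyperbolic case reduces to it after
  cancelling common factors.\<close>

lemma cross_cancel:
  fixes x y z :: "'a::field_char_0"
  assumes "(x - z) * (y + z) = (y - z) * (x + z)" "z \<noteq> 0"
  shows "x = y"
proof -
  have "2 * (z * (x - y)) = (x - z) * (y + z) - (y - z) * (x + z)" by (simp add: algebra_simps)
  then show ?thesis using assms by simp
qed

lemma perfect_grid_exponential: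
  fixes q t :: "'a::field_char_0"
  assumes nz: "q \<noteq> 0" "t \<noteq> 0"
    and ind: "\<And>a b. q powi a * t powi b = 1 \<Longrightarrow> a = 0 \<and> b = 0"
  shows "perfect_grid (\<lambda>a b. q powi a * t powi b) (\<lambda>a b. q powi a * t powi b)"
proof -
  let ?x = "\<lambda>a b. q powi a * t powi b"
  have x0: "?x a b \<noteq> 0" for a b using nz by simp
  have inj: "a = a' \<and> b = b'" if "?x a b = ?x a' b'" for a b a' b'
  proof -
    have "?x (a - a') (b - b') = ?x a b / ?x a' b'" using nz by (simp add: power_int_diff)
    then show ?thesis using ind[of "a - a'" "b - b'"] that x0 by simp
  qed
  have step: "?x (a - 1) b = ?x a b / q" "?x (a + 1) b = ?x a b * q"
    "?x a (b - 1) = ?x a b / t" "?x a (b + 1) = ?x a b * t" for a b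
    using nz by (simp_all add: power_int_diff power_int_add_1)
  show ?thesis
    unfolding perfect_grid_def
  proof (intro conjI allI impI)
    show "\<exists>Q. degree Q \<le> 2 \<and> (\<forall>a b. (?x a b)\<^sup>2 = poly Q (?x a b))"
      by (intro exI[of _ "[:0, 0, 1:]"]) (simp add: power2_eq_square)
    show "\<exists>U u. degree U \<le> 1 \<and> (\<forall>a b. ?x (a - 1) b = poly U (?x a b) + u * ?x a b \<and> ?x (a + 1) b = poly U (?x a b) - u * ?x a b)"
      unfolding step
      by (intro exI[of _ "[:0, (1 / q + q) / 2:]"] exI[of _ "(1 / q - q) / 2"] conjI allI poly_half_step_poly)
    show "\<exists>W w. degree W \<le> 1 \<and> (\<forall>a b. ?x a (b - 1) = poly W (?x a b) + w * ?x a b \<and> ?x a (b + 1) = poly W (?x a b) - w * ?x a b)"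
      unfolding step
      by (intro exI[of _ "[:0, (1 / t + t) / 2:]"] exI[of _ "(1 / t - t) / 2"] conjI allI poly_half_step_poly)
  next
    fix a b a' b' a0 b0
    assume "(?x a b - ?x a0 b0) * (?x a' b' + ?x a0 b0) = (?x a' b' - ?x a0 b0) * (?x a b + ?x a0 b0)"
    then have "?x a b = ?x a' b'" by (rule cross_cancel) (rule x0)
    from inj[OF this] show "a = a'" "b = b'" by simp_all
  next
    fix a b a' b' assume "?x a b = ?x a' b'"
    from inj[OF this] show "a = a'" "b = b'" by simp_all
  qed (rule x0)
qed

lemma perfect_grid_hyperbolic:
  fixes q t \<alpha> :: "'a::field_char_0"
  assumes nz: "q \<noteq> 0" "t \<noteq> 0" "\<alpha> \<noteq> 0"
    and ind: "\<And>a b c. q powi a * t powi b * \<alpha> powi c = 1 \<Longrightarrow> a = 0 \<and> b = 0 \<and> c = 0"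
  defines "x \<equiv> \<lambda>a b. \<alpha> * q powi a * t powi b"
  shows "perfect_grid (\<lambda>a b. x a b + inverse (x a b)) (\<lambda>a b. x a b - inverse (x a b))"
proof -
  have x0: "x a b \<noteq> 0" for a b using nz by (simp add: x_def)
  have inj: "a = a' \<and> b = b'" if "x a b = x a' b'" for a b a' b'
  proof -
    have "q powi (a - a') * t powi (b - b') * \<alpha> powi 0 = x a b / x a' b'" using nz by (simp add: x_def power_int_diff)
    then show ?thesis using ind[of "a - a'" "b - b'" 0] that x0 by simp
  qed
  \<comment> \<open>The product contains \<alpha> with exponent 2. This excludes the second solution
    of \<open>u + inverse u = v + inverse v\<close>, namely \<open>v = inverse u\<close>.\<close>
  have prod1: "x a b * x a' b' \<noteq> 1" for a b a' b'
  proof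
    assume "x a b * x a' b' = 1"
    moreover have "q powi (a + a') * t powi (b + b') * \<alpha> powi 2 = x a b * x a' b'"
      using nz by (simp add: x_def power_int_add power2_eq_square)
    ultimately show False using ind[of "a + a'" "b + b'" 2] by simp
  qed
  have step: "x (a - 1) b = x a b / q" "x (a + 1) b = x a b * q"
    "x a (b - 1) = x a b / t" "x a (b + 1) = x a b * t" for a b
    using nz by (simp_all add: x_def power_int_diff power_int_add_1)
  have inv: "inverse (x a b / r) = inverse (x a b) * r" "inverse (x a b * r) = inverse (x a b) / r" for a b r
    by (simp_all add: field_simps)
  show ?thesis
    unfolding perfect_grid_def
  proof (intro conjI allI impI)
    fix a b
    show "x a b - inverse (x a b) \<noteq> 0" using prod1[of a b a b] x0[of a b] by (simp add: field_simps)
  next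
    show "\<exists>Q. degree Q \<le> 2 \<and> (\<forall>a b. (x a b - inverse (x a b))\<^sup>2 = poly Q (x a b + inverse (x a b)))"
      \<comment> \<open>From
        \<open>(x - inverse x)\<^sup>2 = (x + inverse x)\<^sup>2 - 4\<close>.\<close>
      using x0 by (intro exI[of _ "[:- 4, 0, 1:]"]) (simp add: power2_eq_square field_simps)
    show "\<exists>U u. degree U \<le> 1 \<and> (\<forall>a b. x (a - 1) b + inverse (x (a - 1) b) = poly U (x a b + inverse (x a b)) + u * (x a b - inverse (x a b)) \<and>
        x (a + 1) b + inverse (x (a + 1) b) = poly U (x a b + inverse (x a b)) - u * (x a b - inverse (x a b)))"
      unfolding step inv
      by (intro exI[of _ "[:0, (1 / q + q) / 2:]"] exI[of _ "(1 / q - q) / 2"] conjI allI poly_half_step_poly)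
    show "\<exists>W w. degree W \<le> 1 \<and> (\<forall>a b. x a (b - 1) + inverse (x a (b - 1)) = poly W (x a b + inverse (x a b)) + w * (x a b - inverse (x a b)) \<and>
        x a (b + 1) + inverse (x a (b + 1)) = poly W (x a b + inverse (x a b)) - w * (x a b - inverse (x a b)))"
      unfolding step inv
      by (intro exI[of _ "[:0, (1 / t + t) / 2:]"] exI[of _ "(1 / t - t) / 2"] conjI allI poly_half_step_poly)
  next
    fix a b a' b'
    have fac: "u + inverse u = v + inverse v \<Longrightarrow> u \<noteq> 0 \<Longrightarrow> v \<noteq> 0 \<Longrightarrow> (u - v) * (u * v - 1) = 0" for u v :: 'a
      by (simp add: field_simps)
    assume "x a b + inverse (x a b) = x a' b' + inverse (x a' b')"
    from fac[OF this x0 x0] have "x a b = x a' b'" using prod1[of a b a' b'] by simp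
    from inj[OF this] show "a = a'" "b = b'" by simp_all
  next
    fix a b a' b' a0 b0
    \<comment> \<open>Both expressions share the factor \<open>(u * z - 1) / (u * z)\<close>,
      nonzero at grid points, and without it they are \<open>u - z\<close> and
      \<open>u + z\<close>.\<close>
    have fac1: "u + inverse u - (z + inverse z) = (u - z) * (u * z - 1) / (u * z)" "u - inverse u + (z - inverse z) = (u + z) * (u * z - 1) / (u * z)"
      if "u \<noteq> 0" "z \<noteq> 0" for u z :: 'a
      using that by (simp_all add: field_simps)
    have fac: "u = v"
      if "(u + inverse u - (z + inverse z)) * (v - inverse v + (z - inverse z)) = (v + inverse v - (z + inverse z)) * (u - inverse u + (z - inverse z))"
        "u \<noteq> 0" "v \<noteq> 0" "z \<noteq> 0" "u * z \<noteq> 1" "v * z \<noteq> 1" for u v z :: 'a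
    proof -
      let ?k = "(u * z - 1) * (v * z - 1) / (u * z * (v * z))"
      have "(u - z) * (v + z) * ?k = (v - z) * (u + z) * ?k"
        using that(1) unfolding fac1[OF that(2,4)] fac1[OF that(3,4)] by (simp add: mult_ac)
      moreover have "?k \<noteq> 0" using that by simp
      ultimately have "(u - z) * (v + z) = (v - z) * (u + z)" by (metis mult_right_cancel)
      then show ?thesis by (rule cross_cancel) (rule that(4))
    qed
    assume "(x a b + inverse (x a b) - (x a0 b0 + inverse (x a0 b0))) * (x a' b' - inverse (x a' b') + (x a0 b0 - inverse (x a0 b0))) =
      (x a' b' + inverse (x a' b') - (x a0 b0 + inverse (x a0 b0))) * (x a b - inverse (x a b) + (x a0 b0 - inverse (x a0 b0)))"
    from fac[OF this x0 x0 x0 prod1 prod1] have "x a b = x a' b'" .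
    from inj[OF this] show "a = a'" "b = b'" by simp_all
  qed
qed

section \<open>Single variables and the embedding of the parameter ring\<close>

lemma dominant_lvar: "w \<ge> 0 \<Longrightarrow> dominant (Poly_Mapping.single i w) (lvar i w)"
  by (auto simp: dominant_def lvar_def lookup_single when_def)

lemma lregular_lvar: "w \<ge> 0 \<or> x i \<noteq> 0 \<Longrightarrow> lregular (lvar i w) x"
  by (auto simp: lregular_def lvar_def lookup_single when_def)

lemma leval_lvar:
  fixes x :: "nat \<Rightarrow> 'a::field"
  shows "leval (lvar i w) x = x i powi w"
proof (cases "w = 0")
  case False
  then show ?thesis by (simp add: lvar_def leval_single lmon_def)
next
  case True
  then have "lvar i w = (lconst 1 :: 'a laurent)" by (simp add: lvar_def lconst_def)
  then show ?thesis using True by (simp only: leval_lconst power_int_0_right)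
qed

lemma dominant_lvar_inverse: "dominant (Poly_Mapping.single i 1) (lvar i 1 + lvar i (- 1) :: 'a::field laurent)"
  unfolding dominant_def
proof (intro conjI ballI allI)
  fix k j assume "k \<in> ks (lvar i 1 + lvar i (- 1) :: 'a laurent)"
  then have "k \<in> ks (lvar i 1 :: 'a laurent) \<union> ks (lvar i (- 1) :: 'a laurent)"
    by (rule subsetD[OF keys_add])
  then have "k = Poly_Mapping.single i 1 \<or> k = Poly_Mapping.single i (- 1)" by (auto simp: lvar_def)
  then show "\<bar>lk k j\<bar> \<le> lk (Poly_Mapping.single i 1) j"
    by (elim disjE) (simp_all add: lookup_single when_def)
next
  have "Poly_Mapping.single i (- 1 :: int) \<noteq> Poly_Mapping.single i 1"
  proof
    assume "Poly_Mapping.single i (- 1 :: int) = Poly_Mapping.single i 1"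
    then have "lk (Poly_Mapping.single i (- 1 :: int)) i = lk (Poly_Mapping.single i 1) i" by (rule arg_cong)
    then show False by simp
  qed
  then show "lk (lvar i 1 + lvar i (- 1) :: 'a laurent) (Poly_Mapping.single i 1) = 1"
    by (simp add: lvar_def lookup_add lookup_single_not_eq)
qed

lemma to_fract_power: "to_fract (p ^ k) = to_fract p ^ k"
  by (induction k) simp_all

lemma to_fract_of_nat: "to_fract (of_nat k) = of_nat k"
  by (induction k) simp_all

lemma to_fract_of_int: "to_fract (of_int k) = of_int k"
  by (cases k) (simp_all add: to_fract_of_nat del: of_nat_Suc)

text \<open>Moves negative exponents to the other side, so that the relation can be compared
  monomial by monomial in a polynomial ring.\<close>

lemma powi_eq_1D:
  assumes "x powi a * y powi b * z powi c = (1 :: 'a::field)" "x \<noteq> 0" "y \<noteq> 0" "z \<noteq> 0"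
  shows "x ^ nat a * y ^ nat b * z ^ nat c = x ^ nat (- a) * y ^ nat (- b) * z ^ nat (- c)"
proof -
  have split: "u powi k * u ^ nat (- k) = u ^ nat k" if "u \<noteq> 0" for u :: 'a and k
    using that by (cases "k \<ge> 0") (auto simp: power_int_def field_simps)
  have "x ^ nat a * y ^ nat b * z ^ nat c =
    (x powi a * x ^ nat (- a)) * (y powi b * y ^ nat (- b)) * (z powi c * z ^ nat (- c))"
    by (simp only: split[OF assms(2)] split[OF assms(3)] split[OF assms(4)])
  also have "\<dots> = (x powi a * y powi b * z powi c) * (x ^ nat (- a) * y ^ nat (- b) * z ^ nat (- c))"
    by (simp only: mult_ac)
  finally show ?thesis using assms(1) by simp
qed

lemma int_diff_of_nat: "i \<in> {1..n} \<Longrightarrow> int n - int i = int (n - i)"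
  by auto

section \<open>Verification for the four families\<close>

lemma grid_family_AJ:
  defines "\<tau> \<equiv> to_fract [:0, 1:] :: rat poly fract"
  shows "grid_family (AJ n) (\<lambda>a b. of_int a + of_int b * \<tau>) (\<lambda>_ _. 1) n 1"
proof -
  let ?phi = "\<lambda>a b. of_int a + of_int b * \<tau>"
  have sel: "nvars (AJ n) = n" "gen (AJ n) = (\<lambda>i. lvar i 1)" "deg_factor (AJ n) = 1"
    "pnorm (AJ n) = (\<lambda>x. \<Sum>i=1..n. x i)"
    "shifted (AJ n) l i = of_nat (l i) + of_nat (n - i) * \<tau>" for l i
    by (simp_all add: AJ_def Let_def \<tau>_def to_fract_def)
  have nd: "shifted (AJ n) l i = node ?phi n l i" if "i \<in> {1..n}" for l i
    unfolding sel node_def int_diff_of_nat[OF that] by simp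
  show ?thesis
  proof (unfold_locales)
    show "perfect_grid ?phi (\<lambda>_ _. 1)"
    proof (rule perfect_grid_linear)
      fix a b assume "of_int a + of_int b * \<tau> = 0"
      moreover have "of_int a + of_int b * \<tau> = to_fract [:of_int a, of_int b:]"
        unfolding \<tau>_def to_fract_of_int[symmetric] to_fract_mult[symmetric] to_fract_add[symmetric]
        by (simp add: of_int_poly)
      ultimately show "a = 0 \<and> b = 0" by simp
    qed
    fix l m :: "nat \<Rightarrow> nat"
    assume "psize n l \<noteq> psize n m"
    \<comment> \<open>The norm is the size plus a constant independent of the partition.\<close>
    moreover have "(\<Sum>i=1..n. node ?phi n l i) = of_nat (psize n l) + (\<Sum>i=1..n. of_int (int n - int i) * \<tau>)" for l
      by (simp add: node_def sum.distrib psize_def)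
    ultimately show "(\<Sum>i=1..n. node ?phi n l i) \<noteq> (\<Sum>i=1..n. node ?phi n m i)" by simp
  qed (simp_all add: sel(1-4) lact_lvar permutes_bij dominant_lvar lregular_lvar leval_lvar nd)
qed

lemma grid_family_BJ:
  defines "\<tau> \<equiv> to_fract [:[:0, 1:]:] :: rat poly poly fract" and "\<alpha> \<equiv> to_fract [:0, 1:]"
  shows "grid_family (BJ n) (\<lambda>a b. (of_int a + of_int b * \<tau> + \<alpha>)\<^sup>2) (\<lambda>a b. of_int a + of_int b * \<tau> + \<alpha>) n 2"
proof -
  let ?phi = "\<lambda>a b. (of_int a + of_int b * \<tau> + \<alpha>)\<^sup>2"
  have sel: "nvars (BJ n) = n" "gen (BJ n) = (\<lambda>i. lvar i 2)" "deg_factor (BJ n) = 2"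
    "pnorm (BJ n) = (\<lambda>x. \<Sum>i=1..n. (x i)\<^sup>2)"
    "shifted (BJ n) l i = of_nat (l i) + of_nat (n - i) * \<tau> + \<alpha>" for l i
    by (simp_all add: BJ_def Let_def \<tau>_def \<alpha>_def to_fract_def)
  have nd: "(shifted (BJ n) l i)\<^sup>2 = node ?phi n l i" if "i \<in> {1..n}" for l i
    unfolding sel node_def int_diff_of_nat[OF that] by simp
  show ?thesis
  proof (unfold_locales)
    show "perfect_grid ?phi (\<lambda>a b. of_int a + of_int b * \<tau> + \<alpha>)"
    proof (rule perfect_grid_square)
      fix a b c assume "of_int a + of_int b * \<tau> + of_int c * \<alpha> = 0"
      moreover have "of_int a + of_int b * \<tau> + of_int c * \<alpha> = to_fract [:[:of_int a, of_int b:], of_int c:]"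
        unfolding \<tau>_def \<alpha>_def to_fract_of_int[symmetric] to_fract_mult[symmetric] to_fract_add[symmetric]
        by (simp add: of_int_poly)
      ultimately show "a = 0 \<and> b = 0 \<and> c = 0" by simp
    qed
    fix l m :: "nat \<Rightarrow> nat"
    let ?p = "\<lambda>l. \<Sum>i=1..n. [:[:of_nat (l i), of_nat (n - i):], 1:]\<^sup>2 :: rat poly poly"
    have emb: "(\<Sum>i=1..n. node ?phi n l i) = to_fract (?p l)" for l
      unfolding to_fract_sum to_fract_power
    proof (rule sum.cong[OF refl])
      fix i assume i: "i \<in> {1..n}"
      have "to_fract [:[:of_nat (l i), of_nat (n - i):], 1:] = of_nat (l i) + of_nat (n - i) * \<tau> + \<alpha>"
        unfolding \<tau>_def \<alpha>_def to_fract_of_nat[symmetric] to_fract_mult[symmetric] to_fract_add[symmetric]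
        by (simp add: of_nat_poly)
      then show "node ?phi n l i = (to_fract [:[:of_nat (l i), of_nat (n - i):], 1:])\<^sup>2"
        using nd[OF i, of l] by (simp only: sel)
    qed
    have sq: "[:p, 1:]\<^sup>2 = [:p * p, p + p, 1:]" for p :: "rat poly"
      by (simp add: power2_eq_square)
    \<comment> \<open>The part of the norm linear in \<alpha> and free of \<tau> is twice the
      size.\<close>
    have "coeff (coeff (?p l) 1) 0 = (\<Sum>i=1..n. of_nat (l i) + of_nat (l i))" for l
      unfolding coeff_sum sq by (intro sum.cong refl) simp
    then have cf: "coeff (coeff (?p l) 1) 0 = of_nat (psize n l + psize n l)" for l
      by (simp only: psize_def sum.distrib of_nat_add of_nat_sum)
    show "(\<Sum>i=1..n. node ?phi n l i) \<noteq> (\<Sum>i=1..n. node ?phi n m i)" if ne: "psize n l \<noteq> psize n m"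
    proof
      assume "(\<Sum>i=1..n. node ?phi n l i) = (\<Sum>i=1..n. node ?phi n m i)"
      then have "?p l = ?p m" unfolding emb to_fract_eq_iff .
      then have "of_nat (psize n l + psize n l) = (of_nat (psize n m + psize n m) :: rat)"
        using cf[of l] cf[of m] by (simp only:)
      then show False using ne unfolding of_nat_eq_iff by simp
    qed
  qed (simp_all add: sel(1-4) lact_lvar permutes_bij dominant_lvar lregular_lvar leval_lvar nd)
qed

lemma grid_family_AM:
  defines "q \<equiv> to_fract [:[:0, 1:]:] :: rat poly poly fract" and "t \<equiv> to_fract [:0, 1:]"
  shows "grid_family (AM n) (\<lambda>a b. q powi a * t powi b) (\<lambda>a b. q powi a * t powi b) n 1"
proof -
  let ?phi = "\<lambda>a b. q powi a * t powi b"
  have sel: "nvars (AM n) = n" "gen (AM n) = (\<lambda>i. lvar i 1)" "deg_factor (AM n) = 1"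
    "pnorm (AM n) = (\<lambda>x. \<Sum>i=1..n. x i)"
    "shifted (AM n) l i = q ^ l i * t ^ (n - i)" for l i
    by (simp_all add: AM_def Let_def q_def t_def to_fract_def)
  have nd: "shifted (AM n) l i = node ?phi n l i" if "i \<in> {1..n}" for l i
    unfolding sel node_def int_diff_of_nat[OF that] by simp
  have nz: "q \<noteq> 0" "t \<noteq> 0" by (simp_all add: q_def t_def)
  have emb: "q ^ a * t ^ b = to_fract (Polynomial.monom (Polynomial.monom 1 a) b)" for a b
    unfolding q_def t_def to_fract_power[symmetric] to_fract_mult[symmetric]
    by (simp add: monom_altdef poly_const_pow del: to_fract_mult)
  show ?thesis
  proof (unfold_locales)
    show "perfect_grid ?phi ?phi"
    proof (rule perfect_grid_exponential[OF nz])
      fix a b assume "q powi a * t powi b = 1"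
      then have "q ^ nat a * t ^ nat b = q ^ nat (- a) * t ^ nat (- b)"
        using powi_eq_1D[of q a t b 1 0] nz by simp
      then have "nat a = nat (- a) \<and> nat b = nat (- b)"
        unfolding emb to_fract_eq_iff by (simp add: monom_eq_iff')
      then show "a = 0 \<and> b = 0" by auto
    qed
    fix l m :: "nat \<Rightarrow> nat"
    let ?p = "\<lambda>l. \<Sum>i=1..n. Polynomial.monom (Polynomial.monom 1 (l i)) (n - i) :: rat poly poly"
    have eq: "(\<Sum>i=1..n. node ?phi n l i) = to_fract (?p l)" for l
      unfolding to_fract_sum emb[symmetric] by (intro sum.cong refl) (simp add: nd[symmetric] sel)
    \<comment> \<open>The powers of t tell the rows apart, so the norm determines every part of the
      partition.\<close>
    have cf: "coeff (?p l) (n - j) = Polynomial.monom 1 (l j)" if j: "j \<in> {1..n}" for j l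
    proof -
      have "coeff (?p l) (n - j) = (\<Sum>i=1..n. if i = j then Polynomial.monom 1 (l i) else 0)"
        unfolding coeff_sum using j by (intro sum.cong refl) auto
      then show ?thesis using j by simp
    qed
    show "(\<Sum>i=1..n. node ?phi n l i) \<noteq> (\<Sum>i=1..n. node ?phi n m i)" if ne: "psize n l \<noteq> psize n m"
    proof
      assume "(\<Sum>i=1..n. node ?phi n l i) = (\<Sum>i=1..n. node ?phi n m i)"
      then have "?p l = ?p m" unfolding eq to_fract_eq_iff .
      then have "Polynomial.monom 1 (l j) = (Polynomial.monom 1 (m j) :: rat poly)" if "j \<in> {1..n}" for j
        using cf[OF that, of l] cf[OF that, of m] by simp
      then have "l j = m j" if "j \<in> {1..n}" for j using that by (simp add: monom_eq_iff')
      then have "psize n l = psize n m" unfolding psize_def by (rule sum.cong[OF refl])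
      then show False using ne by contradiction
    qed
  qed (simp_all add: sel(1-4) lact_lvar permutes_bij dominant_lvar lregular_lvar leval_lvar nd)
qed

lemma grid_family_BM:
  defines "q \<equiv> to_fract [:[:[:0, 1:]:]:] :: rat poly poly poly fract" and "t \<equiv> to_fract [:[:0, 1:]:]"
    and "\<alpha> \<equiv> to_fract [:0, 1:]"
  shows "grid_family (BM n) (\<lambda>a b. \<alpha> * q powi a * t powi b + inverse (\<alpha> * q powi a * t powi b))
    (\<lambda>a b. \<alpha> * q powi a * t powi b - inverse (\<alpha> * q powi a * t powi b)) n 1"
proof -
  let ?phi = "\<lambda>a b. \<alpha> * q powi a * t powi b + inverse (\<alpha> * q powi a * t powi b)"
  have sel: "nvars (BM n) = n" "gen (BM n) = (\<lambda>i. lvar i 1 + lvar i (- 1))" "deg_factor (BM n) = 1"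
    "pnorm (BM n) = (\<lambda>x. \<Sum>i=1..n. x i + inverse (x i))"
    "shifted (BM n) l i = \<alpha> * q ^ l i * t ^ (n - i)" for l i
    by (simp_all add: BM_def Let_def q_def t_def \<alpha>_def to_fract_def)
  have nd: "shifted (BM n) l i + inverse (shifted (BM n) l i) = node ?phi n l i" if "i \<in> {1..n}" for l i
    unfolding sel node_def int_diff_of_nat[OF that] by simp
  have nz: "q \<noteq> 0" "t \<noteq> 0" "\<alpha> \<noteq> 0" by (simp_all add: q_def t_def \<alpha>_def)
  have snz: "shifted (BM n) l i \<noteq> 0" for l i using nz by (simp add: sel)
  have emb: "q ^ a * t ^ b * \<alpha> ^ c = to_fract (Polynomial.monom (Polynomial.monom (Polynomial.monom 1 a) b) c)" for a b c
    unfolding q_def t_def \<alpha>_def to_fract_power[symmetric] to_fract_mult[symmetric]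
    by (simp add: monom_altdef poly_const_pow del: to_fract_mult)
  show ?thesis
  proof (unfold_locales)
    show "perfect_grid ?phi (\<lambda>a b. \<alpha> * q powi a * t powi b - inverse (\<alpha> * q powi a * t powi b))"
    proof (rule perfect_grid_hyperbolic[OF nz])
      fix a b c assume "q powi a * t powi b * \<alpha> powi c = 1"
      from powi_eq_1D[OF this nz] have "nat a = nat (- a) \<and> nat b = nat (- b) \<and> nat c = nat (- c)"
        unfolding emb to_fract_eq_iff by (simp add: monom_eq_iff')
      then show "a = 0 \<and> b = 0 \<and> c = 0" by auto
    qed
    fix l m :: "nat \<Rightarrow> nat"
    \<comment> \<open>One exponent serving both partitions: multiplying by \<open>?D\<close> clears
      the denominators of both norms, and no subtraction \<open>M - l i\<close> or
      \<open>M - m i\<close> is truncated.\<close>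
    define M where "M = psize n l + psize n m"
    let ?mon = "\<lambda>a b c. Polynomial.monom (Polynomial.monom (Polynomial.monom 1 a) b) c :: rat poly poly poly"
    let ?p = "\<lambda>l. \<Sum>i=1..n. ?mon (M + l i) (n + (n - i)) 2 + ?mon (M - l i) i 0"
    let ?D = "q ^ M * t ^ n * \<alpha>"
    have eq: "?D * (\<Sum>i=1..n. node ?phi n k i) = to_fract (?p k)" if "psize n k \<le> M" for k
      unfolding to_fract_sum to_fract_add emb[symmetric] sum_distrib_left
    proof (intro sum.cong refl)
      fix i assume i: "i \<in> {1..n}"
      let ?x = "\<alpha> * q ^ k i * t ^ (n - i)"
      have "k i \<le> psize n k" unfolding psize_def using i by (intro member_le_sum) auto
      then have "q ^ M = q ^ (M - k i) * q ^ k i" "t ^ n = t ^ i * t ^ (n - i)"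
        using that i by (simp_all flip: power_add)
      then have "?D * inverse ?x = q ^ (M - k i) * t ^ i * \<alpha> ^ 0"
        using nz by (simp add: field_simps)
      moreover have "?D * ?x = q ^ (M + k i) * t ^ (n + (n - i)) * \<alpha> ^ 2"
        by (simp add: power_add power2_eq_square)
      moreover have "?D * node ?phi n k i = ?D * ?x + ?D * inverse ?x"
        unfolding nd[OF i, of k, symmetric] sel by (rule distrib_left)
      ultimately show "?D * node ?phi n k i = q ^ (M + k i) * t ^ (n + (n - i)) * \<alpha> ^ 2 + q ^ (M - k i) * t ^ i * \<alpha> ^ 0"
        by simp
    qed
    \<comment> \<open>The terms quadratic in \<alpha> come from x and those free of \<alpha> from
      its inverse, so the former can be read off row by row through the powers of t.\<close>
    have cf: "coeff (coeff (?p k) 2) (n + (n - j)) = Polynomial.monom 1 (M + k j)" if j: "j \<in> {1..n}" for j k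
    proof -
      have "coeff (coeff (?p k) 2) (n + (n - j)) = (\<Sum>i=1..n. if i = j then Polynomial.monom 1 (M + k i) else 0)"
        unfolding coeff_sum using j by (intro sum.cong refl) auto
      then show ?thesis using j by simp
    qed
    show "(\<Sum>i=1..n. node ?phi n l i) \<noteq> (\<Sum>i=1..n. node ?phi n m i)" if ne: "psize n l \<noteq> psize n m"
    proof
      assume "(\<Sum>i=1..n. node ?phi n l i) = (\<Sum>i=1..n. node ?phi n m i)"
      then have "to_fract (?p l) = to_fract (?p m)" using eq[of l] eq[of m] by (simp add: M_def)
      then have pp: "?p l = ?p m" unfolding to_fract_eq_iff .
      have "l j = m j" if "j \<in> {1..n}" for j
      proof -
        have "Polynomial.monom 1 (M + l j) = (Polynomial.monom 1 (M + m j) :: rat poly)"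
          using cf[OF that, of l] cf[OF that, of m] unfolding pp by simp
        then show ?thesis by (simp add: monom_eq_iff')
      qed
      then have "psize n l = psize n m" unfolding psize_def by (rule sum.cong[OF refl])
      then show False using ne by contradiction
    qed
  qed (simp_all add: sel(1-4) lact_lvar lact_add permutes_bij dominant_lvar_inverse lregular_lvar lregular_add leval_lvar leval_add snz nd)
qed

lemma binom_weighted_sum:
  assumes "grid_family F \<phi> \<delta> n w" "l \<in> partitions n" "m \<in> partitions n"
  shows "binom F l m = (\<Sum>z\<in>saturated_chains n l m.
    chain_wt F z * (\<Prod>i<psize n l - psize n m. binom F (z ! i) (z ! Suc i)))"
  using grid_family.binom_eq_chain_sum[OF assms] unfolding grid_family.chain_sum_def[OF assms(1)] .

theorem theorem4:
  fixes n k :: nat and l m :: "nat \<Rightarrow> nat"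
  assumes "n \<ge> 1"
    and "l \<in> partitions n"
    and "m \<in> partitions n"
    and "k = psize n l - psize n m"
  shows
    "binom (AJ n) l m =
       (\<Sum>z\<in>saturated_chains n l m. chain_wt (AJ n) z * (\<Prod>i<k. binom (AJ n) (z ! i) (z ! Suc i))) \<and>
     binom (BJ n) l m =
       (\<Sum>z\<in>saturated_chains n l m. chain_wt (BJ n) z * (\<Prod>i<k. binom (BJ n) (z ! i) (z ! Suc i))) \<and>
     binom (AM n) l m =
       (\<Sum>z\<in>saturated_chains n l m. chain_wt (AM n) z * (\<Prod>i<k. binom (AM n) (z ! i) (z ! Suc i))) \<and>
     binom (BM n) l m =
       (\<Sum>z\<in>saturated_chains n l m. chain_wt (BM n) z * (\<Prod>i<k. binom (BM n) (z ! i) (z ! Suc i)))"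
proof -
  show ?thesis
    unfolding assms(4)
    by (intro conjI binom_weighted_sum[OF grid_family_AJ] binom_weighted_sum[OF grid_family_BJ]
        binom_weighted_sum[OF grid_family_AM] binom_weighted_sum[OF grid_family_BM] assms(2,3))
qed

end
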